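(* Let $\mathcal{U}$ be a good collection of open subsets of $[0,\infty)^m$ and let $(\mathcal{F}(U,\mathbb{R}))_{U\in\mathcal{U}}$ be a family of locally convex spaces suitable for global analysis. Let $M$ be an $m$-dimensional compact smooth manifold with corners and $N$ an $n$-dimensional smooth manifold which admits a local addition. Then the evaluation map $$\varepsilon:\mathcal{F}(M,N)\times M\to N,\quad(\gamma,p)\mapsto\gamma(p)$$ is continuous. Moreover, for each $p\in M$, the point evaluation map $$\varepsilon_p:\mathcal{F}(M,N)\to N,\quad\gamma\mapsto\gamma(p)$$ is smooth.
   Context: **Conventions.** Smoothness ($C^\infty$) of maps between open subsets of locally convex spaces is in the sense of Bastiani (Keller's $C^\infty_c$-calculus), and smooth manifolds may be modeled on locally convex spaces; maps on open subsets of $[0,\infty)^m$ are smooth in the usual sense for domains with corners. "Relatively compact in $U$" means having compact closure contained in $U$. A locally convex space is integral complete if every continuous path from $[0,1]$ to it has a weak integral in it. Fix $m\in\mathbb{N}$. **Good collection.** A set $\mathcal{U}$ of open subsets of $[0,\infty)^m$ is a good collection of open subsets if: (a) $\mathcal{U}$ is a basis for the topology of $[0,\infty)^m$; (b) if $U\in\mathcal{U}$ and $K\subseteq U$ is compact and non-empty, there is $V\in\mathcal{U}$ with compact closure $\overline V$ in $[0,\infty)^m$ such that $K\subseteq V$ and $\overline V\subseteq U$; (c) if $U\subseteq[0,\infty)^m$ is open and $W\in\mathcal{U}$ is relatively compact in $U$, there is $V\in\mathcal{U}$ relatively compact in $U$ with $\overline W\subseteq V$; (d) if $\phi:U\to V$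 is a $C^\infty$-diffeomorphism between open subsets of $[0,\infty)^m$ and $W\in\mathcal{U}$ is relatively compact in $U$, then $\phi(W)\in\mathcal{U}$. **Suitable family.** For each $U\in\mathcal{U}$ let $\mathcal{F}(U,\mathbb{R})$ be a vector subspace of the space $BC(U,\mathbb{R})$ of bounded continuous functions (with supremum norm), endowed with an integral complete locally convex topology making the inclusion $\mathcal{F}(U,\mathbb{R})\to BC(U,\mathbb{R})$ continuous. For a finite-dimensional real vector space $E$ with basis $b_1,\dots,b_n$ put $\mathcal{F}(U,E)=\sum_i\mathcal{F}(U,\mathbb{R})b_i$ with the topology making $\mathcal{F}(U,\mathbb{R})^n\to\mathcal{F}(U,E)$, $(f_i)_i\mapsto\sum_i f_ib_i$ an isomorphism of topological vector spaces. The family is suitable for global analysis if for all finite-dimensional real vector spaces $E,F$: (PF) for all $U,V\in\mathcal{U}$ with $V$ relatively compact in $U$ and each smooth $f:U\times E\to F$, one has $f_*(\gamma):=f\circ(\mathrm{id}_V,\gamma|_V)\in\mathcal{F}(V,F)$ for all $\gamma\in\mathcal{F}(U,E)$, and $f_*:\mathcal{F}(U,E)\to\mathcal{F}(V,F)$ is continuous; (PB) if $U\subseteq[0,\infty)^m$ is open, $V,W\in\mathcal{U}$, $W$ is relatively compact in $U$ and $\Theta:U\to V$ is a smooth diffeomorphism, then $\gamma\circ\Theta|_W\in\mathcal{F}(W,E)$ for all $\gamma\in\mathcal{F}(V,E)$ and $\mathcal{F}(V,E)\to\mathcal{F}(W,E)$, $\gamma\mapsto\gamma\circ\Theta|_W$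 is continuous; (GL) if $U,V\in\mathcal{U}$, $V\subseteq U$ and $\gamma\in\mathcal{F}(V,E)$ has compact support, then its extension by $0$ to $\tilde\gamma:U\to E$ lies in $\mathcal{F}(U,E)$, and for each compact $K\subseteq V$ the map $\mathcal{F}_K(V,E)\to\mathcal{F}(U,E)$, $\gamma\mapsto\tilde\gamma$ is continuous, where $\mathcal{F}_K(V,E)=\{\gamma\in\mathcal{F}(V,E):\mathrm{supp}(\gamma)\subseteq K\}$ has the induced topology; (MU) if $U\in\mathcal{U}$ and $h\in C_c^\infty(U,\mathbb{R})$, then $h\gamma\in\mathcal{F}(U,E)$ for all $\gamma\in\mathcal{F}(U,E)$ and $\gamma\mapsto h\gamma$ is a continuous self-map of $\mathcal{F}(U,E)$. **Manifolds and mapping spaces.** An $m$-dimensional smooth manifold with corners is a paracompact Hausdorff space with a maximal atlas of smoothly compatible charts onto open subsets of $[0,\infty)^m$; "smooth manifold" means without boundary. For $M$ an $m$-dimensional compact smooth manifold with corners and $N$ an $n$-dimensional smooth manifold, $\mathcal{F}(M,N)$ is the set of all functions $\gamma:M\to N$ such that for each $p\in M$ there are charts $\phi_M:U_M\to V_M$ of $M$ with $p\in U_M$, $V_M\in\mathcal{U}$, and $\phi_N:U_N\to V_N$ of $N$ with $\gamma(U_M)\subseteq U_N$ and $\phi_N\circ\gamma\circ\phi_M^{-1}\in\mathcal{F}(V_M,\mathbb{R}^n)$. Let $\pi_N:TN\to N$ be the tangent bundle. For $\gamma\in\mathcal{F}(M,N)$ let $\Gamma_{\mathcal{F}}(\gamma)=\{\sigma\in\mathcal{F}(M,TN):\pi_N\circ\sigma=\gamma\}$,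 a vector space under pointwise operations, with the initial locally convex topology with respect to the maps $\Gamma_{\mathcal{F}}(\gamma)\to\mathcal{F}(W,\mathbb{R}^n)$, $\sigma\mapsto d\phi\circ\sigma\circ\varphi^{-1}|_W$, where $\varphi:U_\varphi\to V_\varphi$ is a chart of $M$, $W\in\mathcal{U}$ is relatively compact in $V_\varphi$, and $\phi:U_\phi\to V_\phi$ is a chart of $N$ with $\gamma(U_\varphi)\subseteq U_\phi$; here $d\phi:TU_\phi\to\mathbb{R}^n$ is the second component of $T\phi:TU_\phi\to V_\phi\times\mathbb{R}^n$. **Local addition and manifold structure.** A local addition on $N$ is a smooth map $\Sigma:\Omega\to N$ on an open neighborhood $\Omega\subseteq TN$ of the zero-section $\{0_p\in T_pN:p\in N\}$ with $\Sigma(0_p)=p$ for all $p\in N$, such that $\Omega':=(\pi_N,\Sigma)(\Omega)$ is open in $N\times N$ and $\theta_N:=(\pi_N,\Sigma):\Omega\to\Omega'$ is a $C^\infty$-diffeomorphism. Put $\mathcal{V}_\gamma=\{\sigma\in\Gamma_{\mathcal{F}}(\gamma):\sigma(M)\subseteq\Omega\}$ (open in $\Gamma_{\mathcal{F}}(\gamma)$) and $\mathcal{U}_\gamma=\{\xi\in\mathcal{F}(M,N):(\gamma,\xi)(M)\subseteq\Omega'\}$. The map $\Psi_\gamma:\mathcal{V}_\gamma\to\mathcal{U}_\gamma$, $\sigma\mapsto\Sigma\circ\sigma$ is a bijection with inverse $\xi\mapsto\theta_N^{-1}\circ(\gamma,\xi)$. $\mathcal{F}(M,N)$ carries the smooth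 manifold structure with atlas $\{\Psi_\gamma^{-1}:\mathcal{U}_\gamma\to\mathcal{V}_\gamma\mid\gamma\in\mathcal{F}(M,N)\}$ (it exists and does not depend on the choice of local addition). *)

theory Defs
  imports "HOL-Analysis.Analysis"
begin

section \<open>Locally convex spaces\<close>

text \<open>
  A locally convex space is given by explicit operations on the carrier
  \<open>topspace (ltop E)\<close>. Explicit carriers are needed because the vector addition of
  a space of sections depends on the section's base map, and because dimensions vary
  inside hypotheses.
\<close>

record 'a lcs =
  ltop :: "'a topology"
  lzero :: 'a
  ladd :: "'a \<Rightarrow> 'a \<Rightarrow> 'a"
  lscale :: "real \<Rightarrow> 'a \<Rightarrow> 'a"

abbreviation lcarrier :: "'a lcs \<Rightarrow> 'a set" where
  "lcarrier E \<equiv> topspace (ltop E)"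

definition vector_space_lcs :: "'a lcs \<Rightarrow> bool" where
  "vector_space_lcs E \<longleftrightarrow>
     lzero E \<in> lcarrier E \<and>
     (\<forall>x\<in>lcarrier E. \<forall>y\<in>lcarrier E. ladd E x y \<in> lcarrier E) \<and>
     (\<forall>r. \<forall>x\<in>lcarrier E. lscale E r x \<in> lcarrier E) \<and>
     (\<forall>x\<in>lcarrier E. \<forall>y\<in>lcarrier E. \<forall>z\<in>lcarrier E.
        ladd E (ladd E x y) z = ladd E x (ladd E y z)) \<and>
     (\<forall>x\<in>lcarrier E. \<forall>y\<in>lcarrier E. ladd E x y = ladd E y x) \<and>
     (\<forall>x\<in>lcarrier E. ladd E x (lzero E) = x) \<and>
     (\<forall>x\<in>lcarrier E. ladd E x (lscale E (-1) x) = lzero E) \<and>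
     (\<forall>r. \<forall>x\<in>lcarrier E. \<forall>y\<in>lcarrier E.
        lscale E r (ladd E x y) = ladd E (lscale E r x) (lscale E r y)) \<and>
     (\<forall>r s. \<forall>x\<in>lcarrier E. lscale E (r + s) x = ladd E (lscale E r x) (lscale E s x)) \<and>
     (\<forall>r s. \<forall>x\<in>lcarrier E. lscale E (r * s) x = lscale E r (lscale E s x)) \<and>
     (\<forall>x\<in>lcarrier E. lscale E 1 x = x)"

definition convex_in :: "'a lcs \<Rightarrow> 'a set \<Rightarrow> bool" where
  "convex_in E C \<longleftrightarrow>
     (\<forall>x\<in>C. \<forall>y\<in>C. \<forall>t\<in>{0..1}. ladd E (lscale E (1 - t) x) (lscale E t y) \<in> C)"

definition locally_convex_space :: "'a lcs \<Rightarrow> bool" where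
  "locally_convex_space E \<longleftrightarrow>
     vector_space_lcs E \<and>
     Hausdorff_space (ltop E) \<and>
     continuous_map (prod_topology (ltop E) (ltop E)) (ltop E) (\<lambda>(x, y). ladd E x y) \<and>
     continuous_map (prod_topology euclideanreal (ltop E)) (ltop E) (\<lambda>(r, x). lscale E r x) \<and>
     (\<forall>W. openin (ltop E) W \<and> lzero E \<in> W \<longrightarrow>
        (\<exists>C. openin (ltop E) C \<and> lzero E \<in> C \<and> C \<subseteq> W \<and> convex_in E C))"

definition dual_lcs :: "'a lcs \<Rightarrow> ('a \<Rightarrow> real) set" where
  "dual_lcs E = {l. continuous_map (ltop E) euclideanreal l \<and>
     (\<forall>x\<in>lcarrier E. \<forall>y\<in>lcarrier E. l (ladd E x y) = l x + l y) \<and>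
     (\<forall>r. \<forall>x\<in>lcarrier E. l (lscale E r x) = r * l x)}"

definition weak_integral :: "'a lcs \<Rightarrow> (real \<Rightarrow> 'a) \<Rightarrow> 'a \<Rightarrow> bool" where
  "weak_integral E c z \<longleftrightarrow>
     z \<in> lcarrier E \<and> (\<forall>l\<in>dual_lcs E. ((\<lambda>t. l (c t)) has_integral l z) {0..1})"

definition integral_complete :: "'a lcs \<Rightarrow> bool" where
  "integral_complete E \<longleftrightarrow> (\<forall>c. pathin (ltop E) c \<longrightarrow> (\<exists>z. weak_integral E c z))"

text \<open>
  The space \<open>\<real>\<^sup>n\<close>, for every natural number \<open>n\<close> including 0, on the functions
  \<open>nat \<Rightarrow> real\<close> that vanish from index \<open>n\<close> on.
\<close>

definition euclid :: "nat \<Rightarrow> (nat \<Rightarrow> real) lcs" where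
  "euclid n = \<lparr>ltop = Euclidean_space n, lzero = (\<lambda>i. 0),
     ladd = (\<lambda>x y i. x i + y i), lscale = (\<lambda>r x i. r * x i)\<rparr>"

definition real_lcs :: "real lcs" where
  "real_lcs = \<lparr>ltop = euclideanreal, lzero = 0, ladd = (+), lscale = (*)\<rparr>"

definition prod_lcs :: "'a lcs \<Rightarrow> 'b lcs \<Rightarrow> ('a \<times> 'b) lcs" where
  "prod_lcs E F = \<lparr>ltop = prod_topology (ltop E) (ltop F), lzero = (lzero E, lzero F),
     ladd = (\<lambda>(x, y) (x', y'). (ladd E x x', ladd F y y')),
     lscale = (\<lambda>r (x, y). (lscale E r x, lscale F r y))\<rparr>"


section \<open>Bastiani calculus\<close>

definition has_dirderiv ::
  "'a lcs \<Rightarrow> 'b lcs \<Rightarrow> ('a \<Rightarrow> 'b) \<Rightarrow> 'a \<Rightarrow> 'a \<Rightarrow> 'b \<Rightarrow> bool" where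
  "has_dirderiv E F f x y l \<longleftrightarrow>
     limitin (ltop F)
       (\<lambda>t. lscale F (1 / t) (ladd F (f (ladd E x (lscale E t y))) (lscale F (-1) (f x))))
       l (at 0)"

text \<open>
  A map \<open>f\<close> on \<open>U\<close> is smooth if it is continuous, all iterated directional derivatives
  \<open>d\<^sup>(\<^sup>k\<^sup>) f (x, y\<^sub>1, \<dots>, y\<^sub>k) = (D\<^bsub>y\<^sub>k\<^esub> \<dots> D\<^bsub>y\<^sub>1\<^esub> f) (x)\<close> exist for \<open>x\<close> in the interior of \<open>U\<close>,
  and they extend to continuous maps \<open>U \<times> E\<^sup>k \<rightarrow> F\<close>. The map \<open>D k\<close> below is that continuous
  extension of \<open>d\<^sup>(\<^sup>k\<^sup>) f\<close>, with the directions \<open>y\<^sub>1, \<dots>, y\<^sub>k\<close> stored at the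
  indices \<open>0, \<dots>, k - 1\<close>. For open \<open>U\<close> this is Bastiani's notion; for sets with corners
  (relatively open subsets of \<open>[0,\<infinity>)\<^sup>m\<close> or of \<open>[0,\<infinity>)\<^sup>m \<times> \<real>\<^sup>k\<close>) it is the usual extension of it.
  It is only meant for sets \<open>U\<close> with dense interior.
\<close>

definition bsmooth :: "'a lcs \<Rightarrow> 'b lcs \<Rightarrow> 'a set \<Rightarrow> ('a \<Rightarrow> 'b) \<Rightarrow> bool" where
  "bsmooth E F U f \<longleftrightarrow>
     U \<subseteq> lcarrier E \<and>
     (\<exists>D :: nat \<Rightarrow> 'a \<times> (nat \<Rightarrow> 'a) \<Rightarrow> 'b.
        (\<forall>x\<in>U. D 0 (x, \<lambda>_. undefined) = f x) \<and>
        (\<forall>k. continuous_map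
               (prod_topology (subtopology (ltop E) U) (product_topology (\<lambda>_. ltop E) {..<k}))
               (ltop F) (D k)) \<and>
        (\<forall>k. \<forall>x \<in> (ltop E) interior_of U. \<forall>ys \<in> {..<Suc k} \<rightarrow>\<^sub>E lcarrier E.
           has_dirderiv E F (\<lambda>z. D k (z, restrict ys {..<k})) x (ys k) (D (Suc k) (x, ys))))"

definition diffeo :: "'a lcs \<Rightarrow> 'b lcs \<Rightarrow> 'a set \<Rightarrow> 'b set \<Rightarrow> ('a \<Rightarrow> 'b) \<Rightarrow> bool" where
  "diffeo E F U V f \<longleftrightarrow>
     bij_betw f U V \<and> bsmooth E F U f \<and> bsmooth F E V (inv_into U f)"


section \<open>Good collections and families suitable for global analysis\<close>

definition orthant :: "nat \<Rightarrow> (nat \<Rightarrow> real) set" where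
  "orthant m = {x \<in> lcarrier (euclid m). \<forall>i<m. 0 \<le> x i}"

abbreviation orthant_top :: "nat \<Rightarrow> (nat \<Rightarrow> real) topology" where
  "orthant_top m \<equiv> subtopology (ltop (euclid m)) (orthant m)"

definition relatively_compact_in :: "'a topology \<Rightarrow> 'a set \<Rightarrow> 'a set \<Rightarrow> bool" where
  "relatively_compact_in X W U \<longleftrightarrow> compactin X (X closure_of W) \<and> X closure_of W \<subseteq> U"

definition good_collection :: "nat \<Rightarrow> (nat \<Rightarrow> real) set set \<Rightarrow> bool" where
  "good_collection m \<U> \<longleftrightarrow>
     openin (orthant_top m) = arbitrary union_of (\<lambda>U. U \<in> \<U>) \<and>
     (\<forall>U\<in>\<U>. \<forall>K. compactin (orthant_top m) K \<and> K \<noteq> {} \<and> K \<subseteq> U \<longrightarrow>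
        (\<exists>V\<in>\<U>. relatively_compact_in (orthant_top m) V U \<and> K \<subseteq> V)) \<and>
     (\<forall>U W. openin (orthant_top m) U \<and> W \<in> \<U> \<and> relatively_compact_in (orthant_top m) W U \<longrightarrow>
        (\<exists>V\<in>\<U>. relatively_compact_in (orthant_top m) V U \<and> orthant_top m closure_of W \<subseteq> V)) \<and>
     (\<forall>U V W \<phi>. openin (orthant_top m) U \<and> openin (orthant_top m) V \<and>
        diffeo (euclid m) (euclid m) U V \<phi> \<and>
        W \<in> \<U> \<and> relatively_compact_in (orthant_top m) W U \<longrightarrow> \<phi> ` W \<in> \<U>)"

text \<open>
  A function space on \<open>U\<close> consists of functions that are extensional on \<open>U\<close>. Its vector
  operations are the pointwise ones, so the family \<open>(\<F>(U,\<real>))\<^sub>U\<close> is given by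
  the topologies alone.
\<close>

definition fun_lcs :: "'x set \<Rightarrow> ('x \<Rightarrow> real) topology \<Rightarrow> ('x \<Rightarrow> real) lcs" where
  "fun_lcs U T = \<lparr>ltop = T, lzero = (\<lambda>x\<in>U. 0),
     ladd = (\<lambda>f g. \<lambda>x\<in>U. f x + g x), lscale = (\<lambda>r f. \<lambda>x\<in>U. r * f x)\<rparr>"

text \<open>The bounded continuous real functions on \<open>U\<close>, with the supremum metric.\<close>

definition BC :: "nat \<Rightarrow> (nat \<Rightarrow> real) set \<Rightarrow> ((nat \<Rightarrow> real) \<Rightarrow> real) topology" where
  "BC m U = mtopology_of (cfunspace (subtopology (ltop (euclid m)) U) euclidean_metric)"

definition function_family ::
  "nat \<Rightarrow> (nat \<Rightarrow> real) set set \<Rightarrow> ((nat \<Rightarrow> real) set \<Rightarrow> ((nat \<Rightarrow> real) \<Rightarrow> real) topology) \<Rightarrow> bool"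
  where
  "function_family m \<U> \<F> \<longleftrightarrow>
     (\<forall>U\<in>\<U>. topspace (\<F> U) \<subseteq> topspace (BC m U) \<and>
        locally_convex_space (fun_lcs U (\<F> U)) \<and>
        integral_complete (fun_lcs U (\<F> U)) \<and>
        continuous_map (\<F> U) (BC m U) (\<lambda>f. f))"

text \<open>
  The space \<open>\<F>(U,\<real>\<^sup>k)\<close>: its topology is transported from \<open>\<F>(U,\<real>)\<^sup>k\<close> along
  \<open>(f\<^sub>i)\<^sub>i \<mapsto> \<Sum>\<^sub>i f\<^sub>i e\<^sub>i\<close>.
\<close>

definition vec_fun ::
  "((nat \<Rightarrow> real) set \<Rightarrow> ((nat \<Rightarrow> real) \<Rightarrow> real) topology) \<Rightarrow> nat \<Rightarrow>
   (nat \<Rightarrow> real) set \<Rightarrow> ((nat \<Rightarrow> real) \<Rightarrow> (nat \<Rightarrow> real)) topology" where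
  "vec_fun \<F> k U =
     pullback_topology (U \<rightarrow>\<^sub>E lcarrier (euclid k)) (\<lambda>\<gamma>. \<lambda>i\<in>{..<k}. \<lambda>x\<in>U. \<gamma> x i)
       (product_topology (\<lambda>_. \<F> U) {..<k})"

definition support_in :: "'x topology \<Rightarrow> 'a \<Rightarrow> ('x \<Rightarrow> 'a) \<Rightarrow> 'x set" where
  "support_in X z f = X closure_of {x \<in> topspace X. f x \<noteq> z}"

abbreviation vec_support :: "nat \<Rightarrow> (nat \<Rightarrow> real) set \<Rightarrow> ((nat \<Rightarrow> real) \<Rightarrow> (nat \<Rightarrow> real)) \<Rightarrow> (nat \<Rightarrow> real) set" where
  "vec_support m U \<equiv> support_in (subtopology (ltop (euclid m)) U) (\<lambda>i. 0)"

definition extend_by_zero ::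
  "(nat \<Rightarrow> real) set \<Rightarrow> (nat \<Rightarrow> real) set \<Rightarrow> ((nat \<Rightarrow> real) \<Rightarrow> (nat \<Rightarrow> real)) \<Rightarrow>
   (nat \<Rightarrow> real) \<Rightarrow> (nat \<Rightarrow> real)" where
  "extend_by_zero V U \<gamma> = (\<lambda>x\<in>U. if x \<in> V then \<gamma> x else (\<lambda>i. 0))"

definition axiom_PF where
  "axiom_PF m \<U> \<F> \<longleftrightarrow>
     (\<forall>k l. \<forall>U\<in>\<U>. \<forall>V\<in>\<U>. \<forall>f.
        relatively_compact_in (orthant_top m) V U \<and>
        bsmooth (prod_lcs (euclid m) (euclid k)) (euclid l) (U \<times> lcarrier (euclid k)) f \<longrightarrow>
        continuous_map (vec_fun \<F> k U) (vec_fun \<F> l V) (\<lambda>\<gamma>. \<lambda>x\<in>V. f (x, \<gamma> x)))"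

definition axiom_PB where
  "axiom_PB m \<U> \<F> \<longleftrightarrow>
     (\<forall>k U \<Theta>. \<forall>V\<in>\<U>. \<forall>W\<in>\<U>.
        openin (orthant_top m) U \<and> relatively_compact_in (orthant_top m) W U \<and>
        diffeo (euclid m) (euclid m) U V \<Theta> \<longrightarrow>
        continuous_map (vec_fun \<F> k V) (vec_fun \<F> k W) (\<lambda>\<gamma>. \<lambda>x\<in>W. \<gamma> (\<Theta> x)))"

definition axiom_GL where
  "axiom_GL m \<U> \<F> \<longleftrightarrow>
     (\<forall>k. \<forall>U\<in>\<U>. \<forall>V\<in>\<U>. V \<subseteq> U \<longrightarrow>
        (\<forall>\<gamma>\<in>topspace (vec_fun \<F> k V).
           compactin (orthant_top m) (vec_support m V \<gamma>) \<longrightarrow>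
           extend_by_zero V U \<gamma> \<in> topspace (vec_fun \<F> k U)) \<and>
        (\<forall>K. compactin (orthant_top m) K \<and> K \<subseteq> V \<longrightarrow>
           continuous_map (subtopology (vec_fun \<F> k V) {\<gamma>. vec_support m V \<gamma> \<subseteq> K})
             (vec_fun \<F> k U) (extend_by_zero V U)))"

definition axiom_MU where
  "axiom_MU m \<U> \<F> \<longleftrightarrow>
     (\<forall>k. \<forall>U\<in>\<U>. \<forall>h :: (nat \<Rightarrow> real) \<Rightarrow> real.
        bsmooth (euclid m) real_lcs U h \<and>
        compactin (orthant_top m) (support_in (subtopology (ltop (euclid m)) U) 0 h) \<longrightarrow>
        continuous_map (vec_fun \<F> k U) (vec_fun \<F> k U) (\<lambda>\<gamma>. \<lambda>x\<in>U. lscale (euclid k) (h x) (\<gamma> x)))"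

text \<open>
  The finite-dimensional spaces \<open>E, F\<close> in the axioms range over the \<open>\<real>\<^sup>k\<close>; since \<open>\<F>(U,E)\<close>
  is defined through a basis of \<open>E\<close>, other finite-dimensional spaces give the same conditions.
\<close>

definition suitable_for_global_analysis ::
  "nat \<Rightarrow> (nat \<Rightarrow> real) set set \<Rightarrow> ((nat \<Rightarrow> real) set \<Rightarrow> ((nat \<Rightarrow> real) \<Rightarrow> real) topology) \<Rightarrow> bool"
  where
  "suitable_for_global_analysis m \<U> \<F> \<longleftrightarrow>
     function_family m \<U> \<F> \<and>
     axiom_PF m \<U> \<F> \<and> axiom_PB m \<U> \<F> \<and> axiom_GL m \<U> \<F> \<and> axiom_MU m \<U> \<F>"


section \<open>Manifolds\<close>

text \<open>
  Each chart carries its own modelling space, as needed for manifolds modelled on locally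
  convex spaces.
\<close>

record ('p, 'e) chart =
  ch_model :: "'e lcs"
  ch_dom :: "'p set"
  ch_map :: "'p \<Rightarrow> 'e"

abbreviation ch_img :: "('p, 'e) chart \<Rightarrow> 'e set" where
  "ch_img c \<equiv> ch_map c ` ch_dom c"

abbreviation ch_inv :: "('p, 'e) chart \<Rightarrow> 'e \<Rightarrow> 'p" where
  "ch_inv c \<equiv> inv_into (ch_dom c) (ch_map c)"

record ('p, 'e) mfd =
  mfd_top :: "'p topology"
  mfd_atlas :: "('p, 'e) chart set"

abbreviation points :: "('p, 'e) mfd \<Rightarrow> 'p set" where
  "points P \<equiv> topspace (mfd_top P)"

definition is_chart :: "'p topology \<Rightarrow> 'e lcs \<Rightarrow> 'e set \<Rightarrow> ('p, 'e) chart \<Rightarrow> bool" where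
  "is_chart X E Q c \<longleftrightarrow>
     ch_model c = E \<and> openin X (ch_dom c) \<and> ch_map c \<in> extensional (ch_dom c) \<and>
     openin (subtopology (ltop E) Q) (ch_img c) \<and>
     homeomorphic_map (subtopology X (ch_dom c)) (subtopology (ltop E) (ch_img c)) (ch_map c)"

definition smoothly_compatible :: "('p, 'e) chart \<Rightarrow> ('p, 'e) chart \<Rightarrow> bool" where
  "smoothly_compatible c d \<longleftrightarrow>
     bsmooth (ch_model c) (ch_model d) (ch_map c ` (ch_dom c \<inter> ch_dom d)) (ch_map d \<circ> ch_inv c) \<and>
     bsmooth (ch_model d) (ch_model c) (ch_map d ` (ch_dom c \<inter> ch_dom d)) (ch_map c \<circ> ch_inv d)"

text \<open>The charts onto open subsets of \<open>Q \<subseteq> E\<close> which are compatible with all charts in \<open>A\<close>.\<close>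

definition compatible_charts ::
  "'p topology \<Rightarrow> 'e lcs \<Rightarrow> 'e set \<Rightarrow> ('p, 'e) chart set \<Rightarrow> ('p, 'e) chart set" where
  "compatible_charts X E Q A = {c. is_chart X E Q c \<and> (\<forall>d\<in>A. smoothly_compatible c d)}"

definition maximal_atlas :: "'p topology \<Rightarrow> 'e lcs \<Rightarrow> 'e set \<Rightarrow> ('p, 'e) chart set \<Rightarrow> bool" where
  "maximal_atlas X E Q A \<longleftrightarrow>
     (\<Union>c\<in>A. ch_dom c) = topspace X \<and>
     (\<forall>c\<in>A. is_chart X E Q c) \<and>
     (\<forall>c\<in>A. \<forall>d\<in>A. smoothly_compatible c d) \<and>
     compatible_charts X E Q A \<subseteq> A"

definition paracompact_space :: "'p topology \<Rightarrow> bool" where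
  "paracompact_space X \<longleftrightarrow>
     (\<forall>\<C>. (\<forall>C\<in>\<C>. openin X C) \<and> \<Union>\<C> = topspace X \<longrightarrow>
        (\<exists>\<D>. (\<forall>D\<in>\<D>. openin X D) \<and> \<Union>\<D> = topspace X \<and>
             (\<forall>D\<in>\<D>. \<exists>C\<in>\<C>. D \<subseteq> C) \<and> locally_finite_in X \<D>))"

definition manifold_with_corners :: "nat \<Rightarrow> ('p, nat \<Rightarrow> real) mfd \<Rightarrow> bool" where
  "manifold_with_corners m M \<longleftrightarrow>
     Hausdorff_space (mfd_top M) \<and> paracompact_space (mfd_top M) \<and>
     maximal_atlas (mfd_top M) (euclid m) (orthant m) (mfd_atlas M)"

text \<open>Manifolds without boundary.\<close>

definition smooth_manifold :: "nat \<Rightarrow> ('p, nat \<Rightarrow> real) mfd \<Rightarrow> bool" where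
  "smooth_manifold n N \<longleftrightarrow>
     Hausdorff_space (mfd_top N) \<and> paracompact_space (mfd_top N) \<and>
     maximal_atlas (mfd_top N) (euclid n) (lcarrier (euclid n)) (mfd_atlas N)"

text \<open>
  Smoothness of a map on an open subset \<open>S\<close> of a manifold. It can be tested in any atlas,
  so it is also used below for manifolds specified by a non-maximal atlas.
\<close>

definition smooth_map_on ::
  "('p, 'e) mfd \<Rightarrow> ('q, 'f) mfd \<Rightarrow> 'p set \<Rightarrow> ('p \<Rightarrow> 'q) \<Rightarrow> bool" where
  "smooth_map_on P Q S f \<longleftrightarrow>
     openin (mfd_top P) S \<and>
     continuous_map (subtopology (mfd_top P) S) (mfd_top Q) f \<and>
     (\<forall>c\<in>mfd_atlas P. \<forall>d\<in>mfd_atlas Q.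
        bsmooth (ch_model c) (ch_model d)
          (ch_map c ` {p \<in> ch_dom c \<inter> S. f p \<in> ch_dom d}) (ch_map d \<circ> f \<circ> ch_inv c))"

text \<open>The topology on \<open>X\<close> making the given charts homeomorphisms between open sets.\<close>

definition atlas_topology :: "'p set \<Rightarrow> ('p, 'e) chart set \<Rightarrow> 'p topology" where
  "atlas_topology X A =
     topology (\<lambda>W. W \<subseteq> X \<and> (\<forall>c\<in>A. openin (ltop (ch_model c)) (ch_map c ` (W \<inter> ch_dom c))))"

definition prod_chart :: "('p, 'e) chart \<Rightarrow> ('q, 'f) chart \<Rightarrow> ('p \<times> 'q, 'e \<times> 'f) chart" where
  "prod_chart c d = \<lparr>ch_model = prod_lcs (ch_model c) (ch_model d),
     ch_dom = ch_dom c \<times> ch_dom d,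
     ch_map = restrict (map_prod (ch_map c) (ch_map d)) (ch_dom c \<times> ch_dom d)\<rparr>"

definition prod_mfd :: "('p, 'e) mfd \<Rightarrow> ('q, 'f) mfd \<Rightarrow> ('p \<times> 'q, 'e \<times> 'f) mfd" where
  "prod_mfd P Q = \<lparr>mfd_top = prod_topology (mfd_top P) (mfd_top Q),
     mfd_atlas = {prod_chart c d | c d. c \<in> mfd_atlas P \<and> d \<in> mfd_atlas Q}\<rparr>"


section \<open>Tangent bundles and local additions\<close>

text \<open>
  A tangent vector at \<open>p\<close> is a pair \<open>(p, v)\<close>, where \<open>v\<close> assigns to each chart around \<open>p\<close> the
  coordinate vector in that chart, such that coordinate vectors transform by the
  derivatives of the chart changes.
\<close>

type_synonym 'q tangent = "'q \<times> (('q, nat \<Rightarrow> real) chart \<Rightarrow> (nat \<Rightarrow> real))"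

definition charts_at :: "('q, nat \<Rightarrow> real) mfd \<Rightarrow> 'q \<Rightarrow> ('q, nat \<Rightarrow> real) chart set" where
  "charts_at N p = {c \<in> mfd_atlas N. p \<in> ch_dom c}"

definition tangent_space :: "('q, nat \<Rightarrow> real) mfd \<Rightarrow> 'q \<Rightarrow> 'q tangent set" where
  "tangent_space N p = {(p, v) | v.
     v \<in> extensional (charts_at N p) \<and>
     (\<forall>c\<in>charts_at N p. v c \<in> lcarrier (ch_model c)) \<and>
     (\<forall>c\<in>charts_at N p. \<forall>d\<in>charts_at N p.
        has_dirderiv (ch_model c) (ch_model d) (ch_map d \<circ> ch_inv c) (ch_map c p) (v c) (v d))}"

definition tangent_zero :: "('q, nat \<Rightarrow> real) mfd \<Rightarrow> 'q \<Rightarrow> 'q tangent" where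
  "tangent_zero N p = (p, \<lambda>c\<in>charts_at N p. lzero (ch_model c))"

text \<open>Only meaningful for two tangent vectors with the same base point.\<close>

definition tangent_add ::
  "('q, nat \<Rightarrow> real) mfd \<Rightarrow> 'q tangent \<Rightarrow> 'q tangent \<Rightarrow> 'q tangent" where
  "tangent_add N x y =
     (fst x, \<lambda>c\<in>charts_at N (fst x). ladd (ch_model c) (snd x c) (snd y c))"

definition tangent_scale ::
  "('q, nat \<Rightarrow> real) mfd \<Rightarrow> real \<Rightarrow> 'q tangent \<Rightarrow> 'q tangent" where
  "tangent_scale N r x = (fst x, \<lambda>c\<in>charts_at N (fst x). lscale (ch_model c) r (snd x c))"

definition tangent_points :: "('q, nat \<Rightarrow> real) mfd \<Rightarrow> 'q tangent set" where
  "tangent_points N = (\<Union>p\<in>points N. tangent_space N p)"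

text \<open>The identification \<open>\<real>\<^sup>n \<times> \<real>\<^sup>n \<cong> \<real>\<^sup>2\<^sup>n\<close>.\<close>

definition join_coords :: "nat \<Rightarrow> (nat \<Rightarrow> real) \<Rightarrow> (nat \<Rightarrow> real) \<Rightarrow> (nat \<Rightarrow> real)" where
  "join_coords n x y = (\<lambda>i. if i < n then x i else y (i - n))"

definition tangent_chart ::
  "nat \<Rightarrow> ('q, nat \<Rightarrow> real) mfd \<Rightarrow> ('q, nat \<Rightarrow> real) chart \<Rightarrow>
   ('q tangent, nat \<Rightarrow> real) chart" where
  "tangent_chart n N c = \<lparr>ch_model = euclid (2 * n),
     ch_dom = {x \<in> tangent_points N. fst x \<in> ch_dom c},
     ch_map = (\<lambda>x\<in>{x \<in> tangent_points N. fst x \<in> ch_dom c}.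
                 join_coords n (ch_map c (fst x)) (snd x c))\<rparr>"

definition tangent_bundle ::
  "nat \<Rightarrow> ('q, nat \<Rightarrow> real) mfd \<Rightarrow> ('q tangent, nat \<Rightarrow> real) mfd" where
  "tangent_bundle n N =
     (let A = tangent_chart n N ` mfd_atlas N;
          X = atlas_topology (tangent_points N) A
      in \<lparr>mfd_top = X,
          mfd_atlas = compatible_charts X (euclid (2 * n)) (lcarrier (euclid (2 * n))) A\<rparr>)"

definition local_addition ::
  "nat \<Rightarrow> ('q, nat \<Rightarrow> real) mfd \<Rightarrow> 'q tangent set \<Rightarrow> ('q tangent \<Rightarrow> 'q) \<Rightarrow> bool" where
  "local_addition n N \<Omega> \<Sigma> \<longleftrightarrow>
     (let TN = tangent_bundle n N; \<theta> = (\<lambda>x. (fst x, \<Sigma> x)) in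
        openin (mfd_top TN) \<Omega> \<and>
        (\<forall>p\<in>points N. tangent_zero N p \<in> \<Omega>) \<and>
        smooth_map_on TN N \<Omega> \<Sigma> \<and>
        (\<forall>p\<in>points N. \<Sigma> (tangent_zero N p) = p) \<and>
        openin (mfd_top (prod_mfd N N)) (\<theta> ` \<Omega>) \<and>
        inj_on \<theta> \<Omega> \<and>
        smooth_map_on TN (prod_mfd N N) \<Omega> \<theta> \<and>
        smooth_map_on (prod_mfd N N) TN (\<theta> ` \<Omega>) (inv_into \<Omega> \<theta>))"


section \<open>Manifolds of mappings\<close>

text \<open>The set \<open>\<F>(M,N)\<close>, where \<open>k\<close> is the dimension of \<open>N\<close>.\<close>

definition maps ::
  "(nat \<Rightarrow> real) set set \<Rightarrow> ((nat \<Rightarrow> real) set \<Rightarrow> ((nat \<Rightarrow> real) \<Rightarrow> real) topology) \<Rightarrow>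
   ('p, nat \<Rightarrow> real) mfd \<Rightarrow> nat \<Rightarrow> ('q, nat \<Rightarrow> real) mfd \<Rightarrow> ('p \<Rightarrow> 'q) set" where
  "maps \<U> \<F> M k N = {\<gamma> \<in> points M \<rightarrow>\<^sub>E points N.
     \<forall>p\<in>points M. \<exists>c\<in>mfd_atlas M. \<exists>d\<in>mfd_atlas N.
        p \<in> ch_dom c \<and> ch_img c \<in> \<U> \<and> \<gamma> ` ch_dom c \<subseteq> ch_dom d \<and>
        (\<lambda>x\<in>ch_img c. ch_map d (\<gamma> (ch_inv c x))) \<in> topspace (vec_fun \<F> k (ch_img c))}"

definition sections ::
  "(nat \<Rightarrow> real) set set \<Rightarrow> ((nat \<Rightarrow> real) set \<Rightarrow> ((nat \<Rightarrow> real) \<Rightarrow> real) topology) \<Rightarrow>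
   ('p, nat \<Rightarrow> real) mfd \<Rightarrow> nat \<Rightarrow> ('q, nat \<Rightarrow> real) mfd \<Rightarrow> ('p \<Rightarrow> 'q) \<Rightarrow>
   ('p \<Rightarrow> 'q tangent) set" where
  "sections \<U> \<F> M n N \<gamma> =
     {\<sigma> \<in> maps \<U> \<F> M (2 * n) (tangent_bundle n N). \<forall>p\<in>points M. fst (\<sigma> p) = \<gamma> p}"

text \<open>
  The initial topology on \<open>\<Gamma>\<^sub>\<F>(\<gamma>)\<close>. For a chart \<open>d\<close> of \<open>N\<close>, the coordinate vector \<open>snd x d\<close>
  is \<open>d\<phi>(x)\<close>. The set of all sections is included in the subbase only to make it
  the underlying set.
\<close>

definition sections_topology ::
  "nat \<Rightarrow> (nat \<Rightarrow> real) set set \<Rightarrow> ((nat \<Rightarrow> real) set \<Rightarrow> ((nat \<Rightarrow> real) \<Rightarrow> real) topology) \<Rightarrow>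
   ('p, nat \<Rightarrow> real) mfd \<Rightarrow> nat \<Rightarrow> ('q, nat \<Rightarrow> real) mfd \<Rightarrow> ('p \<Rightarrow> 'q) \<Rightarrow>
   ('p \<Rightarrow> 'q tangent) topology" where
  "sections_topology m \<U> \<F> M n N \<gamma> =
     topology_generated_by (insert (sections \<U> \<F> M n N \<gamma>)
       {{\<sigma> \<in> sections \<U> \<F> M n N \<gamma>. (\<lambda>x\<in>W. snd (\<sigma> (ch_inv c x)) d) \<in> B} | c d W B.
          c \<in> mfd_atlas M \<and> W \<in> \<U> \<and> relatively_compact_in (orthant_top m) W (ch_img c) \<and>
          d \<in> mfd_atlas N \<and> \<gamma> ` ch_dom c \<subseteq> ch_dom d \<and> openin (vec_fun \<F> n W) B})"

definition sections_lcs ::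
  "nat \<Rightarrow> (nat \<Rightarrow> real) set set \<Rightarrow> ((nat \<Rightarrow> real) set \<Rightarrow> ((nat \<Rightarrow> real) \<Rightarrow> real) topology) \<Rightarrow>
   ('p, nat \<Rightarrow> real) mfd \<Rightarrow> nat \<Rightarrow> ('q, nat \<Rightarrow> real) mfd \<Rightarrow> ('p \<Rightarrow> 'q) \<Rightarrow>
   ('p \<Rightarrow> 'q tangent) lcs" where
  "sections_lcs m \<U> \<F> M n N \<gamma> = \<lparr>ltop = sections_topology m \<U> \<F> M n N \<gamma>,
     lzero = (\<lambda>p\<in>points M. tangent_zero N (\<gamma> p)),
     ladd = (\<lambda>\<sigma> \<tau>. \<lambda>p\<in>points M. tangent_add N (\<sigma> p) (\<tau> p)),
     lscale = (\<lambda>r \<sigma>. \<lambda>p\<in>points M. tangent_scale N r (\<sigma> p))\<rparr>"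

text \<open>The chart \<open>\<Psi>\<^sub>\<gamma>\<^sup>-\<^sup>1 : \<U>\<^sub>\<gamma> \<rightarrow> \<V>\<^sub>\<gamma>\<close> around \<open>\<gamma>\<close>.\<close>

definition maps_chart ::
  "nat \<Rightarrow> (nat \<Rightarrow> real) set set \<Rightarrow> ((nat \<Rightarrow> real) set \<Rightarrow> ((nat \<Rightarrow> real) \<Rightarrow> real) topology) \<Rightarrow>
   ('p, nat \<Rightarrow> real) mfd \<Rightarrow> nat \<Rightarrow> ('q, nat \<Rightarrow> real) mfd \<Rightarrow>
   'q tangent set \<Rightarrow> ('q tangent \<Rightarrow> 'q) \<Rightarrow> ('p \<Rightarrow> 'q) \<Rightarrow> ('p \<Rightarrow> 'q, 'p \<Rightarrow> 'q tangent) chart" where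
  "maps_chart m \<U> \<F> M n N \<Omega> \<Sigma> \<gamma> =
     (let \<Psi> = (\<lambda>\<sigma>. \<lambda>p\<in>points M. \<Sigma> (\<sigma> p));
          V\<gamma> = {\<sigma> \<in> sections \<U> \<F> M n N \<gamma>. \<sigma> ` points M \<subseteq> \<Omega>};
          U\<gamma> = {\<xi> \<in> maps \<U> \<F> M n N. (\<lambda>p. (\<gamma> p, \<xi> p)) ` points M \<subseteq> (\<lambda>x. (fst x, \<Sigma> x)) ` \<Omega>}
      in \<lparr>ch_model = sections_lcs m \<U> \<F> M n N \<gamma>, ch_dom = U\<gamma>,
          ch_map = restrict (inv_into V\<gamma> \<Psi>) U\<gamma>\<rparr>)"

definition maps_mfd ::
  "nat \<Rightarrow> (nat \<Rightarrow> real) set set \<Rightarrow> ((nat \<Rightarrow> real) set \<Rightarrow> ((nat \<Rightarrow> real) \<Rightarrow> real) topology) \<Rightarrow>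
   ('p, nat \<Rightarrow> real) mfd \<Rightarrow> nat \<Rightarrow> ('q, nat \<Rightarrow> real) mfd \<Rightarrow>
   'q tangent set \<Rightarrow> ('q tangent \<Rightarrow> 'q) \<Rightarrow> ('p \<Rightarrow> 'q, 'p \<Rightarrow> 'q tangent) mfd" where
  "maps_mfd m \<U> \<F> M n N \<Omega> \<Sigma> =
     (let A = maps_chart m \<U> \<F> M n N \<Omega> \<Sigma> ` maps \<U> \<F> M n N
      in \<lparr>mfd_top = atlas_topology (maps \<U> \<F> M n N) A, mfd_atlas = A\<rparr>)"

end

theory Submission
  imports Defs
begin

text \<open>
  The set of sections of \<open>\<Gamma>\<^sub>\<F>(\<gamma>)\<close> that map a compact \<open>K \<subseteq> M\<close> into an open \<open>O \<subseteq> TN\<close> is open: near a point,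
  a section has a local representative in \<open>\<F>(W,\<real>\<^sup>n)\<close>, whose topology is finer than that of uniform
  convergence. Transported by the charts \<open>\<Psi>\<^sub>\<gamma>\<close>, this makes \<open>{\<xi>. \<xi>(K) \<subseteq> V}\<close> open in \<open>\<F>(M,N)\<close> for open
  \<open>V \<subseteq> N\<close>, whence the evaluation map is continuous, as \<open>M\<close> is compact and Hausdorff. In the chart at \<open>\<gamma>\<close>
  the point evaluation at \<open>p\<close> is \<open>\<sigma> \<mapsto> \<Sigma>(\<sigma>(p))\<close>, in coordinates a smooth map on an open subset of \<open>\<real>\<^sup>2\<^sup>n\<close>
  composed with a continuous affine map. Only (PF) and (PB) are needed: (PF) applies to a
  locally defined smooth function after precomposing it with a smooth retraction of \<open>\<real>\<^sup>k\<close> onto a small box.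
\<close>

section \<open>Smooth real functions on open subsets of Euclidean space\<close>

text \<open>\<open>bsmooth\<close> asks for the whole sequence of iterated differentials, so proving
  compositions smooth directly would require a formula for each of them. On open subsets of
  \<real>^k it is therefore traded for the coinductive predicate \<open>csmooth\<close>, which
  speaks of first partial derivatives only: a function is smooth as soon as it belongs to some class
  of continuous functions closed under partial derivatives. The corners of \<open>M\<close> stay
  outside this calculus: chart changes of \<open>M\<close> only serve as the given diffeomorphisms
  in (PB), and all other smooth maps are reduced to maps on open subsets of some \<real>^k. The
  second obstacle is that (PF) and (PB) permit an operation only after passing to a relatively
  compact smaller set. Local statements are therefore phrased with \<open>germ_F\<close>, which
  leaves the neighbourhood open and lets each step shrink it again. The tangent bundle is given by
  its atlas alone, so that its standard charts are homeomorphisms onto open sets and smoothly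
  compatible has to be derived, from the chain rule for \<open>jac\<close>.\<close>

abbreviation vecs :: "nat \<Rightarrow> (nat \<Rightarrow> real) set" where
  "vecs n \<equiv> {x. \<forall>i\<ge>n. x i = 0}"

text \<open>As a subspace of the type \<open>nat \<Rightarrow> real\<close>, the model space becomes
  accessible to \<open>continuous_on\<close> and to limits in that type.\<close>

lemma ltop_euclid [simp]: "ltop (euclid n) = top_of_set (vecs n)"
  by (simp add: euclid_def Euclidean_space_def euclidean_product_topology)

lemma ladd_euclid [simp]: "ladd (euclid n) = (\<lambda>x y i. x i + y i)"
  and lscale_euclid [simp]: "lscale (euclid n) = (\<lambda>r x i. r * x i)"
  by (simp_all add: euclid_def)

text \<open>A basic open set of the product topology constrains coordinates individually. Those from
  \<open>n\<close> on agree with \<open>u\<close> throughout \<open>vecs n\<close>, so finitely many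
  conditions remain and a single radius serves them all.\<close>

lemma open_box:
  assumes "openin (top_of_set (vecs n)) S" "u \<in> S"
  shows "\<exists>\<delta>>0. \<forall>y\<in>vecs n. (\<forall>i<n. \<bar>y i - u i\<bar> < \<delta>) \<longrightarrow> y \<in> S"
proof -
  obtain T where T: "open T" "S = vecs n \<inter> T"
    using assms(1) by (auto simp: openin_open)
  have "openin (product_topology (\<lambda>_::nat. euclideanreal) UNIV) T" "u \<in> T"
    using T assms(2) by (auto simp: open_fun_def)
  then obtain X where X: "u \<in> Pi\<^sub>E UNIV X" "\<And>i. open (X i)" "Pi\<^sub>E UNIV X \<subseteq> T"
    using product_topology_open_contains_basis[of "\<lambda>_. euclideanreal" UNIV T u] by auto
  have "\<exists>\<delta>>0. ball (u i) \<delta> \<subseteq> X i" for i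
    using X(1) X(2)[of i] by (auto simp: open_contains_ball)
  then obtain d where d: "\<And>i. d i > 0" "\<And>i. ball (u i) (d i) \<subseteq> X i" by metis
  \<comment> \<open>The extra element 1 keeps the minimum meaningful for
    \<open>n = 0\<close>.\<close>
  define \<delta> where "\<delta> = Min (insert 1 (d ` {..<n}))"
  have "\<delta> > 0" unfolding \<delta>_def using d(1) by (subst Min_gr_iff) auto
  moreover have "y \<in> S" if y: "y \<in> vecs n" "\<forall>i<n. \<bar>y i - u i\<bar> < \<delta>" for y
  proof -
    have "y i \<in> X i" for i
    proof (cases "i < n")
      case True
      then have "\<delta> \<le> d i" unfolding \<delta>_def by (intro Min_le) auto
      then have "\<bar>y i - u i\<bar> < d i" using y True by fastforce
      then show ?thesis using d(2)[of i] by (auto simp: dist_real_def ball_def abs_minus_commute)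
    next
      case False
      then have "y i = u i" using y(1) assms(2) T by auto
      then show ?thesis using X(1) by auto
    qed
    then show ?thesis using X(3) T y(1) by auto
  qed
  ultimately show ?thesis by blast
qed

lemma continuous_map_vecs_iff:
  "continuous_map X (top_of_set (vecs n)) f \<longleftrightarrow>
     f \<in> topspace X \<rightarrow> vecs n \<and> (\<forall>i<n. continuous_map X euclideanreal (\<lambda>x. f x i))"
proof -
  have "continuous_map X euclidean f \<longleftrightarrow> (\<forall>i. continuous_map X euclideanreal (\<lambda>x. f x i))"
    using continuous_map_componentwise_UNIV[of X "\<lambda>_. euclideanreal" f]
    by (simp add: euclidean_product_topology)
  moreover have "continuous_map X euclideanreal (\<lambda>x. f x i)"
    if "f \<in> topspace X \<rightarrow> vecs n" "i \<ge> n" for i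
    by (rule continuous_map_eq[where f="\<lambda>_. 0"]) (use that in auto)
  ultimately show ?thesis
    unfolding continuous_map_in_subtopology by (auto simp: image_subset_iff Pi_iff) (meson linorder_le_less_linear)
qed

lemma openin_boxI:
  "openin (top_of_set (vecs n)) {y \<in> vecs n. \<forall>i<n. \<bar>y i - u i\<bar> < \<delta>}"
proof -
  have "open {y :: nat \<Rightarrow> real. \<forall>i\<in>{..<n}. \<bar>y i - u i\<bar> < \<delta>}"
    by (simp only: Collect_ball_eq, intro open_INT) (auto intro!: open_Collect_less continuous_intros)
  moreover have "{y \<in> vecs n. \<forall>i<n. \<bar>y i - u i\<bar> < \<delta>} = vecs n \<inter> {y. \<forall>i\<in>{..<n}. \<bar>y i - u i\<bar> < \<delta>}" by auto
  ultimately show ?thesis by (auto simp: openin_open)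
qed

text \<open>Convergence in the subspace \<open>vecs l\<close> is more than coordinatewise
  convergence: the difference quotients must eventually lie in \<open>vecs l\<close>, which is the
  second conjunct.\<close>

lemma has_dirderiv_euclid:
  "has_dirderiv E (euclid l) f x y L \<longleftrightarrow>
     L \<in> vecs l \<and>
     (\<forall>\<^sub>F t in at 0. \<forall>i\<ge>l. (f (ladd E x (lscale E t y)) i - f x i) / t = 0) \<and>
     (\<forall>i. ((\<lambda>t. (f (ladd E x (lscale E t y)) i - f x i) / t) \<longlongrightarrow> L i) (at 0))"
  apply (simp only: has_dirderiv_def ltop_euclid limitin_subtopology)
  apply (simp add: flip: euclidean_product_topology)
  apply (simp add: limitin_componentwise)
  done

text \<open>A two-sided derivative along a coordinate line, so only on open sets is it determined by
  the values there.\<close>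

definition has_partial :: "nat \<Rightarrow> ((nat \<Rightarrow> real) \<Rightarrow> real) \<Rightarrow> real \<Rightarrow> (nat \<Rightarrow> real) \<Rightarrow> bool" where
  "has_partial i f d x \<longleftrightarrow> ((\<lambda>t. f (x(i := t))) has_real_derivative d) (at (x i))"

lemma has_partial_const: "has_partial i (\<lambda>_. c) 0 x"
  by (simp add: has_partial_def)

lemma has_partial_coord: "has_partial j (\<lambda>x. x i) (if i = j then 1 else 0) x"
  by (auto simp: has_partial_def)

lemma has_partial_add:
  "has_partial i f a x \<Longrightarrow> has_partial i g b x \<Longrightarrow> has_partial i (\<lambda>x. f x + g x) (a + b) x"
  by (simp add: has_partial_def DERIV_add)

lemma has_partial_mult:
  "has_partial i f a x \<Longrightarrow> has_partial i g b x \<Longrightarrow> has_partial i (\<lambda>x. f x * g x) (a * g x + b * f x) x"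
  unfolding has_partial_def
  using DERIV_mult[of "\<lambda>t. f (x(i := t))" a "x i" UNIV "\<lambda>t. g (x(i := t))" b] by simp

text \<open>The only witnesses demanded are first partial derivatives; those of higher order arise
  by unfolding the predicate again.\<close>

coinductive csmooth :: "nat \<Rightarrow> (nat \<Rightarrow> real) set \<Rightarrow> ((nat \<Rightarrow> real) \<Rightarrow> real) \<Rightarrow> bool"
  for n S where
  "continuous_on S f \<Longrightarrow>
   (\<And>i. i < n \<Longrightarrow> \<exists>f'. csmooth n S f' \<and> (\<forall>x\<in>S. has_partial i f (f' x) x)) \<Longrightarrow>
   csmooth n S f"

lemma csmooth_continuous_on: "csmooth n S f \<Longrightarrow> continuous_on S f"
  by (erule csmooth.cases) auto

lemma csmooth_partial:
  assumes "csmooth n S f" "i < n"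
  shows "\<exists>f'. csmooth n S f' \<and> (\<forall>x\<in>S. has_partial i f (f' x) x)"
  using assms csmooth.simps[of n S f] by blast

text \<open>Here \<open>i < n\<close> is essential: changing a later coordinate leaves
  \<open>vecs n\<close>.\<close>

lemma eventually_line_in:
  assumes "openin (top_of_set (vecs n)) S" "x \<in> S" "i < n"
  shows "\<forall>\<^sub>F t in nhds (x i). x(i := t) \<in> S"
proof -
  obtain \<delta> where \<delta>: "\<delta> > 0" "\<forall>y\<in>vecs n. (\<forall>i<n. \<bar>y i - x i\<bar> < \<delta>) \<longrightarrow> y \<in> S"
    using open_box[OF assms(1,2)] by blast
  have xv: "x \<in> vecs n" using assms openin_subset by fastforce
  have "\<forall>\<^sub>F t in nhds (x i). dist t (x i) < \<delta>"
    using \<delta>(1) eventually_nhds_metric by blast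
  then show ?thesis
  proof (rule eventually_mono)
    fix t assume "dist t (x i) < \<delta>"
    then show "x(i := t) \<in> S"
      by (intro \<delta>(2)[rule_format]) (use xv \<delta>(1) assms(3) in \<open>auto simp: dist_real_def\<close>)
  qed
qed

lemma has_partial_cong:
  assumes "openin (top_of_set (vecs n)) S" "x \<in> S" "i < n" "\<And>x. x \<in> S \<Longrightarrow> g x = f x" "has_partial i f d x"
  shows "has_partial i g d x"
proof -
  have "\<forall>\<^sub>F t in nhds (x i). g (x(i := t)) = f (x(i := t))"
    by (rule eventually_mono[OF eventually_line_in[OF assms(1-3)]]) (rule assms(4))
  from DERIV_cong_ev[OF refl this refl, of d] show ?thesis
    using assms(5) unfolding has_partial_def by simp
qed

lemma csmooth_cong:
  assumes S: "openin (top_of_set (vecs n)) S" and f: "csmooth n S f" and eq: "\<And>x. x \<in> S \<Longrightarrow> g x = f x"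
  shows "csmooth n S g"
proof (rule csmooth.intros)
  show "continuous_on S g"
    using continuous_on_cong[of S S g f] eq csmooth_continuous_on[OF f] by simp
  fix i assume i: "i < n"
  then show "\<exists>f'. csmooth n S f' \<and> (\<forall>x\<in>S. has_partial i g (f' x) x)"
    using csmooth_partial[OF f] has_partial_cong[OF S _ i, of _ g f] eq by blast
qed

text \<open>The partial derivatives of the generators need only be algebraic combinations of generators, so no
  formulas for higher derivatives are needed.\<close>

inductive alg :: "('a \<Rightarrow> real) set \<Rightarrow> ('a \<Rightarrow> real) \<Rightarrow> bool" for B where
  alg_gen: "f \<in> B \<Longrightarrow> alg B f"
| alg_const: "alg B (\<lambda>_. c)"
| alg_add: "alg B f \<Longrightarrow> alg B g \<Longrightarrow> alg B (\<lambda>x. f x + g x)"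
| alg_mult: "alg B f \<Longrightarrow> alg B g \<Longrightarrow> alg B (\<lambda>x. f x * g x)"

lemma alg_sum: "(\<And>i. i \<in> I \<Longrightarrow> alg B (f i)) \<Longrightarrow> alg B (\<lambda>x. \<Sum>i\<in>I. f i x)"
  by (induction I rule: infinite_finite_induct) (auto intro: alg_const alg_add)

text \<open>The invariant of the coinduction is \<open>alg B\<close> itself. Sum and product rule
  carry the condition on the generators over to the algebra that they generate.\<close>

lemma csmooth_alg:
  assumes cont: "\<And>f. f \<in> B \<Longrightarrow> continuous_on S f"
    and der: "\<And>f i. f \<in> B \<Longrightarrow> i < n \<Longrightarrow> \<exists>f'. alg B f' \<and> (\<forall>x\<in>S. has_partial i f (f' x) x)"
    and f: "alg B f"
  shows "csmooth n S f"
  using f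
proof (coinduction arbitrary: f)
  case csmooth
  have "continuous_on S f \<and> (\<forall>i<n. \<exists>f'. alg B f' \<and> (\<forall>x\<in>S. has_partial i f (f' x) x))"
    using csmooth
  proof (induction f rule: alg.induct)
    case (alg_gen f)
    then show ?case using cont der by blast
  next
    case (alg_const c)
    then show ?case by (auto intro!: exI[of _ "\<lambda>_. 0"] alg.alg_const has_partial_const)
  next
    case (alg_add f g)
    have "\<exists>f'. alg B f' \<and> (\<forall>x\<in>S. has_partial i (\<lambda>x. f x + g x) (f' x) x)" if i: "i < n" for i
    proof -
      obtain f' g' where "alg B f'" "alg B g'"
        "\<forall>x\<in>S. has_partial i f (f' x) x" "\<forall>x\<in>S. has_partial i g (g' x) x"
        using alg_add i by blast
      then show ?thesis
        by (intro exI[of _ "\<lambda>x. f' x + g' x"]) (auto intro!: alg.alg_add has_partial_add)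
    qed
    then show ?case using alg_add by (auto intro!: continuous_intros)
  next
    case (alg_mult f g)
    have "\<exists>f'. alg B f' \<and> (\<forall>x\<in>S. has_partial i (\<lambda>x. f x * g x) (f' x) x)" if i: "i < n" for i
    proof -
      obtain f' g' where "alg B f'" "alg B g'"
        "\<forall>x\<in>S. has_partial i f (f' x) x" "\<forall>x\<in>S. has_partial i g (g' x) x"
        using alg_mult i by blast
      with alg_mult show ?thesis
        by (intro exI[of _ "\<lambda>x. f' x * g x + g' x * f x"])
          (auto intro!: alg.alg_add alg.alg_mult has_partial_mult)
    qed
    then show ?case using alg_mult by (auto intro!: continuous_intros)
  qed
  then show ?case by blast
qed

text \<open>With all smooth functions as generators, closure under constants, sums and products
  comes from a single coinduction.\<close>

lemma csmooth_alg_csmooth: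
  assumes "alg {f. csmooth n S f} f"
  shows "csmooth n S f"
proof (rule csmooth_alg[OF _ _ assms])
  fix f i assume "f \<in> {f. csmooth n S f}" "i < n"
  then show "\<exists>f'. alg {f. csmooth n S f} f' \<and> (\<forall>x\<in>S. has_partial i f (f' x) x)"
    using csmooth_partial[of n S f i] by (auto intro: alg_gen)
qed (auto intro: csmooth_continuous_on)

lemma csmooth_const: "csmooth n S (\<lambda>_. c)"
  and csmooth_add: "csmooth n S f \<Longrightarrow> csmooth n S g \<Longrightarrow> csmooth n S (\<lambda>x. f x + g x)"
  and csmooth_mult: "csmooth n S f \<Longrightarrow> csmooth n S g \<Longrightarrow> csmooth n S (\<lambda>x. f x * g x)"
  and csmooth_sum: "(\<And>i. i \<in> I \<Longrightarrow> csmooth n S (h i)) \<Longrightarrow> csmooth n S (\<lambda>x. \<Sum>i\<in>I. h i x)"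
  by (rule csmooth_alg_csmooth, auto intro: alg.intros alg_sum)+

lemma csmooth_coord: "csmooth n S (\<lambda>x. x i)"
proof (rule csmooth.intros)
  show "continuous_on S (\<lambda>x. x i)"
    by (intro continuous_on_subset[OF continuous_on_product_coordinates]) auto
  show "\<exists>f'. csmooth n S f' \<and> (\<forall>x\<in>S. has_partial j (\<lambda>x. x i) (f' x) x)" for j
    by (intro exI[of _ "\<lambda>_. if i = j then 1 else 0"] conjI ballI csmooth_const has_partial_coord)
qed

text \<open>Continuity of the partial derivatives yields total differentiability: walk from
  \<open>u\<close> to \<open>y\<close> one coordinate at a time and apply the mean value inequality
  on every edge.\<close>

lemma partials_differentiable:
  assumes S: "openin (top_of_set (vecs n)) S" and u: "u \<in> S" and e: "e > 0"
    and cont: "\<And>j. j < n \<Longrightarrow> continuous_on S (g' j)"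
    and der: "\<And>j x. j < n \<Longrightarrow> x \<in> S \<Longrightarrow> has_partial j g (g' j x) x"
  shows "\<exists>\<delta>>0. \<forall>y\<in>vecs n. (\<forall>i<n. \<bar>y i - u i\<bar> < \<delta>) \<longrightarrow>
     \<bar>g y - g u - (\<Sum>j<n. (y j - u j) * g' j u)\<bar> \<le> e * (\<Sum>j<n. \<bar>y j - u j\<bar>)"
proof -
  have uv: "u \<in> vecs n" using S u openin_subset by fastforce
  \<comment> \<open>The points where every partial derivative is within \<open>e\<close> of its
    value at \<open>u\<close>. The index set has the additional element \<open>n\<close>, guarded by
    \<open>j < n\<close>, so that the intersection is over a nonempty set and lies in
    \<open>S\<close> even for \<open>n = 0\<close>.\<close>
  define T where "T = (\<Inter>j\<in>{..n}. {x\<in>S. j < n \<longrightarrow> g' j x \<in> ball (g' j u) e})"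
  have "openin (top_of_set (vecs n)) T"
    unfolding T_def
  proof (rule openin_INT2)
    fix j
    have "openin (top_of_set S) (S \<inter> g' j -` ball (g' j u) e)" if "j < n"
      using continuous_openin_preimage_gen[OF cont[OF that]] by blast
    then show "openin (top_of_set (vecs n)) {x \<in> S. j < n \<longrightarrow> g' j x \<in> ball (g' j u) e}"
      using S by (cases "j < n") (auto simp: vimage_def Int_def intro: openin_trans)
  qed auto
  moreover have "u \<in> T" using u e by (simp add: T_def)
  ultimately obtain \<delta> where \<delta>: "\<delta> > 0"
    "\<forall>y\<in>vecs n. (\<forall>i<n. \<bar>y i - u i\<bar> < \<delta>) \<longrightarrow> y \<in> T"
    using open_box[of n T u] by blast
  have T: "x \<in> S \<and> \<bar>g' j x - g' j u\<bar> < e" if "x \<in> T" "j < n" for x j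
    using that by (auto simp: T_def dist_real_def abs_minus_commute)
  have "\<bar>g y - g u - (\<Sum>j<n. (y j - u j) * g' j u)\<bar> \<le> e * (\<Sum>j<n. \<bar>y j - u j\<bar>)"
    if y: "y \<in> vecs n" "\<forall>i<n. \<bar>y i - u i\<bar> < \<delta>" for y
  proof -
    \<comment> \<open>The vertices of the path: \<open>z j\<close> has the first \<open>j\<close>
      coordinates of \<open>y\<close> and the others of \<open>u\<close>.\<close>
    define z where "z j = (\<lambda>i. if i < j then y i else u i)" for j
    have zn: "z n = y" using y uv by (auto simp: z_def fun_eq_iff not_less)
    have z0: "z 0 = u" by (auto simp: z_def)
    have step: "\<bar>g (z (Suc j)) - g (z j) - (y j - u j) * g' j u\<bar> \<le> e * \<bar>y j - u j\<bar>" if j: "j < n" for j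
    proof -
      have inS: "(z j)(j := t) \<in> S \<and> \<bar>g' j ((z j)(j := t)) - g' j u\<bar> < e" 
        if t: "t \<in> closed_segment (u j) (y j)" for t
      proof -
        have "\<bar>t - u j\<bar> < \<delta>" using t y j by (auto simp: closed_segment_eq_real_ivl split: if_splits)
        then have "\<forall>i<n. \<bar>((z j)(j := t)) i - u i\<bar> < \<delta>" using y \<delta>(1) by (auto simp: z_def)
        moreover have "(z j)(j := t) \<in> vecs n" using y uv j by (auto simp: z_def)
        ultimately show ?thesis using \<delta>(2) T j by blast
      qed
      \<comment> \<open>With the linear part at \<open>u\<close> removed, the derivative along the
        edge is smaller than \<open>e\<close> in absolute value.\<close>
      define h where "h t = g ((z j)(j := t)) - t * g' j u" for t
      have "(h has_real_derivative (g' j ((z j)(j := t)) - g' j u)) (at t)"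
        if t: "t \<in> closed_segment (u j) (y j)" for t
      proof -
        have "((\<lambda>t. g ((z j)(j := t))) has_real_derivative g' j ((z j)(j := t))) (at t)"
          using der[OF j conjunct1[OF inS[OF t]]] by (simp add: has_partial_def)
        then show ?thesis unfolding h_def by (auto intro!: derivative_eq_intros)
      qed
      then have "norm (h (y j) - h (u j)) \<le> e * norm (y j - u j)"
        by (intro field_differentiable_bound[of "closed_segment (u j) (y j)" _ "\<lambda>t. g' j ((z j)(j := t)) - g' j u"])
           (auto intro: has_field_derivative_at_within less_imp_le dest: inS)
      moreover have "(z j)(j := y j) = z (Suc j)" "(z j)(j := u j) = z j"
        by (auto simp: z_def fun_eq_iff less_Suc_eq)
      ultimately show ?thesis by (simp add: h_def algebra_simps)
    qed
    have "g y - g u - (\<Sum>j<n. (y j - u j) * g' j u) =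
        (\<Sum>j<n. g (z (Suc j)) - g (z j) - (y j - u j) * g' j u)"
      using sum_lessThan_telescope[of "\<lambda>j. g (z j)" n] by (simp add: sum_subtractf zn z0)
    also have "\<bar>\<dots>\<bar> \<le> (\<Sum>j<n. e * \<bar>y j - u j\<bar>)"
      by (rule order_trans[OF sum_abs]) (use step in \<open>auto intro: sum_mono\<close>)
    finally show ?thesis by (simp add: sum_distrib_left)
  qed
  then show ?thesis using \<delta>(1) by blast
qed

text \<open>The linearisation error at \<open>w t\<close> is at most a small multiple of the
  l1-distance from \<open>w t0\<close>. Divided by \<open>t - t0\<close> it stays small, since the
  difference quotients \<open>q j\<close> of the curve are bounded near \<open>t0\<close>.\<close>

lemma has_derivative_along_curve:
  assumes S: "openin (top_of_set (vecs n)) S" and w: "w t0 \<in> S" "\<forall>\<^sub>F t in at t0. w t \<in> vecs n"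
    and cont: "\<And>j. j < n \<Longrightarrow> continuous_on S (g' j)"
    and der: "\<And>j x. j < n \<Longrightarrow> x \<in> S \<Longrightarrow> has_partial j g (g' j x) x"
    and w': "\<And>j. j < n \<Longrightarrow> ((\<lambda>t. w t j) has_real_derivative w' j) (at t0)"
  shows "((\<lambda>t. g (w t)) has_real_derivative (\<Sum>j<n. w' j * g' j (w t0))) (at t0)"
proof -
  define q where "q j t = (w t j - w t0 j) / (t - t0)" for j t
  have q: "(q j \<longlongrightarrow> w' j) (at t0)" if "j < n" for j
    using w'[OF that] by (simp add: has_field_derivative_iff q_def[abs_def])
  define R where "R t = (g (w t) - g (w t0)) / (t - t0) - (\<Sum>j<n. q j t * g' j (w t0))" for t
  \<comment> \<open>An eventual bound for the sum of the \<bar>\<open>q j t\<close>\<bar>; adding 1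
    makes it strictly larger than the limit, and positive. The tolerance \<open>e / (2 * A)\<close>
    below then leaves a total error of at most \<open>e / 2\<close>.\<close>
  define A where "A = (\<Sum>j<n. \<bar>w' j\<bar>) + 1"
  have A: "A > 0" by (simp add: A_def add_nonneg_pos sum_nonneg)
  have "((\<lambda>t. \<Sum>j<n. \<bar>q j t\<bar>) \<longlongrightarrow> (\<Sum>j<n. \<bar>w' j\<bar>)) (at t0)"
    by (intro tendsto_sum tendsto_rabs q) auto
  then have evA: "\<forall>\<^sub>F t in at t0. (\<Sum>j<n. \<bar>q j t\<bar>) < A"
    by (rule order_tendstoD) (simp add: A_def)
  have "(R \<longlongrightarrow> 0) (at t0)"
  proof (rule tendstoI)
    fix e :: real assume e: "e > 0"
    then have "e / (2 * A) > 0" using A by simp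
    from partials_differentiable[OF S w(1) this cont der]
    obtain \<delta> where \<delta>: "\<delta> > 0" "\<forall>y\<in>vecs n. (\<forall>i<n. \<bar>y i - w t0 i\<bar> < \<delta>) \<longrightarrow>
      \<bar>g y - g (w t0) - (\<Sum>j<n. (y j - w t0 j) * g' j (w t0))\<bar> \<le> e / (2 * A) * (\<Sum>j<n. \<bar>y j - w t0 j\<bar>)"
      by blast
    have "\<forall>\<^sub>F t in at t0. \<forall>i\<in>{..<n}. \<bar>w t i - w t0 i\<bar> < \<delta>"
    proof (rule eventually_ball_finite, safe)
      fix i assume "i < n"
      then have "((\<lambda>t. w t i) \<longlongrightarrow> w t0 i) (at t0)"
        using DERIV_isCont[OF w'] by (auto simp: isCont_def)
      from tendstoD[OF this \<delta>(1)] show "\<forall>\<^sub>F t in at t0. \<bar>w t i - w t0 i\<bar> < \<delta>"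
        by (simp add: dist_real_def)
    qed
    with evA w(2) eventually_neq_at_within[of t0 t0 UNIV] show "\<forall>\<^sub>F t in at t0. dist (R t) 0 < e"
    proof eventually_elim
      case (elim t)
      have "(\<Sum>j<n. q j t * g' j (w t0)) = (\<Sum>j<n. (w t j - w t0 j) * g' j (w t0)) / (t - t0)"
        by (simp add: q_def sum_divide_distrib)
      then have "R t = (g (w t) - g (w t0) - (\<Sum>j<n. (w t j - w t0 j) * g' j (w t0))) / (t - t0)"
        by (simp add: R_def diff_divide_distrib)
      moreover have "\<bar>g (w t) - g (w t0) - (\<Sum>j<n. (w t j - w t0 j) * g' j (w t0))\<bar>
          \<le> e / (2 * A) * (\<Sum>j<n. \<bar>w t j - w t0 j\<bar>)"
        using \<delta>(2) elim by blast
      ultimately have "\<bar>R t\<bar> \<le> e / (2 * A) * (\<Sum>j<n. \<bar>w t j - w t0 j\<bar>) / \<bar>t - t0\<bar>"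
        by (simp only: abs_divide) (rule divide_right_mono, auto)
      also have "\<dots> = e / (2 * A) * (\<Sum>j<n. \<bar>q j t\<bar>)"
        by (simp add: q_def abs_divide sum_divide_distrib sum_distrib_left)
      also have "\<dots> \<le> e / (2 * A) * A"
        using elim e A by (intro mult_left_mono) auto
      also have "\<dots> < e" using e A by simp
      finally show ?case by simp
    qed
  qed
  moreover have "((\<lambda>t. \<Sum>j<n. q j t * g' j (w t0)) \<longlongrightarrow> (\<Sum>j<n. w' j * g' j (w t0))) (at t0)"
    by (intro tendsto_sum tendsto_mult_right q) auto
  ultimately have "((\<lambda>t. R t + (\<Sum>j<n. q j t * g' j (w t0))) \<longlongrightarrow> 0 + (\<Sum>j<n. w' j * g' j (w t0))) (at t0)"
    by (rule tendsto_add)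
  then show ?thesis by (simp add: has_field_derivative_iff R_def)
qed

section \<open>Composition of smooth functions\<close>

lemma csmooth_partials:
  assumes "csmooth n S g"
  shows "\<exists>g'. \<forall>j<n. csmooth n S (g' j) \<and> (\<forall>x\<in>S. has_partial j g (g' j x) x)"
  using csmooth_partial[OF assms] by metis

text \<open>The generators are the smooth functions on \<open>U\<close> together with all
  \<open>h \<circ> F\<close> for \<open>h\<close> smooth on \<open>S\<close>. By the first-order
  chain rule a partial derivative of \<open>h \<circ> F\<close> is a sum of products of such
  generators.\<close>

lemma csmooth_compose:
  assumes U: "openin (top_of_set (vecs n)) U" and S: "openin (top_of_set (vecs l)) S"
    and F: "\<And>j. j < l \<Longrightarrow> csmooth n U (\<lambda>x. F x j)" "F ` U \<subseteq> S" and g: "csmooth l S g"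
  shows "csmooth n U (\<lambda>x. g (F x))"
proof (rule csmooth_alg)
  let ?B = "{f. csmooth n U f} \<union> {\<lambda>x. g (F x) | g. csmooth l S g}"
  show "alg ?B (\<lambda>x. g (F x))" using g by (auto intro: alg_gen)
  have Sv: "S \<subseteq> vecs l" using S openin_subset by fastforce
  have "continuous_on U (\<lambda>x. F x j)" for j
  proof (cases "j < l")
    case False
    then have "F x j = 0" if "x \<in> U" for x using F(2) Sv that by fastforce
    then show ?thesis using continuous_on_cong[of U U "\<lambda>x. F x j" "\<lambda>_. 0"] by simp
  qed (rule csmooth_continuous_on[OF F(1)])
  then have contF: "continuous_on U F" by (rule continuous_on_coordinatewise_then_product)
  fix f assume f: "f \<in> ?B"
  have "continuous_on U (\<lambda>x. h (F x))" if "csmooth l S h" for h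
    using continuous_on_compose2[OF csmooth_continuous_on[OF that] contF F(2)] .
  then show "continuous_on U f" using f csmooth_continuous_on by blast
  fix i assume i: "i < n"
  have "\<exists>f'. alg ?B f' \<and> (\<forall>x\<in>U. has_partial i (\<lambda>x. h (F x)) (f' x) x)" if h: "csmooth l S h" for h
  proof -
    obtain h' where "\<forall>j<l. csmooth l S (h' j) \<and> (\<forall>x\<in>S. has_partial j h (h' j x) x)"
      using csmooth_partials[OF h] by blast
    then have h': "\<And>j. j < l \<Longrightarrow> csmooth l S (h' j)"
      "\<And>j x. j < l \<Longrightarrow> x \<in> S \<Longrightarrow> has_partial j h (h' j x) x" by auto
    have "\<forall>j\<in>{..<l}. \<exists>f'. csmooth n U f' \<and> (\<forall>x\<in>U. has_partial i (\<lambda>x. F x j) (f' x) x)"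
      using csmooth_partial[OF F(1) i] by blast
    then obtain F' where F': "\<And>j. j < l \<Longrightarrow> csmooth n U (F' j)"
      "\<And>j x. j < l \<Longrightarrow> x \<in> U \<Longrightarrow> has_partial i (\<lambda>x. F x j) (F' j x) x"
      by (subst (asm) bchoice_iff) auto
    show ?thesis
    proof (intro exI[of _ "\<lambda>x. \<Sum>j<l. F' j x * h' j (F x)"] conjI ballI)
      show "alg ?B (\<lambda>x. \<Sum>j<l. F' j x * h' j (F x))"
        using F' h' by (intro alg_sum alg_mult) (auto intro!: alg_gen)
      fix x assume x: "x \<in> U"
      have ev: "\<forall>\<^sub>F t in at (x i). F (x(i := t)) \<in> vecs l"
        using eventually_line_in[OF U x i] F(2) Sv
        by (auto simp: eventually_at_filter elim!: eventually_mono)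
      have "((\<lambda>t. h (F (x(i := t)))) has_real_derivative
          (\<Sum>j<l. F' j x * h' j (F (x(i := x i))))) (at (x i))"
      proof (rule has_derivative_along_curve[OF S _ ev])
        show "F (x(i := x i)) \<in> S" using x F(2) by auto
        show "j < l \<Longrightarrow> continuous_on S (h' j)" for j using h'(1) csmooth_continuous_on by blast
        show "j < l \<Longrightarrow> ((\<lambda>t. F (x(i := t)) j) has_real_derivative F' j x) (at (x i))" for j
          using F'(2)[OF _ x] by (simp only: has_partial_def)
      qed (rule h'(2))
      then show "has_partial i (\<lambda>x. h (F x)) (\<Sum>j<l. F' j x * h' j (F x)) x"
        by (simp add: has_partial_def)
    qed
  qed
  then show "\<exists>f'. alg ?B f' \<and> (\<forall>x\<in>U. has_partial i f (f' x) x)"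
    using f csmooth_partial[OF _ i, of U f] by (auto intro: alg_gen)
qed

section \<open>Bastiani smoothness on Euclidean spaces\<close>

text \<open>The body of \<open>bsmooth\<close> with its existentially bound family of differentials
  turned into an argument.\<close>

definition bderivs ::
  "'a lcs \<Rightarrow> 'b lcs \<Rightarrow> 'a set \<Rightarrow> ('a \<Rightarrow> 'b) \<Rightarrow> (nat \<Rightarrow> 'a \<times> (nat \<Rightarrow> 'a) \<Rightarrow> 'b) \<Rightarrow> bool" where
  "bderivs E F U f D \<longleftrightarrow>
     (\<forall>x\<in>U. D 0 (x, \<lambda>_. undefined) = f x) \<and>
     (\<forall>k. continuous_map
            (prod_topology (subtopology (ltop E) U) (product_topology (\<lambda>_. ltop E) {..<k}))
            (ltop F) (D k)) \<and>
     (\<forall>k. \<forall>x \<in> (ltop E) interior_of U. \<forall>ys \<in> {..<Suc k} \<rightarrow>\<^sub>E lcarrier E.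
        has_dirderiv E F (\<lambda>z. D k (z, restrict ys {..<k})) x (ys k) (D (Suc k) (x, ys)))"

lemma bsmooth_iff: "bsmooth E F U f \<longleftrightarrow> U \<subseteq> lcarrier E \<and> (\<exists>D. bderivs E F U f D)"
  by (simp only: bsmooth_def bderivs_def)

lemma bderivsD:
  assumes "bderivs E F U f D"
  shows "x \<in> U \<Longrightarrow> D 0 (x, \<lambda>_. undefined) = f x"
    and "continuous_map (prod_topology (subtopology (ltop E) U) (product_topology (\<lambda>_. ltop E) {..<k})) (ltop F) (D k)"
    and "x \<in> (ltop E) interior_of U \<Longrightarrow> ys \<in> {..<Suc k} \<rightarrow>\<^sub>E lcarrier E \<Longrightarrow>
        has_dirderiv E F (\<lambda>z. D k (z, restrict ys {..<k})) x (ys k) (D (Suc k) (x, ys))"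
  using assms by (simp_all only: bderivs_def)

text \<open>Derivatives are demanded in the interior only, and the interior shrinks with the set;
  the continuous extensions simply restrict.\<close>

lemma bsmooth_mono: "bsmooth E F U f \<Longrightarrow> V \<subseteq> U \<Longrightarrow> bsmooth E F V f"
proof -
  assume f: "bsmooth E F U f" and V: "V \<subseteq> U"
  then obtain D where D: "bderivs E F U f D" "U \<subseteq> lcarrier E" by (auto simp: bsmooth_iff)
  have "bderivs E F V f D"
    unfolding bderivs_def
  proof (intro conjI allI ballI)
    show "x \<in> V \<Longrightarrow> D 0 (x, \<lambda>_. undefined) = f x" for x
      using bderivsD(1)[OF D(1)] V by auto
    fix k
    show "continuous_map (prod_topology (subtopology (ltop E) V) (product_topology (\<lambda>_. ltop E) {..<k})) (ltop F) (D k)"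
      using bderivsD(2)[OF D(1), of k] V
      by (simp add: prod_topology_subtopology(1)) (erule continuous_map_from_subtopology_mono, auto)
    fix x ys assume "x \<in> ltop E interior_of V" "ys \<in> {..<Suc k} \<rightarrow>\<^sub>E lcarrier E"
    then show "has_dirderiv E F (\<lambda>z. D k (z, restrict ys {..<k})) x (ys k) (D (Suc k) (x, ys))"
      using subsetD[OF interior_of_mono[OF V]] by (intro bderivsD(3)[OF D(1)])
  qed
  then show ?thesis using V D(2) by (auto simp: bsmooth_iff)
qed

lemma bsmooth_cong: "bsmooth E F U f \<Longrightarrow> (\<And>x. x \<in> U \<Longrightarrow> g x = f x) \<Longrightarrow> bsmooth E F U g"
  unfolding bsmooth_def by auto

text \<open>For an affine \<open>A\<close> with linear part \<open>L\<close>, the iterated derivatives of \<open>g \<circ> A\<close> need no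
  chain rule.\<close>

lemma bsmooth_affine:
  assumes g: "bsmooth F G S g" and S: "openin (ltop F) S" and U: "U \<subseteq> lcarrier E"
    and A: "continuous_map (subtopology (ltop E) U) (ltop F) A" "A ` U \<subseteq> S"
    and L: "continuous_map (ltop E) (ltop F) L"
    and AL: "\<And>x y t. x \<in> U \<Longrightarrow> y \<in> lcarrier E \<Longrightarrow> A (ladd E x (lscale E t y)) = ladd F (A x) (lscale F t (L y))"
  shows "bsmooth E G U (\<lambda>x. g (A x))"
proof -
  obtain D where D: "bderivs F G S g D"
    using g by (auto simp: bsmooth_iff)
  note D0 = bderivsD(1)[OF D] and Dc = bderivsD(2)[OF D] and Dd = bderivsD(3)[OF D]
  \<comment> \<open>Each differentiation of \<open>g \<circ> A\<close> pushes its direction through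
    the linear part \<open>L\<close>, so the \<open>k\<close>-th differential is that of
    \<open>g\<close> at \<open>A x\<close> in the directions \<open>L (ys i)\<close>.\<close>
  define D' where "D' k = (\<lambda>(x, ys). D k (A x, \<lambda>i\<in>{..<k::nat}. L (ys i)))" for k
  have "D' 0 (x, \<lambda>_. undefined) = g (A x)" if "x \<in> U" for x
    using D0 A(2) that by (auto simp: D'_def restrict_def)
  moreover have "continuous_map
      (prod_topology (subtopology (ltop E) U) (product_topology (\<lambda>_. ltop E) {..<k})) (ltop G) (D' k)" for k
  proof -
    have *: "continuous_map (prod_topology (subtopology (ltop E) U) (product_topology (\<lambda>_. ltop E) {..<k}))
        (prod_topology (subtopology (ltop F) S) (product_topology (\<lambda>_. ltop F) {..<k}))
        (\<lambda>z. (A (fst z), \<lambda>i\<in>{..<k}. L (snd z i)))"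
    proof (intro continuous_map_pairedI)
      show "continuous_map (prod_topology (subtopology (ltop E) U) (product_topology (\<lambda>_. ltop E) {..<k}))
          (subtopology (ltop F) S) (\<lambda>z. A (fst z))"
        using A by (intro continuous_map_compose[OF continuous_map_fst, unfolded comp_def])
          (auto simp: continuous_map_in_subtopology)
      have "continuous_map (prod_topology (subtopology (ltop E) U) (product_topology (\<lambda>_. ltop E) {..<k}))
          (ltop E) (\<lambda>z. snd z i)" if "i < k" for i
        using continuous_map_compose[OF continuous_map_snd continuous_map_product_projection[of i "{..<k}"]] that
        by (auto simp: comp_def)
      then show "continuous_map (prod_topology (subtopology (ltop E) U) (product_topology (\<lambda>_. ltop E) {..<k}))
          (product_topology (\<lambda>_. ltop F) {..<k}) (\<lambda>z. \<lambda>i\<in>{..<k}. L (snd z i))"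
        using continuous_map_compose[OF _ L] by (auto simp: continuous_map_componentwise comp_def)
    qed
    show ?thesis
      using continuous_map_compose[OF * Dc] by (simp add: D'_def comp_def case_prod_beta')
  qed
  moreover have "has_dirderiv E G (\<lambda>z. D' k (z, restrict ys {..<k})) x (ys k) (D' (Suc k) (x, ys))"
    if x: "x \<in> ltop E interior_of U" and ys: "ys \<in> {..<Suc k} \<rightarrow>\<^sub>E lcarrier E" for k x ys
  proof -
    have xU: "x \<in> U" by (rule subsetD[OF interior_of_subset x])
    \<comment> \<open>As \<open>S\<close> is open, every image point is interior, whatever the
      position of \<open>x\<close> in \<open>U\<close>.\<close>
    have "A x \<in> ltop F interior_of S" using A(2) xU S by (auto simp: interior_of_openin)
    moreover have Ls: "(\<lambda>i\<in>{..<Suc k}. L (ys i)) \<in> {..<Suc k} \<rightarrow>\<^sub>E lcarrier F"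
      using ys L by (auto simp: PiE_iff continuous_map_def)
    ultimately have "has_dirderiv F G (\<lambda>z. D k (z, restrict (\<lambda>i\<in>{..<Suc k}. L (ys i)) {..<k})) (A x)
        (L (ys k)) (D (Suc k) (A x, \<lambda>i\<in>{..<Suc k}. L (ys i)))"
      using Dd[of "A x" "\<lambda>i\<in>{..<Suc k}. L (ys i)" k] by simp
    moreover have "restrict (\<lambda>i\<in>{..<Suc k}. L (ys i)) {..<k} = (\<lambda>i\<in>{..<k}. L (restrict ys {..<k} i))"
      by (auto simp: restrict_def)
    moreover have "ys k \<in> lcarrier E" using ys by auto
    ultimately show ?thesis
      using AL[OF xU] by (simp add: has_dirderiv_def D'_def)
  qed
  ultimately have "bderivs E G U (\<lambda>x. g (A x)) D'" by (simp only: bderivs_def) simp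
  then show ?thesis using U by (auto simp: bsmooth_iff)
qed

text \<open>The \<open>k\<close>-th differential of \<open>f\<close> at \<open>x\<close> in the
  directions \<open>ys\<close>, the direction \<open>ys 0\<close> being used first.
  \<open>THE\<close> singles out a partial derivative, as \<open>csmooth\<close> merely asserts
  existence.\<close>

primrec iterated_deriv :: "nat \<Rightarrow> nat \<Rightarrow> ((nat \<Rightarrow> real) \<Rightarrow> real) \<Rightarrow> (nat \<Rightarrow> real) \<Rightarrow> (nat \<Rightarrow> nat \<Rightarrow> real) \<Rightarrow> real" where
  "iterated_deriv n 0 f x ys = f x"
| "iterated_deriv n (Suc k) f x ys =
     (\<Sum>i<n. ys 0 i * iterated_deriv n k (\<lambda>x. THE d. has_partial i f d x) x (\<lambda>j. ys (Suc j)))"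

lemma has_partial_unique: "has_partial i f d x \<Longrightarrow> has_partial i f d' x \<Longrightarrow> d = d'"
  unfolding has_partial_def by (rule DERIV_unique)

lemma csmooth_the_partial:
  assumes S: "openin (top_of_set (vecs n)) S" and f: "csmooth n S f" and i: "i < n"
  shows "csmooth n S (\<lambda>x. THE d. has_partial i f d x)"
    and "x \<in> S \<Longrightarrow> has_partial i f (THE d. has_partial i f d x) x"
proof -
  obtain f' where f': "csmooth n S f'" "\<And>x. x \<in> S \<Longrightarrow> has_partial i f (f' x) x"
    using csmooth_partial[OF f i] by blast
  then have eq: "(THE d. has_partial i f d x) = f' x" if "x \<in> S" for x
    using that has_partial_unique by blast
  show "csmooth n S (\<lambda>x. THE d. has_partial i f d x)"
    by (rule csmooth_cong[OF S f'(1) eq])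
  show "x \<in> S \<Longrightarrow> has_partial i f (THE d. has_partial i f d x) x"
    using eq f'(2) by simp
qed

lemma iterated_deriv_cong: "(\<And>j. j < k \<Longrightarrow> ys j = zs j) \<Longrightarrow> iterated_deriv n k f x ys = iterated_deriv n k f x zs"
proof (induction k arbitrary: f ys zs)
  case (Suc k)
  then have "iterated_deriv n k h x (\<lambda>j. ys (Suc j)) = iterated_deriv n k h x (\<lambda>j. zs (Suc j))" for h
    by (intro Suc.IH) simp
  with Suc.prems show ?case by simp
qed simp

lemma continuous_map_iterated_deriv:
  assumes S: "openin (top_of_set (vecs n)) S"
    and a: "continuous_map T (top_of_set S) a"
    and ys: "\<And>j i. j < k \<Longrightarrow> i < n \<Longrightarrow> continuous_map T euclideanreal (\<lambda>z. ys z j i)"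
    and f: "csmooth n S f"
  shows "continuous_map T euclideanreal (\<lambda>z. iterated_deriv n k f (a z) (ys z))"
  using ys f
proof (induction k arbitrary: f ys)
  case 0
  then show ?case
    using continuous_map_compose[OF a, of euclideanreal f] csmooth_continuous_on by (auto simp: comp_def)
next
  case (Suc k)
  then show ?case
    by (auto intro!: continuous_map_sum continuous_map_real_mult Suc.IH csmooth_the_partial(1)[OF S])
qed

text \<open>The recursion strips the first direction while the new one, \<open>ys k\<close>, comes
  last. The outer factors \<open>ys 0 i\<close> do not depend on \<open>t\<close>, so the derivative
  moves inwards through the sums until only the line derivative of a single smooth function is
  left.\<close>

lemma iterated_deriv_derivative:
  assumes S: "openin (top_of_set (vecs n)) S" and f: "csmooth n S f" and x: "x \<in> S" and y: "y \<in> vecs n"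
    and yk: "\<forall>i<n. ys k i = y i"
  shows "((\<lambda>t. iterated_deriv n k f (\<lambda>i. x i + t * y i) ys) has_real_derivative iterated_deriv n (Suc k) f x ys) (at 0)"
  using f yk
proof (induction k arbitrary: f ys)
  case 0
  have xv: "x \<in> vecs n" using S x openin_subset by fastforce
  have "((\<lambda>t. f (\<lambda>i. x i + t * y i)) has_real_derivative
      (\<Sum>j<n. y j * (THE d. has_partial j f d (\<lambda>i. x i + 0 * y i)))) (at 0)"
    using x xv y csmooth_the_partial[OF S 0(1)]
    by (intro has_derivative_along_curve[OF S, where g' = "\<lambda>j x. THE d. has_partial j f d x"])
      (auto intro!: derivative_eq_intros csmooth_continuous_on)
  then show ?case using 0 by simp
next
  case (Suc k)
  have "((\<lambda>t. \<Sum>i<n. ys 0 i * iterated_deriv n k (\<lambda>x. THE d. has_partial i f d x) (\<lambda>i. x i + t * y i) (\<lambda>j. ys (Suc j)))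
      has_real_derivative
      (\<Sum>i<n. ys 0 i * iterated_deriv n (Suc k) (\<lambda>x. THE d. has_partial i f d x) x (\<lambda>j. ys (Suc j)))) (at 0)"
    using Suc.prems csmooth_the_partial(1)[OF S Suc.prems(1)]
    by (intro DERIV_sum DERIV_cmult Suc.IH) auto
  then show ?case by simp
qed

lemma bsmooth_if_csmooth:
  assumes S: "openin (top_of_set (vecs n)) S" and f: "\<And>j. j < l \<Longrightarrow> csmooth n S (\<lambda>x. f x j)"
    and fv: "f ` S \<subseteq> vecs l"
  shows "bsmooth (euclid n) (euclid l) S f"
proof -
  have Sv: "S \<subseteq> vecs n" using S openin_subset by fastforce
  \<comment> \<open>Filling up with 0 from index \<open>l\<close> on keeps the values in
    \<open>vecs l\<close>, also at points outside \<open>S\<close>.\<close>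
  define D where "D k = (\<lambda>(x, ys) j. if j < l then iterated_deriv n k (\<lambda>z. f z j) x ys else 0)" for k
  have "D 0 (x, \<lambda>_. undefined) = f x" if "x \<in> S" for x
    using fv that by (auto simp: D_def fun_eq_iff image_subset_iff)
  moreover have "continuous_map (prod_topology (subtopology (ltop (euclid n)) S)
      (product_topology (\<lambda>_. ltop (euclid n)) {..<k})) (ltop (euclid l)) (D k)" for k
  proof -
    let ?T = "prod_topology (top_of_set S) (product_topology (\<lambda>_. top_of_set (vecs n)) {..<k})"
    have "continuous_map ?T euclideanreal (\<lambda>z. iterated_deriv n k (\<lambda>z. f z j) (fst z) (snd z))" if "j < l" for j
    proof (rule continuous_map_iterated_deriv[OF S continuous_map_fst _ f[OF that]])
      fix i m assume "i < k" "m < n"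
      then have "continuous_map ?T (top_of_set (vecs n)) (\<lambda>z. snd z i)"
        using continuous_map_compose[OF continuous_map_snd continuous_map_product_projection[of i "{..<k}"]]
        by (auto simp: comp_def)
      then show "continuous_map ?T euclideanreal (\<lambda>z. snd z i m)"
        using \<open>m < n\<close> continuous_map_vecs_iff[of ?T n "\<lambda>z. snd z i"] by blast
    qed
    moreover have "subtopology (ltop (euclid n)) S = top_of_set S"
      using Sv by (simp add: subtopology_subtopology Int_absorb1)
    ultimately show ?thesis
      unfolding ltop_euclid[of l] continuous_map_vecs_iff by (auto simp: D_def case_prod_beta')
  qed
  moreover have "has_dirderiv (euclid n) (euclid l) (\<lambda>z. D k (z, restrict ys {..<k})) x (ys k) (D (Suc k) (x, ys))"
    if x: "x \<in> ltop (euclid n) interior_of S" and ys: "ys \<in> {..<Suc k} \<rightarrow>\<^sub>E lcarrier (euclid n)" for k x ys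
  proof -
    have xS: "x \<in> S" by (rule subsetD[OF interior_of_subset x])
    have cong: "iterated_deriv n k h z (restrict ys {..<k}) = iterated_deriv n k h z ys" for h z
      by (rule iterated_deriv_cong) simp
    have "((\<lambda>t. (iterated_deriv n k (\<lambda>z. f z i) (\<lambda>i. x i + t * ys k i) ys - iterated_deriv n k (\<lambda>z. f z i) x ys) / t)
        \<longlongrightarrow> iterated_deriv n (Suc k) (\<lambda>z. f z i) x ys) (at 0)" if "i < l" for i
      using iterated_deriv_derivative[OF S f[OF that] xS, of "ys k" ys k] ys
      by (auto simp: has_field_derivative_iff simp del: iterated_deriv.simps)
    then show ?thesis
      by (auto simp: has_dirderiv_euclid D_def cong simp del: iterated_deriv.simps)
  qed
  ultimately have "bderivs (euclid n) (euclid l) S f D" by (simp only: bderivs_def) simp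
  then show ?thesis using Sv by (auto simp: bsmooth_iff)
qed

text \<open>The invariant class consists of the components of all \<open>D k (\<cdot>, ys)\<close>
  with fixed directions \<open>ys\<close>. It is closed under partial derivatives, because
  \<open>D (Suc k)\<close> differentiates in one further direction.\<close>

lemma csmooth_if_bsmooth:
  assumes S: "openin (top_of_set (vecs n)) S" and f: "bsmooth (euclid n) (euclid l) S f"
  shows "csmooth n S (\<lambda>x. f x j)"
proof -
  have Sv: "S \<subseteq> vecs n" using S openin_subset by fastforce
  have top: "subtopology (top_of_set (vecs n)) S = top_of_set S"
    using Sv by (simp add: subtopology_subtopology Int_absorb1)
  obtain D where D: "bderivs (euclid n) (euclid l) S f D"
    using f by (auto simp: bsmooth_iff)
  have int: "ltop (euclid n) interior_of S = S" using S by (simp add: interior_of_openin)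
  note D0 = bderivsD(1)[OF D] and Dc = bderivsD(2)[OF D, simplified ltop_euclid top]
    and Dd = bderivsD(3)[OF D, unfolded int, simplified ltop_euclid topspace_euclidean_subtopology]
  have "csmooth n S (\<lambda>x. D k (x, ys) j)" if "ys \<in> {..<k} \<rightarrow>\<^sub>E vecs n" for k ys
    using that
  proof (coinduction arbitrary: k ys)
    case csmooth
    have "continuous_map (top_of_set S) (prod_topology (top_of_set S) (product_topology (\<lambda>_. top_of_set (vecs n)) {..<k}))
        (\<lambda>x. (x, ys))"
      using csmooth by (auto intro!: continuous_map_pairedI)
    from continuous_map_compose[OF this Dc]
    have "continuous_on S (\<lambda>x. D k (x, ys))"
      by (auto simp: comp_def continuous_map_in_subtopology)
    then have cont: "continuous_on S (\<lambda>x. D k (x, ys) j)" by (rule continuous_on_product_then_coordinatewise)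
    have "\<exists>f'. ((\<exists>k ys. f' = (\<lambda>x. D k (x, ys) j) \<and> ys \<in> {..<k} \<rightarrow>\<^sub>E vecs n) \<or> csmooth n S f') \<and>
        (\<forall>x\<in>S. has_partial i (\<lambda>x. D k (x, ys) j) (f' x) x)" if i: "i < n" for i
    proof -
      \<comment> \<open>The \<open>i\<close>-th unit vector is appended as the direction with index
        \<open>k\<close>.\<close>
      define ys' where "ys' = ys(k := (\<lambda>j. if j = i then 1 else 0))"
      have ys': "ys' \<in> {..<Suc k} \<rightarrow>\<^sub>E vecs n" "restrict ys' {..<k} = ys"
        using csmooth i by (auto simp: ys'_def PiE_iff extensional_def restrict_def fun_eq_iff)
      have "has_partial i (\<lambda>x. D k (x, ys) j) (D (Suc k) (x, ys') j) x" if "x \<in> S" for x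
      proof -
        have "(\<lambda>j. x j + t * ys' k j) = x(i := x i + t)" for t
          by (auto simp: ys'_def)
        then have "((\<lambda>t. (D k (x(i := x i + t), ys) j - D k (x, ys) j) / t) \<longlongrightarrow> D (Suc k) (x, ys') j) (at 0)"
          using Dd[OF that ys'(1)] ys'(2) by (simp add: has_dirderiv_euclid)
        then show ?thesis by (simp add: has_partial_def DERIV_def)
      qed
      with ys'(1) show ?thesis by (intro exI[of _ "\<lambda>x. D (Suc k) (x, ys') j"] conjI ballI) blast+
    qed
    with cont show ?case by (intro exI[of _ "\<lambda>x. D k (x, ys) j"]) auto
  qed
  from this[of "\<lambda>_. undefined" 0] have "csmooth n S (\<lambda>x. D 0 (x, \<lambda>_. undefined) j)" by simp
  then show ?thesis by (rule csmooth_cong[OF S]) (simp add: D0)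
qed

lemma bsmooth_range:
  assumes "bsmooth E F U f" shows "f ` U \<subseteq> lcarrier F"
proof -
  obtain D where D: "bderivs E F U f D" and U: "U \<subseteq> lcarrier E"
    using assms by (auto simp: bsmooth_iff)
  note D0 = bderivsD(1)[OF D] and Dc = bderivsD(2)[OF D, of 0]
  have "D 0 (x, \<lambda>_. undefined) \<in> lcarrier F" if "x \<in> U" for x
    using continuous_map_image_subset_topspace[OF Dc] that U by auto
  then show ?thesis using D0 by auto
qed

lemma bsmooth_compose:
  assumes U: "openin (top_of_set (vecs n)) U" and S: "openin (top_of_set (vecs k)) S"
    and f: "bsmooth (euclid n) (euclid k) U f" "f ` U \<subseteq> S" and g: "bsmooth (euclid k) (euclid l) S g"
  shows "bsmooth (euclid n) (euclid l) U (\<lambda>x. g (f x))"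
  using f bsmooth_range[OF g]
  by (intro bsmooth_if_csmooth U csmooth_compose[OF U S _ f(2) csmooth_if_bsmooth[OF S g]] csmooth_if_bsmooth[OF U f(1)])
     auto

section \<open>Extension of locally defined smooth maps\<close>

text \<open>For \<open>k = 0\<close> this is the classical smooth function that is flat at 0. The
  denominators make the family closed under differentiation up to linear combinations, which is what
  \<open>csmooth_alg\<close> asks of generators.\<close>

definition flat :: "nat \<Rightarrow> real \<Rightarrow> real" where
  "flat k x = (if x > 0 then exp (- 1 / x) / x ^ k else 0)"

text \<open>After the substitution of 1/x, the exponential beats every power; on the left the
  function is 0.\<close>

lemma flat_tendsto_0: "(flat k \<longlongrightarrow> 0) (at 0)"
proof -
  have "((\<lambda>x. inverse x ^ k / exp (inverse x)) \<longlongrightarrow> 0) (at_right (0::real))"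
    by (rule filterlim_compose[OF tendsto_power_div_exp_0 filterlim_inverse_at_top_right])
  moreover have "\<forall>\<^sub>F x in at_right (0::real). inverse x ^ k / exp (inverse x) = flat k x"
    unfolding eventually_at_filter by (rule always_eventually) (auto simp: flat_def exp_minus field_simps)
  ultimately have "(flat k \<longlongrightarrow> 0) (at_right 0)" by (rule Lim_transform_eventually)
  moreover have "(flat k \<longlongrightarrow> 0) (at_left 0)"
  proof (rule Lim_transform_eventually[OF tendsto_const])
    show "\<forall>\<^sub>F x in at_left 0. 0 = flat k x"
      unfolding eventually_at_filter by (rule always_eventually) (auto simp: flat_def)
  qed
  ultimately show ?thesis by (simp add: filterlim_at_split)
qed

lemma flat_has_derivative:
  "(flat k has_real_derivative flat (k + 2) x - k * flat (k + 1) x) (at x)"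
proof -
  consider "x > 0" | "x < 0" | "x = 0" by linarith
  then show ?thesis
  proof cases
    case 1
    have "((\<lambda>x. exp (- 1 / x) / x ^ k) has_real_derivative flat (k + 2) x - k * flat (k + 1) x) (at x)"
      using 1 by (cases k) (auto intro!: derivative_eq_intros simp: flat_def field_simps power2_eq_square,
          metis One_nat_def power_eq_if)
    then show ?thesis
      by (rule has_field_derivative_transform_within_open[of _ _ _ "{0<..}"]) (use 1 in \<open>auto simp: flat_def\<close>)
  next
    case 2
    have "((\<lambda>_. 0) has_real_derivative flat (k + 2) x - k * flat (k + 1) x) (at x)"
      using 2 by (auto simp: flat_def)
    then show ?thesis
      by (rule has_field_derivative_transform_within_open[of _ _ _ "{..<0}"]) (use 2 in \<open>auto simp: flat_def\<close>)
  next
    case 3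
    \<comment> \<open>The difference quotient of \<open>flat k\<close> at 0 is
      \<open>flat (Suc k)\<close>.\<close>
    have "((\<lambda>t. (flat k t - flat k 0) / (t - 0)) \<longlongrightarrow> 0) (at 0)"
      by (rule Lim_transform_eventually[OF flat_tendsto_0[of "Suc k"]])
        (auto simp: flat_def eventually_at_filter)
    then show ?thesis using 3 by (simp add: has_field_derivative_iff flat_def)
  qed
qed

text \<open>Here the generators are the smooth functions and the whole family
  \<open>flat k \<circ> f\<close>, since differentiation raises \<open>k\<close>.\<close>

lemma csmooth_flat:
  assumes f: "csmooth n S f"
  shows "csmooth n S (\<lambda>x. flat k (f x))"
proof (rule csmooth_alg)
  let ?B = "{f. csmooth n S f} \<union> range (\<lambda>k x. flat k (f x))"
  show "alg ?B (\<lambda>x. flat k (f x))" by (auto intro: alg_gen)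
  fix g assume g: "g \<in> ?B"
  have "continuous_on UNIV (flat k)" for k
    by (rule DERIV_continuous_on) (rule has_field_derivative_at_within[OF flat_has_derivative])
  then have "continuous_on S (\<lambda>x. flat k (f x))" for k
    using csmooth_continuous_on[OF f] by (rule continuous_on_compose2) simp
  then show "continuous_on S g" using g csmooth_continuous_on[of n S g] by auto
  fix i assume i: "i < n"
  obtain f' where f': "csmooth n S f'" "\<forall>x\<in>S. has_partial i f (f' x) x"
    using csmooth_partial[OF f i] by blast
  have "\<exists>g'. alg ?B g' \<and> (\<forall>x\<in>S. has_partial i (\<lambda>x. flat k (f x)) (g' x) x)" for k
  proof (intro exI[of _ "\<lambda>x. (flat (k + 2) (f x) + (- real k) * flat (k + 1) (f x)) * f' x"] conjI ballI)
    show "alg ?B (\<lambda>x. (flat (k + 2) (f x) + (- real k) * flat (k + 1) (f x)) * f' x)"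
      using f' by (intro alg_mult alg_add alg_const) (auto intro!: alg_gen)
    fix x assume "x \<in> S"
    then have "((\<lambda>t. f (x(i := t))) has_real_derivative f' x) (at (x i))"
      using f'(2) by (simp add: has_partial_def)
    from DERIV_chain2[OF _ this, of "flat k" "flat (k + 2) (f x) - k * flat (k + 1) (f x)"]
    show "has_partial i (\<lambda>x. flat k (f x)) ((flat (k + 2) (f x) + (- real k) * flat (k + 1) (f x)) * f' x) x"
      using flat_has_derivative[of k "f x"] by (simp add: has_partial_def)
  qed
  then show "\<exists>g'. alg ?B g' \<and> (\<forall>x\<in>S. has_partial i g (g' x) x)"
    using g csmooth_partial[OF _ i, of S g] by (auto intro: alg_gen)
qed

text \<open>Equal to 1 on \<open>[-1, 1]\<close>, where the inner bump vanishes, and to 0 outside \<open>[-2, 2]\<close>, where the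
  argument of the outer one is not positive.\<close>

definition plateau :: "real \<Rightarrow> real" where
  "plateau t = flat 0 (1 - flat 0 (t * t - 1) / flat 0 3) / flat 0 1"

lemma flat_0_mono: "x \<le> y \<Longrightarrow> flat 0 x \<le> flat 0 y"
  by (auto simp: flat_def field_simps)

lemma plateau_eq_1: "\<bar>t\<bar> \<le> 1 \<Longrightarrow> plateau t = 1"
proof -
  assume "\<bar>t\<bar> \<le> 1"
  then have "t * t \<le> 1" by (metis abs_mult_self_eq abs_square_le_1 power2_eq_square)
  then show ?thesis by (simp add: plateau_def flat_def)
qed

lemma plateau_bounds: "0 \<le> plateau t" "plateau t \<le> 1" "\<bar>t\<bar> \<ge> 2 \<Longrightarrow> plateau t = 0"
proof -
  have nonneg: "flat 0 x \<ge> 0" for x by (simp add: flat_def)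
  have pos: "flat 0 1 > 0" "flat 0 3 > 0" by (simp_all add: flat_def)
  show "0 \<le> plateau t" using nonneg by (simp add: plateau_def)
  have "flat 0 (1 - flat 0 (t * t - 1) / flat 0 3) \<le> flat 0 1"
    using nonneg by (intro flat_0_mono) simp
  then show "plateau t \<le> 1" using pos by (simp add: plateau_def)
  assume "\<bar>t\<bar> \<ge> 2"
  then have "t * t \<ge> 2 * 2" using mult_mono[of 2 "\<bar>t\<bar>" 2 "\<bar>t\<bar>"] by simp
  \<comment> \<open>The number 3 is the value of \<open>t * t - 1\<close> at
    \<bar>\<open>t\<close>\<bar> = 2: from there on the normalised inner bump is at least 1.\<close>
  then have "flat 0 3 \<le> flat 0 (t * t - 1)" by (intro flat_0_mono) simp
  then have "1 - flat 0 (t * t - 1) / flat 0 3 \<le> 0" using pos by simp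
  then show "plateau t = 0" by (simp add: plateau_def flat_def[of 0 "1 - _"])
qed

text \<open>The function \<open>t * plateau t\<close> is the identity on [-1, 1] and yet bounded on
  the whole line; rescaled, it yields the coordinates of the map \<open>\<rho>\<close> in
  \<open>smooth_extension\<close>.\<close>

lemma abs_mult_plateau_le: "\<bar>t * plateau t\<bar> \<le> 2"
proof (cases "\<bar>t\<bar> \<ge> 2")
  case False
  then have "\<bar>t\<bar> * \<bar>plateau t\<bar> \<le> 2 * 1"
    using plateau_bounds(1,2)[of t] by (intro mult_mono) auto
  then show ?thesis by (simp add: abs_mult)
qed (simp add: plateau_bounds)

lemma csmooth_plateau: "csmooth n S f \<Longrightarrow> csmooth n S (\<lambda>x. plateau (f x))"
proof -
  assume f: "csmooth n S f"
  have "csmooth n S (\<lambda>x. flat 0 (1 + (- 1 / flat 0 3) * flat 0 (f x * f x + (- 1))) * (1 / flat 0 1))"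
    by (intro csmooth_mult csmooth_flat csmooth_add csmooth_const f)
  then show ?thesis by (simp add: plateau_def)
qed

text \<open>Composing with a smooth retraction onto a small box, rather than multiplying with a cutoff
  function, extends a locally defined smooth function to the whole space.\<close>

lemma smooth_extension:
  assumes S: "openin (top_of_set (vecs k)) S" and a: "a \<in> S"
    and f: "bsmooth (euclid k) (euclid l) S f"
  shows "\<exists>g T. bsmooth (euclid k) (euclid l) (vecs k) g \<and> openin (top_of_set (vecs k)) T \<and>
     a \<in> T \<and> T \<subseteq> S \<and> (\<forall>x\<in>T. g x = f x)"
proof -
  have av: "a \<in> vecs k" using S a openin_subset by fastforce
  obtain \<delta> where \<delta>: "\<delta> > 0" "\<forall>y\<in>vecs k. (\<forall>i<k. \<bar>y i - a i\<bar> < \<delta>) \<longrightarrow> y \<in> S"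
    using open_box[OF S a] by blast
  \<comment> \<open>Each coordinate of \<open>\<rho> y\<close> stays within \<open>2 * e\<close> of
    that of \<open>a\<close>, which a third of \<open>\<delta>\<close> makes smaller than
    \<open>\<delta>\<close>.\<close>
  define e where "e = \<delta> / 3"
  have e: "e > 0" using \<delta> by (simp add: e_def)
  \<comment> \<open>In every coordinate this is t \<mapsto> \<open>t * plateau t\<close>, centred at
    \<open>a i\<close> and scaled by \<open>e\<close>; hence it fixes the box \<open>T\<close> and
    sends everything into \<open>S\<close>.\<close>
  define \<rho> where "\<rho> y = (\<lambda>i. if i < k then a i + e * ((y i - a i) / e * plateau ((y i - a i) / e)) else 0)"
    for y :: "nat \<Rightarrow> real"
  have \<rho>S: "\<rho> y \<in> S" for y
  proof (rule \<delta>(2)[rule_format])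
    show "\<rho> y \<in> vecs k" by (simp add: \<rho>_def)
    fix i assume i: "i < k"
    have "\<bar>\<rho> y i - a i\<bar> \<le> e * 2"
      using i e mult_left_mono[OF abs_mult_plateau_le[of "(y i - a i) / e"], of e]
      by (simp add: \<rho>_def abs_mult)
    then show "\<bar>\<rho> y i - a i\<bar> < \<delta>" using \<delta>(1) by (simp add: e_def)
  qed
  define T where "T = {y \<in> vecs k. \<forall>i<k. \<bar>y i - a i\<bar> < e}"
  have \<rho>T: "\<rho> y = y" if "y \<in> T" for y
    using that e by (auto simp: \<rho>_def T_def fun_eq_iff plateau_eq_1)
  have "csmooth k (vecs k) (\<lambda>y. \<rho> y j)" if "j < k" for j
  proof -
    have "csmooth k (vecs k) (\<lambda>y. a j + (e * ((y j + - a j) * (1 / e))) * plateau ((y j + - a j) * (1 / e)))"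
      by (intro csmooth_add csmooth_mult csmooth_plateau csmooth_const csmooth_coord)
    then show ?thesis using that e by (simp add: \<rho>_def algebra_simps diff_divide_distrib)
  qed
  then have "bsmooth (euclid k) (euclid k) (vecs k) \<rho>"
    by (intro bsmooth_if_csmooth) (auto simp: \<rho>_def)
  then have "bsmooth (euclid k) (euclid l) (vecs k) (\<lambda>y. f (\<rho> y))"
    using \<rho>S by (intro bsmooth_compose[OF _ S _ _ f]) auto
  moreover have "a \<in> T" using av e by (simp add: T_def)
  moreover have "T \<subseteq> S" using \<rho>S \<rho>T by (metis subsetI)
  moreover have "openin (top_of_set (vecs k)) T" unfolding T_def by (rule openin_boxI)
  ultimately show ?thesis using \<rho>T by (intro exI[of _ "\<lambda>y. f (\<rho> y)"] exI[of _ T]) simp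
qed

section \<open>Charts\<close>

lemma orthant_subset: "orthant m \<subseteq> vecs m"
  by (auto simp: orthant_def)

lemma orthant_top_eq [simp]: "subtopology (top_of_set (vecs m)) (orthant m) = top_of_set (orthant m)"
  using orthant_subset[of m] by (simp add: subtopology_subtopology Int_absorb1)

lemma is_chartD:
  assumes "is_chart X E Q c"
  shows "ch_model c = E" "openin X (ch_dom c)" "ch_map c \<in> extensional (ch_dom c)"
    "openin (subtopology (ltop E) Q) (ch_img c)"
    "homeomorphic_map (subtopology X (ch_dom c)) (subtopology (ltop E) (ch_img c)) (ch_map c)"
  using assms by (simp_all add: is_chart_def)

lemma chart_dom_subset: "is_chart X E Q c \<Longrightarrow> ch_dom c \<subseteq> topspace X"
  by (rule openin_subset[OF is_chartD(2)])

lemma chart_img_subset: "is_chart X E Q c \<Longrightarrow> ch_img c \<subseteq> lcarrier E \<inter> Q"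
  using openin_subset[OF is_chartD(4)] by fastforce

lemma chart_inj: "is_chart X E Q c \<Longrightarrow> inj_on (ch_map c) (ch_dom c)"
  using homeomorphic_imp_injective_map[OF is_chartD(5), of X E Q c] chart_dom_subset[of X E Q c]
  by (simp add: Int_absorb1)

lemma chart_inv_map: "is_chart X E Q c \<Longrightarrow> p \<in> ch_dom c \<Longrightarrow> ch_inv c (ch_map c p) = p"
  by (simp add: chart_inj inv_into_f_f)

lemma chart_inv_mem: "x \<in> ch_img c \<Longrightarrow> ch_inv c x \<in> ch_dom c"
  by (rule inv_into_into)

lemma chart_map_inv: "x \<in> ch_img c \<Longrightarrow> ch_map c (ch_inv c x) = x"
  by (rule f_inv_into_f)

lemma openin_subtopology_trans:
  assumes "openin (subtopology X V) W" "openin (subtopology X Q) V" "V \<subseteq> Q"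
  shows "openin (subtopology X Q) W"
  using openin_trans_full[of "subtopology X Q" V W] assms
  by (simp add: subtopology_subtopology Int_absorb1)

lemma chart_open_image:
  assumes c: "is_chart X E Q c" and V: "openin X V" "V \<subseteq> ch_dom c"
  shows "openin (subtopology (ltop E) Q) (ch_map c ` V)"
proof -
  have "openin (subtopology X (ch_dom c)) V"
    using V by (metis inf.absorb1 openin_subtopology)
  then have "openin (subtopology (ltop E) (ch_img c)) (ch_map c ` V)"
    using homeomorphic_imp_open_map[OF is_chartD(5)[OF c]] by (simp add: open_map_def)
  then show ?thesis
    using openin_subtopology_trans[OF _ is_chartD(4)[OF c]] chart_img_subset[OF c] by blast
qed

lemma chart_continuous:
  assumes c: "is_chart X E Q c"
  shows "continuous_map (subtopology X (ch_dom c)) (ltop E) (ch_map c)"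
  using homeomorphic_imp_continuous_map[OF is_chartD(5)[OF c]]
  by (simp add: continuous_map_in_subtopology)

lemma chart_open_preimage:
  assumes c: "is_chart X E Q c" and W: "openin (subtopology (ltop E) Q) W"
  shows "openin X {p \<in> ch_dom c. ch_map c p \<in> W}"
proof -
  obtain T where T: "openin (ltop E) T" "W = T \<inter> Q"
    using W by (auto simp: openin_subtopology)
  have "{p \<in> ch_dom c. ch_map c p \<in> W} = {p \<in> ch_dom c. ch_map c p \<in> T}"
    using T chart_img_subset[OF c] by auto
  moreover have "openin (subtopology X (ch_dom c)) {p \<in> ch_dom c. ch_map c p \<in> T}"
    using openin_continuous_map_preimage[OF chart_continuous[OF c] T(1)] chart_dom_subset[OF c]
    by (simp add: Int_absorb1)
  ultimately show ?thesis
    using openin_trans_full[OF _ is_chartD(2)[OF c]] by metis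
qed

text \<open>The definition of \<open>maps\<close> wants charts whose entire image belongs to \<U>,
  and these arise by shrinking. The map is cut down along with the domain because
  \<open>is_chart\<close> requires it to be extensional.\<close>

definition restrict_chart :: "('p, 'e) chart \<Rightarrow> 'e set \<Rightarrow> ('p, 'e) chart" where
  "restrict_chart c W = \<lparr>ch_model = ch_model c, ch_dom = {p \<in> ch_dom c. ch_map c p \<in> W},
     ch_map = restrict (ch_map c) {p \<in> ch_dom c. ch_map c p \<in> W}\<rparr>"

lemma restrict_chart_simps:
  shows ch_dom_restrict_chart: "ch_dom (restrict_chart c W) = {p \<in> ch_dom c. ch_map c p \<in> W}"
    and "ch_model (restrict_chart c W) = ch_model c"
    and ch_img_restrict_chart: "W \<subseteq> ch_img c \<Longrightarrow> ch_img (restrict_chart c W) = W"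
  by (auto simp: restrict_chart_def)

lemma ch_inv_restrict_chart:
  assumes c: "is_chart X E Q c" and W: "W \<subseteq> ch_img c" "x \<in> W"
  shows "ch_inv (restrict_chart c W) x = ch_inv c x"
proof (rule inv_into_f_eq)
  show "inj_on (ch_map (restrict_chart c W)) (ch_dom (restrict_chart c W))"
    using chart_inj[OF c] by (auto simp: inj_on_def restrict_chart_def)
qed (use W in \<open>auto simp: restrict_chart_def chart_map_inv chart_inv_mem subsetD\<close>)

lemma is_chart_restrict:
  assumes c: "is_chart X E Q c" and W: "openin (subtopology (ltop E) Q) W" "W \<subseteq> ch_img c"
  shows "is_chart X E Q (restrict_chart c W)"
proof -
  let ?D = "{p \<in> ch_dom c. ch_map c p \<in> W}"
  have D: "?D \<subseteq> ch_dom c" by auto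
  have "homeomorphic_map (subtopology X ?D) (subtopology (ltop E) W) (ch_map c)"
  proof -
    have "topspace (subtopology (ltop E) (ch_img c)) \<inter> W = ch_map c ` (topspace (subtopology X (ch_dom c)) \<inter> ?D)"
      using W(2) chart_dom_subset[OF c] chart_img_subset[OF c] by auto
    from homeomorphic_map_subtopologies[OF is_chartD(5)[OF c], of ?D W] this
    show ?thesis
      using D W(2) by (simp add: subtopology_subtopology Int_absorb1 Int_absorb2 inf.absorb2)
  qed
  then have "homeomorphic_map (subtopology X ?D) (subtopology (ltop E) W) (restrict (ch_map c) ?D)"
    by (rule homeomorphic_map_eq) auto
  then show ?thesis
    using is_chartD[OF c] chart_open_preimage[OF c W(1)] W ch_img_restrict_chart[OF W(2)]
    unfolding is_chart_def by (simp add: restrict_chart_def)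
qed

lemma smoothly_compatible_restrict:
  assumes c: "is_chart X E Q c" and W: "W \<subseteq> ch_img c" and d: "is_chart X' E' Q' d" and cd: "smoothly_compatible c d"
  shows "smoothly_compatible (restrict_chart c W) d"
proof -
  let ?r = "restrict_chart c W"
  have dom: "ch_dom ?r \<inter> ch_dom d \<subseteq> ch_dom c \<inter> ch_dom d" by (auto simp: restrict_chart_def)
  have img: "ch_map ?r ` (ch_dom ?r \<inter> ch_dom d) \<subseteq> ch_map c ` (ch_dom c \<inter> ch_dom d)"
    by (auto simp: restrict_chart_def)
  have "bsmooth (ch_model c) (ch_model d) (ch_map ?r ` (ch_dom ?r \<inter> ch_dom d)) (ch_map d \<circ> ch_inv ?r)"
  proof (rule bsmooth_cong[OF bsmooth_mono[OF _ img]])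
    show "bsmooth (ch_model c) (ch_model d) (ch_map c ` (ch_dom c \<inter> ch_dom d)) (ch_map d \<circ> ch_inv c)"
      using cd by (simp add: smoothly_compatible_def)
    fix x assume "x \<in> ch_map ?r ` (ch_dom ?r \<inter> ch_dom d)"
    then show "(ch_map d \<circ> ch_inv ?r) x = (ch_map d \<circ> ch_inv c) x"
      using ch_inv_restrict_chart[OF c W] by (auto simp: restrict_chart_def)
  qed
  moreover have "bsmooth (ch_model d) (ch_model c) (ch_map d ` (ch_dom ?r \<inter> ch_dom d)) (ch_map ?r \<circ> ch_inv d)"
  proof (rule bsmooth_cong[OF bsmooth_mono[OF _ image_mono[OF dom]]])
    show "bsmooth (ch_model d) (ch_model c) (ch_map d ` (ch_dom c \<inter> ch_dom d)) (ch_map c \<circ> ch_inv d)"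
      using cd by (simp add: smoothly_compatible_def)
    fix x assume "x \<in> ch_map d ` (ch_dom ?r \<inter> ch_dom d)"
    then obtain p where p: "p \<in> ch_dom ?r" "p \<in> ch_dom d" "x = ch_map d p" by auto
    show "(ch_map ?r \<circ> ch_inv d) x = (ch_map c \<circ> ch_inv d) x"
      using p chart_inv_map[OF d p(2)] by (auto simp: restrict_chart_def)
  qed
  ultimately show ?thesis by (simp add: smoothly_compatible_def restrict_chart_simps)
qed

lemma maximal_atlasD:
  assumes "maximal_atlas X E Q A"
  shows "p \<in> topspace X \<Longrightarrow> \<exists>c\<in>A. p \<in> ch_dom c"
    "c \<in> A \<Longrightarrow> is_chart X E Q c"
    "c \<in> A \<Longrightarrow> d \<in> A \<Longrightarrow> smoothly_compatible c d"
  using assms by (auto simp: maximal_atlas_def)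

text \<open>This is where maximality of the atlas enters: the smaller chart is compatible with every
  chart of the atlas.\<close>

lemma restrict_chart_in_atlas:
  assumes A: "maximal_atlas X E Q A" and c: "c \<in> A"
    and W: "openin (subtopology (ltop E) Q) W" "W \<subseteq> ch_img c"
  shows "restrict_chart c W \<in> A"
proof -
  have "restrict_chart c W \<in> compatible_charts X E Q A"
    using is_chart_restrict[OF maximal_atlasD(2)[OF A c] W]
      smoothly_compatible_restrict[OF maximal_atlasD(2)[OF A c] W(2) maximal_atlasD(2)[OF A]
        maximal_atlasD(3)[OF A c]]
    by (auto simp: compatible_charts_def)
  then show ?thesis using A by (auto simp: maximal_atlas_def)
qed

section \<open>Local properties of suitable families\<close>

lemma ltop_prod_lcs [simp]: "ltop (prod_lcs E F) = prod_topology (ltop E) (ltop F)"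
  by (simp add: prod_lcs_def)

lemma ladd_prod_lcs [simp]: "ladd (prod_lcs E F) x y = (ladd E (fst x) (fst y), ladd F (snd x) (snd y))"
  and lscale_prod_lcs [simp]: "lscale (prod_lcs E F) r x = (lscale E r (fst x), lscale F r (snd x))"
  by (simp_all add: prod_lcs_def case_prod_beta)

lemma bsmooth_id: "U \<subseteq> vecs n \<Longrightarrow> bsmooth (euclid n) (euclid n) U (\<lambda>x. x)"
  by (rule bsmooth_mono[OF bsmooth_if_csmooth[of n "vecs n"]]) (auto intro: csmooth_coord)

lemma relatively_compact_in_subset:
  "relatively_compact_in X W U \<Longrightarrow> W \<subseteq> topspace X \<Longrightarrow> W \<subseteq> U"
  unfolding relatively_compact_in_def by (meson closure_of_subset order_trans)

lemma relatively_compact_in_mono: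
  "relatively_compact_in X W U \<Longrightarrow> U \<subseteq> V \<Longrightarrow> relatively_compact_in X W V"
  by (auto simp: relatively_compact_in_def)

lemma topspace_vec_fun:
  "\<gamma> \<in> topspace (vec_fun \<F> k U) \<longleftrightarrow>
     \<gamma> \<in> U \<rightarrow>\<^sub>E vecs k \<and> (\<forall>i<k. (\<lambda>x\<in>U. \<gamma> x i) \<in> topspace (\<F> U))"
  unfolding vec_fun_def topspace_pullback_topology by (auto simp: PiE_iff)

lemma restrict_in_vec_fun:
  "restrict g U \<in> topspace (vec_fun \<F> k U) \<longleftrightarrow>
     g ` U \<subseteq> vecs k \<and> (\<forall>i<k. (\<lambda>x\<in>U. g x i) \<in> topspace (\<F> U))"
proof -
  have "(\<lambda>x\<in>U. restrict g U x i) = (\<lambda>x\<in>U. g x i)" for i by auto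
  then show ?thesis by (auto simp: topspace_vec_fun)
qed

lemma join_in_vec_fun:
  assumes "restrict g W \<in> topspace (vec_fun \<F> n W)" "restrict h W \<in> topspace (vec_fun \<F> n W)"
  shows "(\<lambda>x\<in>W. join_coords n (g x) (h x)) \<in> topspace (vec_fun \<F> (2 * n) W)"
proof -
  have "(\<lambda>x\<in>W. join_coords n (g x) (h x) i) \<in> topspace (\<F> W)" if "i < 2 * n" for i
  proof (cases "i < n")
    case True
    then show ?thesis using assms(1) by (simp add: restrict_in_vec_fun join_coords_def)
  next
    case False
    then show ?thesis using assms(2) that by (simp add: restrict_in_vec_fun join_coords_def)
  qed
  then show ?thesis
    using assms by (fastforce simp: restrict_in_vec_fun join_coords_def)
qed

text \<open>Membership is decided coordinatewise, so the second half may be split off. It serves to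
  extract the fibre coordinates of a section.\<close>

lemma snd_in_vec_fun:
  assumes "(\<lambda>x\<in>W. join_coords n (g x) (h x)) \<in> topspace (vec_fun \<F> (2 * n) W)"
    and "h ` W \<subseteq> vecs n"
  shows "restrict h W \<in> topspace (vec_fun \<F> n W)"
proof -
  have "(\<lambda>x\<in>W. h x i) \<in> topspace (\<F> W)" if "i < n" for i
    using assms(1)[unfolded restrict_in_vec_fun, THEN conjunct2, rule_format, of "i + n"] that
    by (simp add: join_coords_def)
  then show ?thesis using assms(2) by (simp add: restrict_in_vec_fun)
qed

locale suitable_family =
  fixes m :: nat
    and \<U> :: "(nat \<Rightarrow> real) set set"
    and \<F> :: "(nat \<Rightarrow> real) set \<Rightarrow> ((nat \<Rightarrow> real) \<Rightarrow> real) topology"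
  assumes good: "good_collection m \<U>"
    and suitable: "suitable_for_global_analysis m \<U> \<F>"
begin

abbreviation in_F :: "nat \<Rightarrow> (nat \<Rightarrow> real) set \<Rightarrow> ((nat \<Rightarrow> real) \<Rightarrow> (nat \<Rightarrow> real)) \<Rightarrow> bool" where
  "in_F k W g \<equiv> restrict g W \<in> topspace (vec_fun \<F> k W)"

lemma U_open: "U \<in> \<U> \<Longrightarrow> openin (top_of_set (orthant m)) U"
proof -
  assume U: "U \<in> \<U>"
  have "openin (orthant_top m) = arbitrary union_of (\<lambda>U. U \<in> \<U>)"
    using good unfolding good_collection_def by (rule conjunct1)
  then show ?thesis using arbitrary_union_of_inc[of "\<lambda>U. U \<in> \<U>", OF U] by (metis ltop_euclid orthant_top_eq)
qed

lemma U_subset: "U \<in> \<U> \<Longrightarrow> U \<subseteq> orthant m"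
  using U_open openin_subset by fastforce

text \<open>The basis property gives a member of \<U> between \<open>x\<close> and \<open>P\<close>;
  property (b) of a good collection, applied to the compact set {\<open>x\<close>}, gives a
  relatively compact one inside it.\<close>

lemma small_U:
  assumes P: "openin (top_of_set (orthant m)) P" and x: "x \<in> P"
  shows "\<exists>W\<in>\<U>. x \<in> W \<and> W \<subseteq> P \<and> relatively_compact_in (orthant_top m) W P"
proof -
  have 1: "openin (orthant_top m) = arbitrary union_of (\<lambda>U. U \<in> \<U>)"
    using good unfolding good_collection_def by (rule conjunct1)
  have b: "\<forall>U\<in>\<U>. \<forall>K. compactin (orthant_top m) K \<and> K \<noteq> {} \<and> K \<subseteq> U \<longrightarrow>
        (\<exists>V\<in>\<U>. relatively_compact_in (orthant_top m) V U \<and> K \<subseteq> V)"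
    using good unfolding good_collection_def by (elim conjE)
  have "(arbitrary union_of (\<lambda>U. U \<in> \<U>)) P"
    using P by (simp del: ltop_euclid orthant_top_eq add: 1[symmetric]) simp
  then obtain U where U: "U \<in> \<U>" "x \<in> U" "U \<subseteq> P"
    using x by (auto simp: union_of_def arbitrary_def)
  have "compactin (orthant_top m) {x}" using U(2) U_subset[OF U(1)] by auto
  then have "\<exists>V\<in>\<U>. relatively_compact_in (orthant_top m) V U \<and> {x} \<subseteq> V"
    using U by (intro b[rule_format, OF U(1)]) simp
  then obtain W where W: "W \<in> \<U>" "relatively_compact_in (orthant_top m) W U" "x \<in> W"
    by (elim bexE conjE) simp
  then have "W \<subseteq> U" using U_subset[OF W(1)] by (intro relatively_compact_in_subset[OF W(2)]) simp
  then show ?thesis using W(1,3) U(3) relatively_compact_in_mono[OF W(2) U(3)] by (intro bexI[of _ W]) auto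
qed

text \<open>(PF) for a function that ignores the point of \<open>U\<close>. It is smooth on the
  product because it factors through the linear projection \<open>snd\<close>, so the corners of
  \<open>U\<close> cause no difficulty.\<close>

lemma in_F_postcompose:
  assumes U: "U \<in> \<U>" and V: "V \<in> \<U>" and VU: "relatively_compact_in (orthant_top m) V U"
    and f: "bsmooth (euclid k) (euclid l) (vecs k) f" and g: "in_F k U g"
  shows "in_F l V (\<lambda>x. f (g x))"
proof -
  have "bsmooth (prod_lcs (euclid m) (euclid k)) (euclid l) (U \<times> lcarrier (euclid k)) (\<lambda>z. f (snd z))"
    using f
  proof (rule bsmooth_affine)
    show "U \<times> lcarrier (euclid k) \<subseteq> lcarrier (prod_lcs (euclid m) (euclid k))"
      using U_subset[OF U] orthant_subset[of m] by auto
    show "continuous_map (ltop (prod_lcs (euclid m) (euclid k))) (ltop (euclid k)) snd"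
      by (simp only: ltop_prod_lcs) (rule continuous_map_snd)
    then show "continuous_map (subtopology (ltop (prod_lcs (euclid m) (euclid k))) (U \<times> lcarrier (euclid k)))
        (ltop (euclid k)) snd"
      by (rule continuous_map_from_subtopology)
  qed auto
  moreover have "axiom_PF m \<U> \<F>" using suitable by (simp add: suitable_for_global_analysis_def)
  ultimately have "continuous_map (vec_fun \<F> k U) (vec_fun \<F> l V) (\<lambda>\<gamma>. \<lambda>x\<in>V. f (snd (x, \<gamma> x)))"
    using U V VU unfolding axiom_PF_def by blast
  then have "(\<lambda>x\<in>V. f (snd (x, restrict g U x))) \<in> topspace (vec_fun \<F> l V)"
    using g unfolding continuous_map_def by blast
  moreover have "V \<subseteq> U"
    using U_subset[OF V] by (intro relatively_compact_in_subset[OF VU]) simp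
  then have "(\<lambda>x\<in>V. f (snd (x, restrict g U x))) = (\<lambda>x\<in>V. f (g x))"
    by (intro restrict_ext) auto
  ultimately show ?thesis by simp
qed

lemma in_F_cong: "in_F k W g \<Longrightarrow> (\<And>x. x \<in> W \<Longrightarrow> h x = g x) \<Longrightarrow> in_F k W h"
  by (metis restrict_ext)

lemma in_F_vecs: "in_F k U g \<Longrightarrow> g ` U \<subseteq> vecs k"
  by (simp add: restrict_in_vec_fun)

text \<open>Restriction is (PF) for the identity of \<real>^k, and hence comes with the condition
  that \<open>V\<close> be relatively compact in \<open>U\<close>.\<close>

lemma in_F_restrict:
  assumes "U \<in> \<U>" "V \<in> \<U>" "relatively_compact_in (orthant_top m) V U" "in_F k U g"
  shows "in_F k V g"
  using in_F_postcompose[OF assms(1-3) bsmooth_id assms(4)] by simp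

lemma F_subset_BC: "U \<in> \<U> \<Longrightarrow> topspace (\<F> U) \<subseteq> topspace (BC m U)"
  and F_to_BC: "U \<in> \<U> \<Longrightarrow> continuous_map (\<F> U) (BC m U) (\<lambda>f. f)"
  using suitable by (auto simp: suitable_for_global_analysis_def function_family_def)

lemma in_F_continuous:
  assumes U: "U \<in> \<U>" and g: "in_F k U g"
  shows "continuous_on U g"
proof -
  have Uv: "U \<subseteq> vecs m" using U_subset[OF U] orthant_subset by blast
  have "continuous_on U (\<lambda>x. g x i)" for i
  proof (cases "i < k")
    case True
    then have "(\<lambda>x\<in>U. g x i) \<in> topspace (BC m U)"
      using g F_subset_BC[OF U] by (auto simp: restrict_in_vec_fun)
    then have "continuous_map (top_of_set U) euclideanreal (\<lambda>x\<in>U. g x i)"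
      using Uv by (simp add: BC_def subtopology_subtopology Int_absorb1)
    then have "continuous_on U (\<lambda>x\<in>U. g x i)" by simp
    then show ?thesis by (rule continuous_on_eq) simp
  next
    case False
    then have "g x i = 0" if "x \<in> U" for x using in_F_vecs[OF g] that by fastforce
    then show ?thesis using continuous_on_cong[of U U "\<lambda>x. g x i" "\<lambda>_. 0"] by simp
  qed
  then show ?thesis by (rule continuous_on_coordinatewise_then_product)
qed

lemma in_F_open_preimage:
  assumes U: "U \<in> \<U>" and g: "in_F k U g" and S: "openin (top_of_set (vecs k)) S"
  shows "openin (top_of_set (orthant m)) {x \<in> U. g x \<in> S}"
proof -
  have "openin (top_of_set U) (U \<inter> g -` S)"
    by (rule continuous_openin_preimage[OF in_F_continuous[OF U g] _ S]) (use in_F_vecs[OF g] in auto)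
  then have "openin (top_of_set (orthant m)) (U \<inter> g -` S)" using U_open[OF U] openin_trans by blast
  then show ?thesis by (simp add: vimage_def Int_def)
qed

lemma in_F_local_postcompose:
  assumes U: "U \<in> \<U>" and g: "in_F k U g" and x: "x \<in> U"
    and S: "openin (top_of_set (vecs k)) S" "g x \<in> S" and f: "bsmooth (euclid k) (euclid l) S f"
    and P: "openin (top_of_set (orthant m)) P" "x \<in> P"
  shows "\<exists>W\<in>\<U>. x \<in> W \<and> W \<subseteq> P \<and> W \<subseteq> U \<and> g ` W \<subseteq> S \<and> in_F l W (\<lambda>x. f (g x))"
proof -
  obtain h T where h: "bsmooth (euclid k) (euclid l) (vecs k) h" and T: "openin (top_of_set (vecs k)) T"
     "g x \<in> T" "T \<subseteq> S" "\<forall>x\<in>T. h x = f x"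
    using smooth_extension[OF S f] by blast
  have "openin (top_of_set (orthant m)) (P \<inter> {x \<in> U. g x \<in> T})"
    by (intro openin_Int P in_F_open_preimage[OF U g T(1)])
  from small_U[OF this, of x] obtain W where W: "W \<in> \<U>" "x \<in> W" "W \<subseteq> P \<inter> {x \<in> U. g x \<in> T}"
    "relatively_compact_in (orthant_top m) W (P \<inter> {x \<in> U. g x \<in> T})"
    using x P T(2) by auto
  have "relatively_compact_in (orthant_top m) W U"
    by (rule relatively_compact_in_mono[OF W(4)]) auto
  from in_F_postcompose[OF U W(1) this h g] have "in_F l W (\<lambda>x. f (g x))"
    by (rule in_F_cong) (use W(3) T(4) in auto)
  then show ?thesis using W T(3) by blast
qed

end

section \<open>Product charts\<close>

lemma prod_chart_simps:
  "ch_dom (prod_chart c d) = ch_dom c \<times> ch_dom d"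
  "ch_model (prod_chart c d) = prod_lcs (ch_model c) (ch_model d)"
  "p \<in> ch_dom c \<Longrightarrow> q \<in> ch_dom d \<Longrightarrow> ch_map (prod_chart c d) (p, q) = (ch_map c p, ch_map d q)"
  by (simp_all add: prod_chart_def)

lemma prod_chart_inv:
  assumes c: "is_chart X E Q c" "is_chart X' E' Q' d" and pq: "p \<in> ch_dom c" "q \<in> ch_dom d"
  shows "ch_inv (prod_chart c d) (ch_map c p, ch_map d q) = (p, q)"
proof (rule inv_into_f_eq)
  show "inj_on (ch_map (prod_chart c d)) (ch_dom (prod_chart c d))"
    using chart_inj[OF c(1)] chart_inj[OF c(2)] by (auto simp: inj_on_def prod_chart_simps)
qed (use pq in \<open>auto simp: prod_chart_simps\<close>)

lemma prod_chart_open_image: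
  assumes c: "is_chart X E (lcarrier E) c" "is_chart X' E' (lcarrier E') d"
    and W: "openin (prod_topology X X') W" "W \<subseteq> ch_dom c \<times> ch_dom d"
  shows "openin (prod_topology (ltop E) (ltop E')) (ch_map (prod_chart c d) ` W)"
  unfolding openin_prod_topology_alt
proof (intro allI impI)
  fix x y assume "(x, y) \<in> ch_map (prod_chart c d) ` W"
  then obtain p q where pq: "(p, q) \<in> W" "p \<in> ch_dom c" "q \<in> ch_dom d" "x = ch_map c p" "y = ch_map d q"
    using W(2) by (auto simp: prod_chart_simps)
  then obtain U V where UV: "openin X U" "openin X' V" "p \<in> U" "q \<in> V" "U \<times> V \<subseteq> W"
    using W(1) unfolding openin_prod_topology_alt by metis
  have "openin (ltop E) (ch_map c ` (U \<inter> ch_dom c))" "openin (ltop E') (ch_map d ` (V \<inter> ch_dom d))"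
    using chart_open_image[OF c(1), of "U \<inter> ch_dom c"] chart_open_image[OF c(2), of "V \<inter> ch_dom d"]
      UV is_chartD(2)[OF c(1)] is_chartD(2)[OF c(2)] by auto
  moreover have "ch_map c ` (U \<inter> ch_dom c) \<times> ch_map d ` (V \<inter> ch_dom d) \<subseteq> ch_map (prod_chart c d) ` W"
  proof safe
    fix p' q' assume "p' \<in> U" "p' \<in> ch_dom c" "q' \<in> V" "q' \<in> ch_dom d"
    then show "(ch_map c p', ch_map d q') \<in> ch_map (prod_chart c d) ` W"
      using UV(5) by (intro rev_image_eqI[of "(p', q')"]) (auto simp: prod_chart_simps)
  qed
  ultimately show "\<exists>U V. openin (ltop E) U \<and> openin (ltop E') V \<and> x \<in> U \<and> y \<in> V \<and>
      U \<times> V \<subseteq> ch_map (prod_chart c d) ` W"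
    using pq UV by (intro exI[of _ "ch_map c ` (U \<inter> ch_dom c)"] exI[of _ "ch_map d ` (V \<inter> ch_dom d)"]) auto
qed

definition split_coords :: "nat \<Rightarrow> (nat \<Rightarrow> real) \<Rightarrow> (nat \<Rightarrow> real) \<times> (nat \<Rightarrow> real)" where
  "split_coords n z = ((\<lambda>i. if i < n then z i else 0), (\<lambda>i. if i < n then z (i + n) else 0))"

lemma split_join: "x \<in> vecs n \<Longrightarrow> y \<in> vecs n \<Longrightarrow> split_coords n (join_coords n x y) = (x, y)"
  by (auto simp: split_coords_def join_coords_def fun_eq_iff)

lemma join_in_vecs: "y \<in> vecs n \<Longrightarrow> join_coords n x y \<in> vecs (2 * n)"
  by (auto simp: join_coords_def)

lemma join_split: "z \<in> vecs (2 * n) \<Longrightarrow> join_coords n (fst (split_coords n z)) (snd (split_coords n z)) = z"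
  by (auto simp: split_coords_def join_coords_def fun_eq_iff)

lemma continuous_map_split_coords:
  "continuous_map (top_of_set (vecs (2 * n))) (prod_topology (top_of_set (vecs n)) (top_of_set (vecs n))) (split_coords n)"
  unfolding split_coords_def[abs_def]
  by (intro continuous_map_pairedI) (auto simp: continuous_map_vecs_iff intro!: continuous_on_subset[OF continuous_on_product_coordinates])

text \<open>Product manifolds are modelled on \<open>prod_lcs\<close>, whereas
  \<open>csmooth\<close> and (PF) deal with spaces \<real>^k. The linear map
  \<open>split_coords\<close> turns a smooth function of two variables into one on
  \<real>^(2n).\<close>

lemma bsmooth_split_coords:
  assumes T: "openin (prod_topology (ltop (euclid n)) (ltop (euclid n))) T"
    and f: "bsmooth (prod_lcs (euclid n) (euclid n)) F T f"
  defines "T' \<equiv> {z \<in> vecs (2 * n). split_coords n z \<in> T}"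
  shows "openin (top_of_set (vecs (2 * n))) T'"
    and "bsmooth (euclid (2 * n)) F T' (\<lambda>z. f (split_coords n z))"
proof -
  show T': "openin (top_of_set (vecs (2 * n))) T'"
    using openin_continuous_map_preimage[OF continuous_map_split_coords, of n T] T by (simp add: T'_def)
  show "bsmooth (euclid (2 * n)) F T' (\<lambda>z. f (split_coords n z))"
    using f
  proof (rule bsmooth_affine)
    show "openin (ltop (prod_lcs (euclid n) (euclid n))) T" using T by simp
    show cont: "continuous_map (ltop (euclid (2 * n))) (ltop (prod_lcs (euclid n) (euclid n))) (split_coords n)"
      using continuous_map_split_coords[of n] by (simp only: ltop_prod_lcs ltop_euclid)
    show "continuous_map (subtopology (ltop (euclid (2 * n))) T') (ltop (prod_lcs (euclid n) (euclid n))) (split_coords n)"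
      by (rule continuous_map_from_subtopology[OF cont])
  qed (auto simp: T'_def split_coords_def fun_eq_iff)
qed

section \<open>Germs of maps on the source manifold\<close>

text \<open>A common interface for the two kinds of targets, \<open>N\<close> and its tangent
  bundle.\<close>

definition chart_atlas :: "('q, nat \<Rightarrow> real) mfd \<Rightarrow> nat \<Rightarrow> bool" where
  "chart_atlas N k \<longleftrightarrow> (\<forall>d\<in>mfd_atlas N. is_chart (mfd_top N) (euclid k) (vecs k) d) \<and>
     points N \<subseteq> (\<Union>d\<in>mfd_atlas N. ch_dom d)"

locale mapping_source = suitable_family +
  fixes M :: "('p, nat \<Rightarrow> real) mfd"
  assumes M: "manifold_with_corners m M"
begin

lemma M_atlas: "maximal_atlas (mfd_top M) (euclid m) (orthant m) (mfd_atlas M)"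
  using M by (simp add: manifold_with_corners_def)

lemmas M_chart = maximal_atlasD(2)[OF M_atlas]

lemma M_chart_open_image:
  "c \<in> mfd_atlas M \<Longrightarrow> openin (mfd_top M) V \<Longrightarrow> V \<subseteq> ch_dom c \<Longrightarrow> openin (top_of_set (orthant m)) (ch_map c ` V)"
  using chart_open_image[OF M_chart] by simp

lemma M_chart_open_preimage:
  "c \<in> mfd_atlas M \<Longrightarrow> openin (top_of_set (orthant m)) W \<Longrightarrow> openin (mfd_top M) {p \<in> ch_dom c. ch_map c p \<in> W}"
  using chart_open_preimage[OF M_chart] by simp

text \<open>This is (PB) for the chart change \<open>\<Theta>\<close>. The axiom wants a
  diffeomorphism onto a member of \<U>, so \<open>U\<close> is first shrunk to a member
  \<open>V\<close> of \<U> inside the overlap, and the domain of \<open>\<Theta>\<close> is adjusted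
  to \<open>V\<close>.\<close>

lemma change_chart:
  assumes c: "c \<in> mfd_atlas M" "d \<in> mfd_atlas M" and p: "p \<in> ch_dom c" "p \<in> ch_dom d"
    and U: "U \<in> \<U>" "ch_map c p \<in> U" "U \<subseteq> ch_img c" and g: "in_F k U (\<lambda>x. g (ch_inv c x))"
    and P: "openin (top_of_set (orthant m)) P" "ch_map d p \<in> P"
  shows "\<exists>W\<in>\<U>. ch_map d p \<in> W \<and> W \<subseteq> P \<and> W \<subseteq> ch_img d \<and> in_F k W (\<lambda>x. g (ch_inv d x))"
proof -
  note C = M_chart[OF c(1)] and D = M_chart[OF c(2)]
  have op: "openin (mfd_top M) (ch_dom c \<inter> ch_dom d)"
    using is_chartD(2)[OF C] is_chartD(2)[OF D] by blast
  have "openin (top_of_set (orthant m)) (U \<inter> ch_map c ` (ch_dom c \<inter> ch_dom d))"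
    using M_chart_open_image[OF c(1) op] U_open[OF U(1)] by blast
  from small_U[OF this, of "ch_map c p"] obtain V where V: "V \<in> \<U>" "ch_map c p \<in> V"
    "V \<subseteq> U \<inter> ch_map c ` (ch_dom c \<inter> ch_dom d)"
    "relatively_compact_in (orthant_top m) V (U \<inter> ch_map c ` (ch_dom c \<inter> ch_dom d))"
    using p U(2) by auto
  have gV: "in_F k V (\<lambda>x. g (ch_inv c x))"
    using relatively_compact_in_mono[OF V(4)] by (intro in_F_restrict[OF U(1) V(1) _ g]) auto
  define B where "B = {q \<in> ch_dom c. ch_map c q \<in> V} \<inter> ch_dom d"
  have B: "openin (mfd_top M) B"
    unfolding B_def using M_chart_open_preimage[OF c(1) U_open[OF V(1)]] is_chartD(2)[OF D] by blast
  \<comment> \<open>Exactly the part of the second chart that corresponds to \<open>V\<close>, so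
    that \<open>\<Theta>\<close> maps it onto \<open>V\<close>.\<close>
  define U0 where "U0 = ch_map d ` B"
  have U0: "openin (top_of_set (orthant m)) U0"
    unfolding U0_def by (rule M_chart_open_image[OF c(2) B]) (auto simp: B_def)
  define \<Theta> where "\<Theta> = ch_map c \<circ> ch_inv d"
  have \<Theta>: "\<Theta> (ch_map d q) = ch_map c q" if "q \<in> B" for q
    using that chart_inv_map[OF D] by (auto simp: \<Theta>_def B_def)
  have VB: "V = ch_map c ` B" using V(3) by (auto simp: B_def)
  have inj: "inj_on (ch_map c) B" using chart_inj[OF C] by (auto simp: inj_on_def B_def)
  have bij: "bij_betw \<Theta> U0 V"
  proof -
    have "inj_on \<Theta> U0"
    proof (rule inj_onI)
      fix x y assume "x \<in> U0" "y \<in> U0" "\<Theta> x = \<Theta> y"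
      then show "x = y" using \<Theta> inj unfolding U0_def by (auto dest: inj_onD)
    qed
    moreover have "\<Theta> ` U0 = V" unfolding U0_def VB using \<Theta> by force
    ultimately show ?thesis by (simp add: bij_betw_def)
  qed
  have inv: "inv_into U0 \<Theta> (ch_map c q) = ch_map d q" if "q \<in> B" for q
    using that \<Theta>[OF that] bij by (intro inv_into_f_eq) (auto simp: bij_betw_def U0_def)
  have comp: "smoothly_compatible c d" "ch_model c = euclid m" "ch_model d = euclid m"
    using maximal_atlasD(3)[OF M_atlas] c is_chartD(1)[OF C] is_chartD(1)[OF D] by auto
  have "diffeo (euclid m) (euclid m) U0 V \<Theta>"
    unfolding diffeo_def
  proof (intro conjI bij)
    show "bsmooth (euclid m) (euclid m) U0 \<Theta>"
      unfolding \<Theta>_def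
    proof (rule bsmooth_mono)
      show "bsmooth (euclid m) (euclid m) (ch_map d ` (ch_dom c \<inter> ch_dom d)) (ch_map c \<circ> ch_inv d)"
        using comp by (simp add: smoothly_compatible_def)
    qed (auto simp: U0_def B_def)
    show "bsmooth (euclid m) (euclid m) V (inv_into U0 \<Theta>)"
    proof (rule bsmooth_cong[OF bsmooth_mono])
      show "bsmooth (euclid m) (euclid m) (ch_map c ` (ch_dom c \<inter> ch_dom d)) (ch_map d \<circ> ch_inv c)"
        using comp by (simp add: smoothly_compatible_def)
      fix x assume "x \<in> V"
      then obtain q where q: "q \<in> B" "x = ch_map c q" using VB by auto
      then show "inv_into U0 \<Theta> x = (ch_map d \<circ> ch_inv c) x"
        using inv[OF q(1)] chart_inv_map[OF C, of q] by (auto simp: B_def)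
    qed (use VB in \<open>auto simp: B_def\<close>)
  qed
  moreover have pB: "p \<in> B" using p V(2) by (simp add: B_def)
  have "openin (top_of_set (orthant m)) (P \<inter> U0)" using P U0 by blast
  from small_U[OF this, of "ch_map d p"] obtain W where W: "W \<in> \<U>" "ch_map d p \<in> W" "W \<subseteq> P \<inter> U0"
    "relatively_compact_in (orthant_top m) W (P \<inter> U0)"
    using P pB by (auto simp: U0_def)
  moreover have "relatively_compact_in (orthant_top m) W U0"
    using relatively_compact_in_mono[OF W(4)] by auto
  moreover have "axiom_PB m \<U> \<F>" using suitable by (simp add: suitable_for_global_analysis_def)
  moreover have "openin (orthant_top m) U0" using U0 by simp
  ultimately have "continuous_map (vec_fun \<F> k V) (vec_fun \<F> k W) (\<lambda>\<gamma>. \<lambda>x\<in>W. \<gamma> (\<Theta> x))"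
    using V(1) unfolding axiom_PB_def by blast
  then have "(\<lambda>x\<in>W. restrict (\<lambda>x. g (ch_inv c x)) V (\<Theta> x)) \<in> topspace (vec_fun \<F> k W)"
    using gV unfolding continuous_map_def by blast
  then have "in_F k W (\<lambda>x. g (ch_inv d x))"
  proof (rule in_F_cong)
    fix x assume "x \<in> W"
    then obtain q where q: "q \<in> B" "x = ch_map d q" using W(3) by (auto simp: U0_def)
    then have "\<Theta> x \<in> V" "ch_inv c (\<Theta> x) = q" "ch_inv d x = q"
      using \<Theta>[OF q(1)] chart_inv_map[OF C, of q] chart_inv_map[OF D, of q] by (auto simp: B_def)
    then show "g (ch_inv d x) = restrict (\<lambda>x. g (ch_inv c x)) V (\<Theta> x)" by simp
  qed
  moreover have "W \<subseteq> ch_img d" using W(3) by (auto simp: U0_def B_def)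
  ultimately show ?thesis using W by blast
qed

text \<open>Being of class \<F> near \<open>p\<close>. Unlike in \<open>maps\<close>, the set
  \<open>U\<close> may be smaller than the chart image, so no chart has to be restricted in
  between.\<close>

definition germ_F :: "nat \<Rightarrow> 'p \<Rightarrow> ('p \<Rightarrow> (nat \<Rightarrow> real)) \<Rightarrow> bool" where
  "germ_F k p g \<longleftrightarrow> (\<exists>c\<in>mfd_atlas M. \<exists>U\<in>\<U>. p \<in> ch_dom c \<and> ch_map c p \<in> U \<and> U \<subseteq> ch_img c \<and>
     in_F k U (\<lambda>x. g (ch_inv c x)))"

text \<open>By \<open>change_chart\<close> every chart at \<open>p\<close> serves, with
  \<open>W\<close> inside any prescribed neighbourhood; several local conditions can thus be met on
  one set.\<close>

lemma germ_F_chart: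
  assumes "germ_F k p g" "c \<in> mfd_atlas M" "p \<in> ch_dom c"
    "openin (top_of_set (orthant m)) P" "ch_map c p \<in> P"
  shows "\<exists>W\<in>\<U>. ch_map c p \<in> W \<and> W \<subseteq> P \<and> W \<subseteq> ch_img c \<and> in_F k W (\<lambda>x. g (ch_inv c x))"
proof -
  obtain d U where "d \<in> mfd_atlas M" "U \<in> \<U>" "p \<in> ch_dom d" "ch_map d p \<in> U" "U \<subseteq> ch_img d"
     "in_F k U (\<lambda>x. g (ch_inv d x))"
    using assms(1) unfolding germ_F_def by blast
  then show ?thesis using assms(2-5) by (intro change_chart[of d c p U])
qed

lemma germ_F_open:
  assumes g: "germ_F k p g" and S: "openin (top_of_set (vecs k)) S" "g p \<in> S"
  shows "\<exists>B. openin (mfd_top M) B \<and> p \<in> B \<and> g ` B \<subseteq> S"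
proof -
  obtain c U where c: "c \<in> mfd_atlas M" "U \<in> \<U>" "p \<in> ch_dom c" "ch_map c p \<in> U" "U \<subseteq> ch_img c"
     "in_F k U (\<lambda>x. g (ch_inv c x))"
    using g unfolding germ_F_def by blast
  let ?B = "{q \<in> ch_dom c. ch_map c q \<in> {x \<in> U. g (ch_inv c x) \<in> S}}"
  have "openin (mfd_top M) ?B"
    by (rule M_chart_open_preimage[OF c(1) in_F_open_preimage[OF c(2,6) S(1)]])
  moreover have "p \<in> ?B" "g ` ?B \<subseteq> S" using c(3,4) S(2) chart_inv_map[OF M_chart[OF c(1)]] by auto
  ultimately show ?thesis by blast
qed

lemma germ_F_compose:
  assumes g: "germ_F k p g" and S: "openin (top_of_set (vecs k)) S" "g p \<in> S"
    and f: "bsmooth (euclid k) (euclid l) S f"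
  shows "germ_F l p (\<lambda>q. f (g q))"
proof -
  obtain c U where c: "c \<in> mfd_atlas M" "U \<in> \<U>" "p \<in> ch_dom c" "ch_map c p \<in> U" "U \<subseteq> ch_img c"
     "in_F k U (\<lambda>x. g (ch_inv c x))"
    using g unfolding germ_F_def by blast
  have "g (ch_inv c (ch_map c p)) \<in> S" using chart_inv_map[OF M_chart[OF c(1)] c(3)] S(2) by simp
  from in_F_local_postcompose[OF c(2,6,4) S(1) this f U_open[OF c(2)] c(4)]
  obtain W where "W \<in> \<U>" "ch_map c p \<in> W" "W \<subseteq> U" "in_F l W (\<lambda>x. f (g (ch_inv c x)))" by blast
  then show ?thesis
    unfolding germ_F_def using c(1,3,5) by (intro bexI[of _ c] bexI[of _ W]) auto
qed

lemma germ_F_join: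
  assumes g: "germ_F n p g" and h: "germ_F n p h"
  shows "germ_F (2 * n) p (\<lambda>q. join_coords n (g q) (h q))"
proof -
  obtain c U where c: "c \<in> mfd_atlas M" "U \<in> \<U>" "p \<in> ch_dom c" "ch_map c p \<in> U" "U \<subseteq> ch_img c"
     "in_F n U (\<lambda>x. g (ch_inv c x))"
    using g unfolding germ_F_def by blast
  from germ_F_chart[OF h c(1,3) U_open[OF c(2)] c(4)] obtain V where V: "V \<in> \<U>" "ch_map c p \<in> V"
    "V \<subseteq> U" "V \<subseteq> ch_img c" "in_F n V (\<lambda>x. h (ch_inv c x))" by blast
  \<comment> \<open>A set relatively compact in the domains of both representatives, as
    \<open>in_F_restrict\<close> demands.\<close>
  from small_U[OF U_open[OF V(1)] V(2)] obtain W where W: "W \<in> \<U>" "ch_map c p \<in> W" "W \<subseteq> V"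
    "relatively_compact_in (orthant_top m) W V" by blast
  have "in_F n W (\<lambda>x. g (ch_inv c x))" "in_F n W (\<lambda>x. h (ch_inv c x))"
    using in_F_restrict[OF c(2) W(1) relatively_compact_in_mono[OF W(4) V(3)] c(6)]
      in_F_restrict[OF V(1) W(1,4) V(5)] by auto
  from join_in_vec_fun[OF this] show ?thesis
    unfolding germ_F_def using c(1,3) W V(4) by (meson order_trans)
qed

lemma germ_F_cong:
  assumes g: "germ_F k p g" and B: "openin (mfd_top M) B" "p \<in> B" and eq: "\<And>q. q \<in> B \<Longrightarrow> h q = g q"
  shows "germ_F k p h"
proof -
  obtain c where c: "c \<in> mfd_atlas M" "p \<in> ch_dom c"
    using g unfolding germ_F_def by blast
  have "openin (mfd_top M) (B \<inter> ch_dom c)" using B(1) is_chartD(2)[OF M_chart[OF c(1)]] by blast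
  from germ_F_chart[OF g c M_chart_open_image[OF c(1) this]] obtain W where
    W: "W \<in> \<U>" "ch_map c p \<in> W" "W \<subseteq> ch_map c ` (B \<inter> ch_dom c)" "W \<subseteq> ch_img c" "in_F k W (\<lambda>x. g (ch_inv c x))"
    using B(2) c(2) by blast
  from W(5) have "in_F k W (\<lambda>x. h (ch_inv c x))"
    by (rule in_F_cong) (use W(3) chart_inv_map[OF M_chart[OF c(1)]] eq in auto)
  then show ?thesis unfolding germ_F_def using c W by blast
qed

lemma maps_local:
  assumes \<gamma>: "\<gamma> \<in> maps \<U> \<F> M k N" and p: "p \<in> points M"
  shows "\<exists>d\<in>mfd_atlas N. \<exists>B. openin (mfd_top M) B \<and> p \<in> B \<and> \<gamma> ` B \<subseteq> ch_dom d \<and>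
     germ_F k p (\<lambda>q. ch_map d (\<gamma> q))"
proof -
  have "\<exists>c\<in>mfd_atlas M. \<exists>d\<in>mfd_atlas N.
        p \<in> ch_dom c \<and> ch_img c \<in> \<U> \<and> \<gamma> ` ch_dom c \<subseteq> ch_dom d \<and>
        in_F k (ch_img c) (\<lambda>x. ch_map d (\<gamma> (ch_inv c x)))"
    using \<gamma> p by (simp add: maps_def)
  then obtain c d where c: "c \<in> mfd_atlas M" "d \<in> mfd_atlas N" "p \<in> ch_dom c" "ch_img c \<in> \<U>"
     "\<gamma> ` ch_dom c \<subseteq> ch_dom d" "in_F k (ch_img c) (\<lambda>x. ch_map d (\<gamma> (ch_inv c x)))"
    by blast
  have "germ_F k p (\<lambda>q. ch_map d (\<gamma> q))"
    unfolding germ_F_def using c by (intro bexI[of _ c] bexI[of _ "ch_img c"]) auto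
  then show ?thesis using c is_chartD(2)[OF M_chart[OF c(1)]] by blast
qed

text \<open>Converse of \<open>maps_local\<close>. A germ supplies a member \<open>W\<close> of \<U>
  inside a chart image, and restricting the chart to \<open>W\<close> produces a chart with image
  exactly \<open>W\<close>.\<close>

lemma mapsI:
  assumes \<gamma>: "\<gamma> \<in> points M \<rightarrow>\<^sub>E points N"
    and loc: "\<And>p. p \<in> points M \<Longrightarrow> \<exists>d\<in>mfd_atlas N. \<exists>B. openin (mfd_top M) B \<and> p \<in> B \<and>
       \<gamma> ` B \<subseteq> ch_dom d \<and> germ_F k p (\<lambda>q. ch_map d (\<gamma> q))"
  shows "\<gamma> \<in> maps \<U> \<F> M k N"
  unfolding maps_def
proof (rule CollectI, intro conjI \<gamma> ballI)
  fix p assume "p \<in> points M"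
  from loc[OF this] obtain d B where d: "d \<in> mfd_atlas N" and B: "openin (mfd_top M) B" "p \<in> B"
    "\<gamma> ` B \<subseteq> ch_dom d" and g: "germ_F k p (\<lambda>q. ch_map d (\<gamma> q))" by blast
  obtain c where c: "c \<in> mfd_atlas M" "p \<in> ch_dom c"
    using g unfolding germ_F_def by blast
  have "openin (mfd_top M) (B \<inter> ch_dom c)" using B(1) is_chartD(2)[OF M_chart[OF c(1)]] by blast
  from germ_F_chart[OF g c M_chart_open_image[OF c(1) this]] obtain W where
    W: "W \<in> \<U>" "ch_map c p \<in> W" "W \<subseteq> ch_map c ` (B \<inter> ch_dom c)" "W \<subseteq> ch_img c"
      "in_F k W (\<lambda>x. ch_map d (\<gamma> (ch_inv c x)))"
    using B(2) c(2) by blast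
  let ?r = "restrict_chart c W"
  have "?r \<in> mfd_atlas M"
    using restrict_chart_in_atlas[OF M_atlas c(1) _ W(4)] U_open[OF W(1)] by simp
  moreover have "in_F k (ch_img ?r) (\<lambda>x. ch_map d (\<gamma> (ch_inv ?r x)))"
    unfolding ch_img_restrict_chart[OF W(4)] using W(5)
    by (rule in_F_cong) (simp add: ch_inv_restrict_chart[OF M_chart[OF c(1)] W(4)])
  moreover have "ch_dom ?r \<subseteq> B"
    using W(3) chart_inj[OF M_chart[OF c(1)]] by (auto simp: ch_dom_restrict_chart dest!: subsetD inj_onD)
  then have "\<gamma> ` ch_dom ?r \<subseteq> ch_dom d" using B(3) by blast
  moreover have "p \<in> ch_dom ?r" using c(2) W(2) by (simp add: ch_dom_restrict_chart)
  moreover have "ch_img ?r \<in> \<U>" using W(1) by (simp only: ch_img_restrict_chart[OF W(4)])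
  ultimately show "\<exists>c\<in>mfd_atlas M. \<exists>d\<in>mfd_atlas N. p \<in> ch_dom c \<and> ch_img c \<in> \<U> \<and> \<gamma> ` ch_dom c \<subseteq> ch_dom d \<and>
        in_F k (ch_img c) (\<lambda>x. ch_map d (\<gamma> (ch_inv c x)))"
    using d by (intro bexI[of _ ?r] bexI[of _ d] conjI)
qed

lemma maps_continuous:
  assumes \<gamma>: "\<gamma> \<in> maps \<U> \<F> M k N" and N: "chart_atlas N k"
  shows "continuous_map (mfd_top M) (mfd_top N) \<gamma>"
  unfolding continuous_map_def
proof (intro conjI allI impI)
  show "\<gamma> \<in> points M \<rightarrow> points N" using \<gamma> by (auto simp: maps_def)
  fix V assume V: "openin (mfd_top N) V"
  show "openin (mfd_top M) {p \<in> points M. \<gamma> p \<in> V}"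
  proof (subst openin_subopen, intro ballI)
    fix p assume p: "p \<in> {p \<in> points M. \<gamma> p \<in> V}"
    then obtain d B where d: "d \<in> mfd_atlas N" and B: "openin (mfd_top M) B" "p \<in> B"
      "\<gamma> ` B \<subseteq> ch_dom d" and g: "germ_F k p (\<lambda>q. ch_map d (\<gamma> q))" using maps_local[OF \<gamma>] by blast
    have D: "is_chart (mfd_top N) (euclid k) (vecs k) d" using N d by (simp add: chart_atlas_def)
    have "openin (mfd_top N) (V \<inter> ch_dom d)" using V is_chartD(2)[OF D] by blast
    from chart_open_image[OF D this] have "openin (top_of_set (vecs k)) (ch_map d ` (V \<inter> ch_dom d))"
      by (simp add: subtopology_subtopology)
    from germ_F_open[OF g this] obtain B' where B': "openin (mfd_top M) B'" "p \<in> B'"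
      "(\<lambda>q. ch_map d (\<gamma> q)) ` B' \<subseteq> ch_map d ` (V \<inter> ch_dom d)" using p B by blast
    have "\<gamma> q \<in> V" if "q \<in> B \<inter> B'" for q
    proof -
      have "ch_map d (\<gamma> q) \<in> ch_map d ` (V \<inter> ch_dom d)" "\<gamma> q \<in> ch_dom d" using that B'(3) B(3) by auto
      then show ?thesis using chart_inj[OF D] by (auto dest: inj_onD)
    qed
    then show "\<exists>T. openin (mfd_top M) T \<and> p \<in> T \<and> T \<subseteq> {p \<in> points M. \<gamma> p \<in> V}"
      using B B' openin_subset[OF B(1)] by (intro exI[of _ "B \<inter> B'"]) auto
  qed
qed

end

section \<open>Tangent maps in coordinates\<close>

text \<open>The differential of \<open>f\<close> at \<open>x\<close> applied to \<open>v\<close>,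
  that is, the Jacobian matrix times \<open>v\<close>, padded by 0 from index \<open>l\<close>
  on.\<close>

definition jac :: "nat \<Rightarrow> nat \<Rightarrow> ((nat \<Rightarrow> real) \<Rightarrow> (nat \<Rightarrow> real)) \<Rightarrow> (nat \<Rightarrow> real) \<Rightarrow> (nat \<Rightarrow> real) \<Rightarrow> (nat \<Rightarrow> real)"
  where "jac n l f x v = (\<lambda>i. if i < l then \<Sum>j<n. v j * (THE d. has_partial j (\<lambda>x. f x i) d x) else 0)"

lemma jac_in_vecs: "jac n l f x v \<in> vecs l"
  by (simp add: jac_def)

lemma eventually_ray_in:
  assumes S: "openin (top_of_set (vecs n)) S" and x: "x \<in> S" and v: "v \<in> vecs n"
  shows "\<forall>\<^sub>F t in at 0. (\<lambda>i. x i + t * v i) \<in> S"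
proof -
  have xv: "x \<in> vecs n" using S x openin_subset by fastforce
  obtain \<delta> where \<delta>: "\<delta> > 0" "\<forall>y\<in>vecs n. (\<forall>i<n. \<bar>y i - x i\<bar> < \<delta>) \<longrightarrow> y \<in> S"
    using open_box[OF S x] by blast
  have "\<forall>\<^sub>F t in at 0. \<forall>i\<in>{..<n}. \<bar>t * v i\<bar> < \<delta>"
  proof (rule eventually_ball_finite, simp, safe)
    fix i
    have "((\<lambda>t. \<bar>t * v i\<bar>) \<longlongrightarrow> \<bar>0 * v i\<bar>) (at 0)" by (intro tendsto_intros)
    then show "\<forall>\<^sub>F t in at 0. \<bar>t * v i\<bar> < \<delta>" by (rule order_tendstoD) (simp add: \<delta>)
  qed
  then show ?thesis
  proof (rule eventually_mono)
    fix t assume "\<forall>i\<in>{..<n}. \<bar>t * v i\<bar> < \<delta>"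
    then show "(\<lambda>i. x i + t * v i) \<in> S"
      by (intro \<delta>(2)[rule_format]) (use xv v in auto)
  qed
qed

lemma jac_along_curve:
  assumes S: "openin (top_of_set (vecs n)) S" and f: "bsmooth (euclid n) (euclid l) S f"
    and w: "w 0 \<in> S" "\<forall>\<^sub>F t in at 0. w t \<in> vecs n"
    and w': "\<And>j. j < n \<Longrightarrow> ((\<lambda>t. w t j) has_real_derivative v j) (at 0)" and i: "i < l"
  shows "((\<lambda>t. f (w t) i) has_real_derivative jac n l f (w 0) v i) (at 0)"
proof -
  have g: "csmooth n S (\<lambda>x. f x i)" by (rule csmooth_if_bsmooth[OF S f])
  have "((\<lambda>t. f (w t) i) has_real_derivative
      (\<Sum>j<n. v j * (THE d. has_partial j (\<lambda>x. f x i) d (w 0)))) (at 0)"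
    by (rule has_derivative_along_curve[OF S w(1,2) _ _ w', where g' = "\<lambda>j x. THE d. has_partial j (\<lambda>x. f x i) d x"])
      (rule csmooth_continuous_on[OF csmooth_the_partial(1)[OF S g]] csmooth_the_partial(2)[OF S g] | assumption)+
  then show ?thesis using i by (simp add: jac_def)
qed

lemma jac_derivative:
  assumes S: "openin (top_of_set (vecs n)) S" and f: "bsmooth (euclid n) (euclid l) S f"
    and x: "x \<in> S" and v: "v \<in> vecs n" and i: "i < l"
  shows "((\<lambda>t. f (\<lambda>j. x j + t * v j) i) has_real_derivative jac n l f x v i) (at 0)"
proof -
  have "x \<in> vecs n" using S x openin_subset by fastforce
  then have "\<forall>\<^sub>F t in at 0. (\<lambda>j. x j + t * v j) \<in> vecs n" using v by simp
  moreover have "((\<lambda>t. x j + t * v j) has_real_derivative v j) (at 0)" for j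
    by (auto intro!: derivative_eq_intros)
  ultimately show ?thesis
    using jac_along_curve[OF S f, of "\<lambda>t j. x j + t * v j" v i] x i by simp
qed

text \<open>It turns the relational transformation rule in \<open>tangent_space\<close> into an
  equation. Near 0 the ray stays in the open set \<open>S\<close>, where \<open>f\<close> has values
  in \<open>vecs l\<close>; this settles the coordinates from \<open>l\<close> on.\<close>

lemma has_dirderiv_jac:
  assumes S: "openin (top_of_set (vecs n)) S" and f: "bsmooth (euclid n) (euclid l) S f"
    and x: "x \<in> S" and v: "v \<in> vecs n"
  shows "has_dirderiv (euclid n) (euclid l) f x v L \<longleftrightarrow> L = jac n l f x v"
proof -
  have "f y i = 0" if "y \<in> S" "i \<ge> l" for y i
    using bsmooth_range[OF f] that by fastforce
  then have out: "\<forall>\<^sub>F t in at 0. \<forall>i\<ge>l. (f (\<lambda>j. x j + t * v j) i - f x i) / t = 0"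
    using eventually_ray_in[OF S x v] x by (auto elim!: eventually_mono)
  have lim: "((\<lambda>t. (f (\<lambda>j. x j + t * v j) i - f x i) / t) \<longlongrightarrow> jac n l f x v i) (at 0)" for i
  proof (cases "i < l")
    case True
    then show ?thesis
      using jac_derivative[OF S f x v True] by (simp add: has_field_derivative_iff)
  next
    case False
    then have "\<forall>\<^sub>F t in at 0. 0 = (f (\<lambda>j. x j + t * v j) i - f x i) / t"
      using out by (auto elim!: eventually_mono)
    from Lim_transform_eventually[OF tendsto_const this] False show ?thesis by (simp add: jac_def)
  qed
  show ?thesis
  proof
    assume "has_dirderiv (euclid n) (euclid l) f x v L"
    then have "((\<lambda>t. (f (\<lambda>j. x j + t * v j) i - f x i) / t) \<longlongrightarrow> L i) (at 0)" for i
      by (simp add: has_dirderiv_euclid)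
    then show "L = jac n l f x v"
      using lim tendsto_unique[OF trivial_limit_at] by blast
  next
    assume "L = jac n l f x v"
    then show "has_dirderiv (euclid n) (euclid l) f x v L"
      using lim out jac_in_vecs[of n l f x v] by (simp add: has_dirderiv_euclid)
  qed
qed

lemma jac_cong:
  assumes S: "openin (top_of_set (vecs n)) S" and f: "bsmooth (euclid n) (euclid l) S f"
    and x: "x \<in> S" and eq: "\<And>y. y \<in> S \<Longrightarrow> g y = f y"
  shows "jac n l g x v = jac n l f x v"
proof -
  have "(THE d. has_partial j (\<lambda>x. g x i) d x) = (THE d. has_partial j (\<lambda>x. f x i) d x)" if "j < n" for i j
  proof (rule the_equality)
    have "has_partial j (\<lambda>x. f x i) (THE d. has_partial j (\<lambda>x. f x i) d x) x"
      by (rule csmooth_the_partial(2)[OF S csmooth_if_bsmooth[OF S f] that x])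
    from has_partial_cong[OF S x that _ this, of "\<lambda>x. g x i"] eq
    show *: "has_partial j (\<lambda>x. g x i) (THE d. has_partial j (\<lambda>x. f x i) d x) x" by simp
    show "d = (THE d. has_partial j (\<lambda>x. f x i) d x)" if "has_partial j (\<lambda>x. g x i) d x" for d
      by (rule has_partial_unique[OF that *])
  qed
  then show ?thesis by (simp add: jac_def fun_eq_iff)
qed

lemma jac_id:
  assumes "v \<in> vecs n"
  shows "jac n n (\<lambda>x. x) x v = v"
proof -
  have "(THE d. has_partial j (\<lambda>x. x i) d x) = (if i = j then 1 else 0)" for i j
  proof (rule the_equality)
    show "has_partial j (\<lambda>x. x i) (if i = j then 1 else 0) x" by (rule has_partial_coord)
  qed (rule has_partial_unique[OF _ has_partial_coord])
  then have "jac n n (\<lambda>x. x) x v = (\<lambda>i. if i < n then \<Sum>j<n. if i = j then v j else 0 else 0)"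
    unfolding jac_def by (simp only: mult_if_delta if_distrib[of "(*) _"] mult_1_right mult_zero_right)
  then show ?thesis using assms by (auto simp: fun_eq_iff)
qed

text \<open>Both sides are derivatives at 0 of the single curve t \<mapsto>
  \<open>g (f (x + t v))\<close>, and derivatives are unique.\<close>

lemma jac_compose:
  assumes S: "openin (top_of_set (vecs n)) S" and T: "openin (top_of_set (vecs k)) T"
    and f: "bsmooth (euclid n) (euclid k) S f" and fST: "f ` S \<subseteq> T" and g: "bsmooth (euclid k) (euclid l) T g"
    and x: "x \<in> S" and v: "v \<in> vecs n"
  shows "jac n l (\<lambda>x. g (f x)) x v = jac k l g (f x) (jac n k f x v)"
proof
  fix i
  show "jac n l (\<lambda>x. g (f x)) x v i = jac k l g (f x) (jac n k f x v) i"
  proof (cases "i < l")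
    case True
    define w where "w t = f (\<lambda>j. x j + t * v j)" for t
    have "T \<subseteq> vecs k" using openin_subset[OF T] by simp
    then have ev: "\<forall>\<^sub>F t in at 0. w t \<in> vecs k"
      using eventually_ray_in[OF S x v] fST unfolding w_def by (auto elim!: eventually_mono)
    have "((\<lambda>t. g (w t) i) has_real_derivative jac k l g (w 0) (jac n k f x v) i) (at 0)"
    proof (rule jac_along_curve[OF T g _ ev _ True])
      show "w 0 \<in> T" using x fST by (auto simp: w_def)
      show "j < k \<Longrightarrow> ((\<lambda>t. w t j) has_real_derivative jac n k f x v j) (at 0)" for j
        unfolding w_def by (rule jac_derivative[OF S f x v])
    qed
    moreover have "((\<lambda>t. g (w t) i) has_real_derivative jac n l (\<lambda>x. g (f x)) x v i) (at 0)"
      unfolding w_def using jac_derivative[OF S bsmooth_compose[OF S T f fST g] x v True] .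
    ultimately show ?thesis using DERIV_unique by (fastforce simp: w_def)
  qed (simp add: jac_def)
qed

lemma split_coords_in_vecs: "fst (split_coords n z) \<in> vecs n" "snd (split_coords n z) \<in> vecs n"
  by (auto simp: split_coords_def)

text \<open>The product of \<open>S\<close> with \<real>^n in joined coordinates; images of tangent
  charts have this shape.\<close>

definition over_base :: "nat \<Rightarrow> (nat \<Rightarrow> real) set \<Rightarrow> (nat \<Rightarrow> real) set" where
  "over_base n S = {z \<in> vecs (2 * n). fst (split_coords n z) \<in> S}"

lemma openin_over_base:
  assumes "openin (top_of_set (vecs n)) S"
  shows "openin (top_of_set (vecs (2 * n))) (over_base n S)"
proof -
  have "continuous_map (top_of_set (vecs (2 * n))) (top_of_set (vecs n)) (\<lambda>z. fst (split_coords n z))"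
    using continuous_map_compose[OF continuous_map_split_coords continuous_map_fst] by (simp only: comp_def)
  from openin_continuous_map_preimage[OF this assms] show ?thesis by (simp add: over_base_def)
qed

text \<open>The tangent map (x, v) \<mapsto> (f(x), f'(x)v) in joined coordinates.\<close>

definition tangent_map :: "nat \<Rightarrow> ((nat \<Rightarrow> real) \<Rightarrow> (nat \<Rightarrow> real)) \<Rightarrow> (nat \<Rightarrow> real) \<Rightarrow> (nat \<Rightarrow> real)" where
  "tangent_map n f z = (case split_coords n z of (x, v) \<Rightarrow> join_coords n (f x) (jac n n f x v))"

text \<open>The lower coordinates are those of \<open>f\<close> after the projection to the base;
  the upper ones are linear in the fibre, with partial derivatives of \<open>f\<close> at the base
  point as coefficients.\<close>

lemma bsmooth_tangent_map:
  assumes S: "openin (top_of_set (vecs n)) S" and f: "bsmooth (euclid n) (euclid n) S f"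
  shows "bsmooth (euclid (2 * n)) (euclid (2 * n)) (over_base n S) (tangent_map n f)"
proof (rule bsmooth_if_csmooth[OF openin_over_base[OF S]])
  let ?B = "over_base n S"
  let ?p = "\<lambda>z. fst (split_coords n z)"
  have p: "csmooth (2 * n) ?B (\<lambda>z. ?p z j)" if "j < n" for j
    using that csmooth_coord[of "2 * n" ?B j] by (simp add: split_coords_def)
  have comp: "csmooth (2 * n) ?B (\<lambda>z. h (?p z))" if "csmooth n S h" for h
    by (rule csmooth_compose[OF openin_over_base[OF S] S p _ that]) (auto simp: over_base_def)
  fix i assume "i < 2 * n"
  show "csmooth (2 * n) ?B (\<lambda>z. tangent_map n f z i)"
  proof (cases "i < n")
    case True
    then show ?thesis
      using comp[OF csmooth_if_bsmooth[OF S f]] by (simp add: tangent_map_def join_coords_def case_prod_beta)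
  next
    case False
    then have i: "i - n < n" using \<open>i < 2 * n\<close> by simp
    have "csmooth (2 * n) ?B (\<lambda>z. \<Sum>j<n. z (j + n) * (THE d. has_partial j (\<lambda>x. f x (i - n)) d (?p z)))"
      by (intro csmooth_sum csmooth_mult csmooth_coord comp[OF csmooth_the_partial(1)[OF S csmooth_if_bsmooth[OF S f]]])
        auto
    then show ?thesis
      using False i by (simp add: tangent_map_def join_coords_def case_prod_beta jac_def)
        (simp add: split_coords_def)
  qed
next
  show "tangent_map n f ` over_base n S \<subseteq> vecs (2 * n)"
    by (auto simp: tangent_map_def case_prod_beta join_coords_def jac_def)
qed

section \<open>Topologies defined by atlases\<close>

text \<open>Injectivity of the charts makes taking images commute with intersections; unions are
  harmless.\<close>

lemma istopology_atlas:
  assumes "\<And>c. c \<in> A \<Longrightarrow> inj_on (ch_map c) (ch_dom c)"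
  shows "istopology (\<lambda>W. W \<subseteq> X \<and> (\<forall>c\<in>A. openin (ltop (ch_model c)) (ch_map c ` (W \<inter> ch_dom c))))"
  unfolding istopology_def
proof (intro conjI allI impI)
  fix S T assume S: "S \<subseteq> X \<and> (\<forall>c\<in>A. openin (ltop (ch_model c)) (ch_map c ` (S \<inter> ch_dom c)))"
    and T: "T \<subseteq> X \<and> (\<forall>c\<in>A. openin (ltop (ch_model c)) (ch_map c ` (T \<inter> ch_dom c)))"
  have "ch_map c ` (S \<inter> T \<inter> ch_dom c) = ch_map c ` (S \<inter> ch_dom c) \<inter> ch_map c ` (T \<inter> ch_dom c)"
    if "c \<in> A" for c
    using assms[OF that] inj_on_image_Int[of "ch_map c" "ch_dom c" "S \<inter> ch_dom c" "T \<inter> ch_dom c"]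
    by (simp add: Int_ac)
  then show "S \<inter> T \<subseteq> X" "\<forall>c\<in>A. openin (ltop (ch_model c)) (ch_map c ` (S \<inter> T \<inter> ch_dom c))"
    using S T by auto
next
  fix \<K> assume K: "\<forall>K\<in>\<K>. K \<subseteq> X \<and> (\<forall>c\<in>A. openin (ltop (ch_model c)) (ch_map c ` (K \<inter> ch_dom c)))"
  have eq: "ch_map c ` (\<Union>\<K> \<inter> ch_dom c) = (\<Union>K\<in>\<K>. ch_map c ` (K \<inter> ch_dom c))" for c by auto
  show "\<forall>c\<in>A. openin (ltop (ch_model c)) (ch_map c ` (\<Union>\<K> \<inter> ch_dom c))"
    unfolding eq using K by (intro ballI openin_Union) blast
qed blast

lemma openin_atlas_topology:
  assumes "\<And>c. c \<in> A \<Longrightarrow> inj_on (ch_map c) (ch_dom c)"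
  shows "openin (atlas_topology X A) W \<longleftrightarrow>
     W \<subseteq> X \<and> (\<forall>c\<in>A. openin (ltop (ch_model c)) (ch_map c ` (W \<inter> ch_dom c)))"
  unfolding atlas_topology_def by (simp add: topology_inverse'[OF istopology_atlas[OF assms]])

lemma topspace_atlas_topology:
  assumes "\<And>c. c \<in> A \<Longrightarrow> inj_on (ch_map c) (ch_dom c)"
    and "\<And>c. c \<in> A \<Longrightarrow> ch_dom c \<subseteq> X \<and> openin (ltop (ch_model c)) (ch_img c)"
  shows "topspace (atlas_topology X A) = X"
proof -
  have "openin (atlas_topology X A) X"
    using assms(2) by (auto simp: openin_atlas_topology[OF assms(1)] Int_absorb1)
  moreover have "openin (atlas_topology X A) W \<Longrightarrow> W \<subseteq> X" for W
    by (simp add: openin_atlas_topology[OF assms(1)])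
  ultimately show ?thesis by (meson openin_subset openin_topspace subset_antisym)
qed

section \<open>The tangent bundle\<close>

locale target_manifold =
  fixes n :: nat and N :: "('q, nat \<Rightarrow> real) mfd"
  assumes N: "smooth_manifold n N"
begin

lemma N_atlas: "maximal_atlas (mfd_top N) (euclid n) (vecs n) (mfd_atlas N)"
  using N by (simp add: smooth_manifold_def)

lemmas N_chart = maximal_atlasD(2)[OF N_atlas]

lemma N_chart_atlas: "chart_atlas N n"
  using N_chart maximal_atlasD(1)[OF N_atlas] by (auto simp: chart_atlas_def)

lemma N_model [simp]: "c \<in> mfd_atlas N \<Longrightarrow> ch_model c = euclid n"
  using is_chartD(1)[OF N_chart] .

lemma charts_atD: "c \<in> charts_at N p \<Longrightarrow> c \<in> mfd_atlas N" "c \<in> charts_at N p \<Longrightarrow> p \<in> ch_dom c"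
  by (auto simp: charts_at_def)

abbreviation transition :: "('q, nat \<Rightarrow> real) chart \<Rightarrow> ('q, nat \<Rightarrow> real) chart \<Rightarrow> (nat \<Rightarrow> real) \<Rightarrow> (nat \<Rightarrow> real)" where
  "transition c d \<equiv> ch_map d \<circ> ch_inv c"

abbreviation overlap :: "('q, nat \<Rightarrow> real) chart \<Rightarrow> ('q, nat \<Rightarrow> real) chart \<Rightarrow> (nat \<Rightarrow> real) set" where
  "overlap c d \<equiv> ch_map c ` (ch_dom c \<inter> ch_dom d)"

lemma N_chart_open_image:
  "c \<in> mfd_atlas N \<Longrightarrow> openin (mfd_top N) V \<Longrightarrow> V \<subseteq> ch_dom c \<Longrightarrow> openin (top_of_set (vecs n)) (ch_map c ` V)"
  using chart_open_image[OF N_chart] by (simp add: subtopology_subtopology)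

lemma openin_overlap:
  assumes "c \<in> mfd_atlas N" "d \<in> mfd_atlas N"
  shows "openin (top_of_set (vecs n)) (overlap c d)"
  using is_chartD(2)[OF N_chart[OF assms(1)]] is_chartD(2)[OF N_chart[OF assms(2)]]
  by (intro N_chart_open_image[OF assms(1)]) auto

lemma bsmooth_trans:
  assumes "c \<in> mfd_atlas N" "d \<in> mfd_atlas N"
  shows "bsmooth (euclid n) (euclid n) (overlap c d) (transition c d)"
  using maximal_atlasD(3)[OF N_atlas assms] assms by (simp add: smoothly_compatible_def)

lemma trans_chart: "c \<in> mfd_atlas N \<Longrightarrow> p \<in> ch_dom c \<Longrightarrow> transition c d (ch_map c p) = ch_map d p"
  using chart_inv_map[OF N_chart] by simp

lemma jac_trans_self:
  assumes "c \<in> mfd_atlas N" "p \<in> ch_dom c" "v \<in> vecs n"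
  shows "jac n n (transition c c) (ch_map c p) v = v"
proof -
  have "jac n n (transition c c) (ch_map c p) v = jac n n (\<lambda>x. x) (ch_map c p) v"
    using openin_subset[OF openin_overlap[OF assms(1,1)]] trans_chart assms
    by (intro jac_cong[OF openin_overlap[OF assms(1,1)] bsmooth_id]) auto
  then show ?thesis by (simp add: jac_id[OF assms(3)])
qed

text \<open>The cocycle identity, by the chain rule on the triple overlap.\<close>

lemma jac_trans_trans:
  assumes c: "c \<in> mfd_atlas N" "d \<in> mfd_atlas N" "e \<in> mfd_atlas N"
    and p: "p \<in> ch_dom c" "p \<in> ch_dom d" "p \<in> ch_dom e" and v: "v \<in> vecs n"
  shows "jac n n (transition d e) (ch_map d p) (jac n n (transition c d) (ch_map c p) v) = jac n n (transition c e) (ch_map c p) v"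
proof -
  let ?S = "ch_map c ` (ch_dom c \<inter> ch_dom d \<inter> ch_dom e)"
  have S: "openin (top_of_set (vecs n)) ?S"
    using is_chartD(2)[OF N_chart[OF c(1)]] is_chartD(2)[OF N_chart[OF c(2)]] is_chartD(2)[OF N_chart[OF c(3)]]
    by (intro N_chart_open_image[OF c(1)]) auto
  have f: "bsmooth (euclid n) (euclid n) ?S (transition c d)"
    by (rule bsmooth_mono[OF bsmooth_trans[OF c(1,2)]]) auto
  have fS: "transition c d ` ?S \<subseteq> overlap d e" using trans_chart[OF c(1)] by auto
  have x: "ch_map c p \<in> ?S" using p by auto
  have "jac n n (transition c e) (ch_map c p) v = jac n n (\<lambda>x. transition d e (transition c d x)) (ch_map c p) v"
    using trans_chart[OF c(1)] trans_chart[OF c(2)]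
    by (intro jac_cong[OF S bsmooth_compose[OF S openin_overlap[OF c(2,3)] f fS bsmooth_trans[OF c(2,3)]] x]) auto
  also have "\<dots> = jac n n (transition d e) (transition c d (ch_map c p)) (jac n n (transition c d) (ch_map c p) v)"
    by (rule jac_compose[OF S openin_overlap[OF c(2,3)] f fS bsmooth_trans[OF c(2,3)] x v])
  finally show ?thesis using trans_chart[OF c(1) p(1)] by simp
qed

section \<open>Tangent vectors in coordinates\<close>

lemma tangent_space_iff:
  "(p, v) \<in> tangent_space N p \<longleftrightarrow> v \<in> extensional (charts_at N p) \<and>
     (\<forall>c\<in>charts_at N p. v c \<in> vecs n) \<and>
     (\<forall>c\<in>charts_at N p. \<forall>d\<in>charts_at N p. v d = jac n n (transition c d) (ch_map c p) (v c))"
proof -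
  have "has_dirderiv (ch_model c) (ch_model d) (transition c d) (ch_map c p) w L \<longleftrightarrow>
      L = jac n n (transition c d) (ch_map c p) w"
    if "c \<in> charts_at N p" "d \<in> charts_at N p" "w \<in> vecs n" for c d w L
    using that has_dirderiv_jac[OF openin_overlap bsmooth_trans, of c d "ch_map c p" w L] charts_atD[of _ p] by auto
  moreover have "lcarrier (ch_model c) = vecs n" if "c \<in> charts_at N p" for c
    using charts_atD(1)[OF that] by simp
  then have "(p, v) \<in> tangent_space N p \<longleftrightarrow> v \<in> extensional (charts_at N p) \<and>
     (\<forall>c\<in>charts_at N p. v c \<in> vecs n) \<and>
     (\<forall>c\<in>charts_at N p. \<forall>d\<in>charts_at N p.
        has_dirderiv (ch_model c) (ch_model d) (transition c d) (ch_map c p) (v c) (v d))"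
    by (simp add: tangent_space_def)
  ultimately show ?thesis by (simp cong: conj_cong ball_cong)
qed

text \<open>The tangent vector whose coordinate vector in the chart \<open>c\<close> is
  \<open>w\<close>; the transformation rule forces its other coordinate vectors.\<close>

definition tvec :: "('q, nat \<Rightarrow> real) chart \<Rightarrow> 'q \<Rightarrow> (nat \<Rightarrow> real) \<Rightarrow> 'q tangent" where
  "tvec c p w = (p, \<lambda>d\<in>charts_at N p. jac n n (transition c d) (ch_map c p) w)"

lemma tvec_in_tangent_space:
  assumes c: "c \<in> charts_at N p" and w: "w \<in> vecs n"
  shows "tvec c p w \<in> tangent_space N p"
  unfolding tvec_def tangent_space_iff
  using c w jac_trans_trans charts_atD by (auto simp: jac_in_vecs jac_def)

lemma tangent_points_iff: "x \<in> tangent_points N \<longleftrightarrow> fst x \<in> points N \<and> x \<in> tangent_space N (fst x)"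
  by (auto simp: tangent_points_def tangent_space_def)

lemma tangent_pointD:
  assumes "x \<in> tangent_points N" "c \<in> mfd_atlas N" "fst x \<in> ch_dom c"
  shows "snd x c \<in> vecs n"
    and "d \<in> mfd_atlas N \<Longrightarrow> fst x \<in> ch_dom d \<Longrightarrow> snd x d = jac n n (transition c d) (ch_map c (fst x)) (snd x c)"
proof -
  have *: "(fst x, snd x) \<in> tangent_space N (fst x)" using assms(1) by (simp add: tangent_points_iff)
  have c: "c \<in> charts_at N (fst x)" using assms by (simp add: charts_at_def)
  show "snd x c \<in> vecs n" using *[unfolded tangent_space_iff] c by (elim conjE) (rule bspec)
  assume "d \<in> mfd_atlas N" "fst x \<in> ch_dom d"
  then have "d \<in> charts_at N (fst x)" by (simp add: charts_at_def)
  with c show "snd x d = jac n n (transition c d) (ch_map c (fst x)) (snd x c)"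
    using *[unfolded tangent_space_iff] by (elim conjE) (rule bspec, erule bspec)
qed

lemma tangent_point_extensional: "x \<in> tangent_points N \<Longrightarrow> snd x \<in> extensional (charts_at N (fst x))"
proof -
  assume "x \<in> tangent_points N"
  then have "(fst x, snd x) \<in> tangent_space N (fst x)" by (simp add: tangent_points_iff)
  then show ?thesis unfolding tangent_space_iff by (rule conjunct1)
qed

text \<open>The transformation rule computes all coordinate vectors from one of them, and
  extensionality fixes the values off the charts at the base point.\<close>

lemma tangent_point_eqI:
  assumes xy: "x \<in> tangent_points N" "y \<in> tangent_points N" "fst x = fst y" "snd x c = snd y c"
    and c: "c \<in> mfd_atlas N" "fst x \<in> ch_dom c"
  shows "x = y"
proof -
  have "snd x d = snd y d" for d
  proof (cases "d \<in> charts_at N (fst x)")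
    case True
    then show ?thesis
      using tangent_pointD(2)[OF xy(1) c, of d] tangent_pointD(2)[OF xy(2) c(1), of d] c xy charts_atD[OF True] by simp
  next
    case False
    then have "snd x d = undefined" "snd y d = undefined"
      using xy(3) tangent_point_extensional[OF xy(1)] tangent_point_extensional[OF xy(2)]
      by (simp_all add: extensional_def)
    then show ?thesis by simp
  qed
  then have "snd x = snd y" by (rule ext)
  with xy(3) show ?thesis by (rule prod_eqI)
qed

section \<open>Standard charts of the tangent bundle\<close>

abbreviation "tch \<equiv> tangent_chart n N"

lemma tch_simps:
  "ch_model (tch c) = euclid (2 * n)"
  "ch_dom (tch c) = {x \<in> tangent_points N. fst x \<in> ch_dom c}"
  "x \<in> ch_dom (tch c) \<Longrightarrow> ch_map (tch c) x = join_coords n (ch_map c (fst x)) (snd x c)"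
  by (simp_all add: tangent_chart_def)

lemma N_chart_vecs: "c \<in> mfd_atlas N \<Longrightarrow> p \<in> ch_dom c \<Longrightarrow> ch_map c p \<in> vecs n"
  using chart_img_subset[OF N_chart] by fastforce

lemma split_tch:
  assumes "c \<in> mfd_atlas N" "x \<in> ch_dom (tch c)"
  shows "split_coords n (ch_map (tch c) x) = (ch_map c (fst x), snd x c)"
  using assms split_join N_chart_vecs[OF assms(1), of "fst x"] tangent_pointD(1)[of x c]
  by (simp add: tch_simps)

lemma tch_inj: "c \<in> mfd_atlas N \<Longrightarrow> inj_on (ch_map (tch c)) (ch_dom (tch c))"
proof (rule inj_onI)
  fix x y assume c: "c \<in> mfd_atlas N" and xy: "x \<in> ch_dom (tch c)" "y \<in> ch_dom (tch c)"
    and "ch_map (tch c) x = ch_map (tch c) y"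
  then have "ch_map c (fst x) = ch_map c (fst y)" "snd x c = snd y c" using split_tch by (metis Pair_inject)+
  moreover have "fst x = fst y"
    using calculation xy chart_inj[OF N_chart[OF c]] by (auto simp: tch_simps dest: inj_onD)
  ultimately show "x = y" using xy c tangent_point_eqI[of x y c] by (auto simp: tch_simps)
qed

text \<open>The fibres are mapped onto all of \<real>^n because \<open>tvec\<close> realises every
  coordinate vector.\<close>

lemma tch_image:
  assumes c: "c \<in> mfd_atlas N" and V: "V \<subseteq> ch_dom c"
  shows "ch_map (tch c) ` {x \<in> tangent_points N. fst x \<in> V} = over_base n (ch_map c ` V)"
proof (intro set_eqI iffI)
  fix z assume "z \<in> ch_map (tch c) ` {x \<in> tangent_points N. fst x \<in> V}"
  then obtain x where x: "x \<in> tangent_points N" "fst x \<in> V" "z = ch_map (tch c) x" by auto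
  then have xd: "x \<in> ch_dom (tch c)" using V by (auto simp: tch_simps)
  then have "z \<in> vecs (2 * n)"
    using x tch_simps(3)[OF xd] join_in_vecs tangent_pointD(1)[OF x(1) c] V by auto
  then show "z \<in> over_base n (ch_map c ` V)"
    using split_tch[OF c xd] x by (auto simp: over_base_def)
next
  fix z assume z: "z \<in> over_base n (ch_map c ` V)"
  then obtain p where p: "p \<in> V" "fst (split_coords n z) = ch_map c p" by (auto simp: over_base_def)
  have pc: "p \<in> ch_dom c" using p V by auto
  define x where "x = tvec c p (snd (split_coords n z))"
  have "c \<in> charts_at N p" using c pc by (simp add: charts_at_def)
  then have x: "x \<in> tangent_points N" "fst x = p" "snd x c = snd (split_coords n z)"
    using tvec_in_tangent_space[of c p] split_coords_in_vecs(2)[of n z] jac_trans_self[OF c pc]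
      chart_dom_subset[OF N_chart[OF c]] pc
    by (auto simp: tangent_points_iff x_def tvec_def)
  then have "ch_map (tch c) x = z"
    using pc p join_split[of z n] z by (simp add: tch_simps over_base_def)
  then show "z \<in> ch_map (tch c) ` {x \<in> tangent_points N. fst x \<in> V}" using x p by auto
qed

lemma tch_tangent_map:
  assumes "c \<in> mfd_atlas N" "d \<in> mfd_atlas N" "x \<in> ch_dom (tch c)" "x \<in> ch_dom (tch d)"
  shows "tangent_map n (transition c d) (ch_map (tch c) x) = ch_map (tch d) x"
  using assms split_tch[OF assms(1,3)] tangent_pointD(2)[of x c d] trans_chart[OF assms(1), of "fst x" d]
  by (simp add: tangent_map_def tch_simps)

lemma tch_overlap:
  assumes "c \<in> mfd_atlas N"
  shows "ch_map (tch c) ` (ch_dom (tch c) \<inter> ch_dom (tch d)) = over_base n (overlap c d)"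
proof -
  have "ch_dom (tch c) \<inter> ch_dom (tch d) = {x \<in> tangent_points N. fst x \<in> ch_dom c \<inter> ch_dom d}"
    by (auto simp: tch_simps)
  then show ?thesis using tch_image[OF assms, of "ch_dom c \<inter> ch_dom d"] by simp
qed

abbreviation "TN \<equiv> tangent_bundle n N"

lemma TN_simps:
  "mfd_top TN = atlas_topology (tangent_points N) (tch ` mfd_atlas N)"
  "mfd_atlas TN = compatible_charts (mfd_top TN) (euclid (2 * n)) (vecs (2 * n)) (tch ` mfd_atlas N)"
  by (simp_all add: tangent_bundle_def Let_def)

lemma openin_TN:
  "openin (mfd_top TN) W \<longleftrightarrow> W \<subseteq> tangent_points N \<and>
     (\<forall>c\<in>mfd_atlas N. openin (top_of_set (vecs (2 * n))) (ch_map (tch c) ` (W \<inter> ch_dom (tch c))))"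
proof -
  have "inj_on (ch_map c) (ch_dom c)" if "c \<in> tch ` mfd_atlas N" for c using that tch_inj by blast
  from openin_atlas_topology[where X = "tangent_points N" and W = W, OF this] show ?thesis
    by (simp add: TN_simps(1) tch_simps(1))
qed

lemma openin_tch_dom: "c \<in> mfd_atlas N \<Longrightarrow> openin (mfd_top TN) (ch_dom (tch c))"
  unfolding openin_TN
proof (intro conjI ballI)
  fix d assume "c \<in> mfd_atlas N" "d \<in> mfd_atlas N"
  then show "openin (top_of_set (vecs (2 * n))) (ch_map (tch d) ` (ch_dom (tch c) \<inter> ch_dom (tch d)))"
    using openin_over_base[OF openin_overlap, of d c] tch_overlap[of d c] by (simp add: Int_commute)
qed (auto simp: tch_simps)

lemma points_TN: "points TN = tangent_points N"
proof -
  have "inj_on (ch_map c) (ch_dom c)" if "c \<in> tch ` mfd_atlas N" for c using that tch_inj by blast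
  moreover have "ch_dom c \<subseteq> tangent_points N \<and> openin (ltop (ch_model c)) (ch_img c)"
    if c: "c \<in> tch ` mfd_atlas N" for c
  proof -
    obtain d where d: "d \<in> mfd_atlas N" "c = tch d" using c by blast
    have "ch_img (tch d) = over_base n (overlap d d)" using tch_overlap[OF d(1), of d] by simp
    then show ?thesis using openin_over_base[OF openin_overlap[OF d(1,1)]] d by (auto simp: tch_simps)
  qed
  ultimately show ?thesis unfolding TN_simps(1) by (rule topspace_atlas_topology)
qed

text \<open>Openness in the atlas topology is tested in each chart \<open>tch d\<close>. There the
  set becomes the preimage of \<open>S\<close> under the tangent map of a chart change, which is
  smooth and so continuous.\<close>

lemma tch_continuous:
  assumes c: "c \<in> mfd_atlas N" and S: "openin (top_of_set (vecs (2 * n))) S"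
  shows "openin (mfd_top TN) {x \<in> ch_dom (tch c). ch_map (tch c) x \<in> S}"
  unfolding openin_TN
proof (intro conjI ballI)
  fix d assume d: "d \<in> mfd_atlas N"
  have T: "openin (top_of_set (vecs (2 * n))) (over_base n (overlap d c))"
    by (rule openin_over_base[OF openin_overlap[OF d c]])
  have sm: "bsmooth (euclid (2 * n)) (euclid (2 * n)) (over_base n (overlap d c)) (tangent_map n (transition d c))"
    by (rule bsmooth_tangent_map[OF openin_overlap[OF d c] bsmooth_trans[OF d c]])
  have "continuous_on (over_base n (overlap d c)) (tangent_map n (transition d c))"
    using csmooth_continuous_on[OF csmooth_if_bsmooth[OF T sm]]
    by (rule continuous_on_coordinatewise_then_product)
  from continuous_openin_preimage[OF this _ S]
  have "openin (top_of_set (over_base n (overlap d c)))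
      (over_base n (overlap d c) \<inter> tangent_map n (transition d c) -` S)"
    using bsmooth_range[OF sm] by auto
  then have "openin (top_of_set (vecs (2 * n))) (over_base n (overlap d c) \<inter> tangent_map n (transition d c) -` S)"
    using T openin_trans by blast
  also have "over_base n (overlap d c) \<inter> tangent_map n (transition d c) -` S =
      ch_map (tch d) ` ({x \<in> ch_dom (tch c). ch_map (tch c) x \<in> S} \<inter> ch_dom (tch d))"
    unfolding tch_overlap[OF d, symmetric] using tch_tangent_map[OF d c] by force
  finally show "openin (top_of_set (vecs (2 * n)))
      (ch_map (tch d) ` ({x \<in> ch_dom (tch c). ch_map (tch c) x \<in> S} \<inter> ch_dom (tch d)))" .
qed (auto simp: tch_simps)

lemma tch_is_chart:
  assumes c: "c \<in> mfd_atlas N"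
  shows "is_chart (mfd_top TN) (euclid (2 * n)) (vecs (2 * n)) (tch c)"
proof -
  have img: "ch_img (tch c) = over_base n (overlap c c)" using tch_overlap[OF c, of c] by simp
  have iop: "openin (top_of_set (vecs (2 * n))) (ch_img (tch c))"
    unfolding img by (rule openin_over_base[OF openin_overlap[OF c c]])
  have isub: "ch_img (tch c) \<subseteq> vecs (2 * n)" using openin_subset[OF iop] by simp
  have dsub: "ch_dom (tch c) \<subseteq> points TN" by (auto simp: points_TN tch_simps)
  have "homeomorphic_map (subtopology (mfd_top TN) (ch_dom (tch c))) (subtopology (ltop (euclid (2 * n))) (ch_img (tch c)))
      (ch_map (tch c))"
  proof (rule bijective_open_imp_homeomorphic_map)
    show "continuous_map (subtopology (mfd_top TN) (ch_dom (tch c))) (subtopology (ltop (euclid (2 * n))) (ch_img (tch c)))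
        (ch_map (tch c))"
      unfolding continuous_map_in_subtopology
    proof
      show "continuous_map (subtopology (mfd_top TN) (ch_dom (tch c))) (ltop (euclid (2 * n))) (ch_map (tch c))"
        unfolding continuous_map_def
      proof (intro conjI allI impI)
        fix S assume "openin (ltop (euclid (2 * n))) S"
        then have "openin (mfd_top TN) {x \<in> ch_dom (tch c). ch_map (tch c) x \<in> S}"
          using tch_continuous[OF c] by simp
        moreover have "{x \<in> topspace (subtopology (mfd_top TN) (ch_dom (tch c))). ch_map (tch c) x \<in> S} =
            {x \<in> ch_dom (tch c). ch_map (tch c) x \<in> S}" using dsub by auto
        ultimately show "openin (subtopology (mfd_top TN) (ch_dom (tch c)))
            {x \<in> topspace (subtopology (mfd_top TN) (ch_dom (tch c))). ch_map (tch c) x \<in> S}"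
          by (simp only: openin_open_subtopology[OF openin_tch_dom[OF c]]) auto
      qed (use isub dsub in auto)
    qed (use dsub in auto)
    show "open_map (subtopology (mfd_top TN) (ch_dom (tch c))) (subtopology (ltop (euclid (2 * n))) (ch_img (tch c)))
        (ch_map (tch c))"
      unfolding open_map_def
    proof (intro allI impI)
      fix W assume "openin (subtopology (mfd_top TN) (ch_dom (tch c))) W"
      then have W: "openin (mfd_top TN) W" "W \<subseteq> ch_dom (tch c)"
        using openin_open_subtopology[OF openin_tch_dom[OF c]] by auto
      have "openin (top_of_set (vecs (2 * n))) (ch_map (tch c) ` (W \<inter> ch_dom (tch c)))"
        using W(1)[unfolded openin_TN] c by (elim conjE) (rule bspec)
      then have "openin (top_of_set (vecs (2 * n))) (ch_map (tch c) ` W)"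
        using W(2) by (simp only: Int_absorb2)
      then show "openin (subtopology (ltop (euclid (2 * n))) (ch_img (tch c))) (ch_map (tch c) ` W)"
        using W(2) iop by (simp only: ltop_euclid openin_open_subtopology[OF iop]) auto
    qed
  qed (use dsub isub tch_inj[OF c] in \<open>auto simp: Int_absorb1\<close>)
  then show ?thesis
    using openin_tch_dom[OF c] iop isub
    unfolding is_chart_def by (simp add: tangent_chart_def subtopology_subtopology)
qed

lemma tch_compatible:
  assumes "c \<in> mfd_atlas N" "d \<in> mfd_atlas N"
  shows "smoothly_compatible (tch c) (tch d)"
proof -
  have "bsmooth (euclid (2 * n)) (euclid (2 * n)) (ch_map (tch c) ` (ch_dom (tch c) \<inter> ch_dom (tch d)))
      (ch_map (tch d) \<circ> ch_inv (tch c))" if "c \<in> mfd_atlas N" "d \<in> mfd_atlas N" for c d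
  proof (rule bsmooth_cong)
    show "bsmooth (euclid (2 * n)) (euclid (2 * n)) (ch_map (tch c) ` (ch_dom (tch c) \<inter> ch_dom (tch d)))
        (tangent_map n (transition c d))"
      unfolding tch_overlap[OF that(1)]
      by (rule bsmooth_tangent_map[OF openin_overlap[OF that] bsmooth_trans[OF that]])
    fix z assume "z \<in> ch_map (tch c) ` (ch_dom (tch c) \<inter> ch_dom (tch d))"
    then show "(ch_map (tch d) \<circ> ch_inv (tch c)) z = tangent_map n (transition c d) z"
      by (elim imageE IntE) (simp add: tch_tangent_map[OF that] chart_inv_map[OF tch_is_chart[OF that(1)]])
  qed
  from this[OF assms] this[OF assms(2,1)] show ?thesis
    by (simp add: smoothly_compatible_def tch_simps(1) Int_commute)
qed

lemma tch_in_atlas: "c \<in> mfd_atlas N \<Longrightarrow> tch c \<in> mfd_atlas TN"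
  unfolding TN_simps(2) compatible_charts_def using tch_is_chart tch_compatible by blast

lemma TN_chart: "d \<in> mfd_atlas TN \<Longrightarrow> is_chart (mfd_top TN) (euclid (2 * n)) (vecs (2 * n)) d"
  and TN_compatible: "d \<in> mfd_atlas TN \<Longrightarrow> c \<in> mfd_atlas N \<Longrightarrow> smoothly_compatible d (tch c)"
  unfolding TN_simps(2) compatible_charts_def by auto

lemma TN_chart_atlas: "chart_atlas TN (2 * n)"
proof -
  have "\<exists>d\<in>mfd_atlas TN. x \<in> ch_dom d" if "x \<in> points TN" for x
  proof -
    have "x \<in> tangent_points N" using that points_TN by simp
    then obtain c where "c \<in> mfd_atlas N" "fst x \<in> ch_dom c"
      using maximal_atlasD(1)[OF N_atlas] tangent_points_iff by blast
    then show ?thesis using tch_in_atlas \<open>x \<in> tangent_points N\<close> by (intro bexI[of _ "tch c"]) (auto simp: tch_simps)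
  qed
  then show ?thesis using TN_chart by (auto simp: chart_atlas_def)
qed

end

section \<open>Maps and sections of class \<open>\<F>\<close>\<close>

lemma smooth_map_preimage:
  assumes f: "smooth_map_on P Q S f" and V: "openin (mfd_top Q) V"
  shows "openin (mfd_top P) {p \<in> S. f p \<in> V}"
proof -
  have S: "openin (mfd_top P) S" and c: "continuous_map (subtopology (mfd_top P) S) (mfd_top Q) f"
    using f by (auto simp: smooth_map_on_def)
  have "topspace (subtopology (mfd_top P) S) = S" using openin_subset[OF S] by auto
  then have "openin (subtopology (mfd_top P) S) {p \<in> S. f p \<in> V}"
    using openin_continuous_map_preimage[OF c V] by simp
  then show ?thesis using S openin_trans_full by blast
qed

lemma smooth_map_onD:
  assumes f: "smooth_map_on P Q S f"
  shows "openin (mfd_top P) S" "f ` S \<subseteq> points Q"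
    and "c \<in> mfd_atlas P \<Longrightarrow> d \<in> mfd_atlas Q \<Longrightarrow>
      bsmooth (ch_model c) (ch_model d) (ch_map c ` {p \<in> ch_dom c \<inter> S. f p \<in> ch_dom d}) (ch_map d \<circ> f \<circ> ch_inv c)"
proof -
  show S: "openin (mfd_top P) S" using f by (simp add: smooth_map_on_def)
  have "continuous_map (subtopology (mfd_top P) S) (mfd_top Q) f" using f by (simp add: smooth_map_on_def)
  from continuous_map_image_subset_topspace[OF this] show "f ` S \<subseteq> points Q"
    using openin_subset[OF S] by (simp add: Int_absorb1)
  show "c \<in> mfd_atlas P \<Longrightarrow> d \<in> mfd_atlas Q \<Longrightarrow>
      bsmooth (ch_model c) (ch_model d) (ch_map c ` {p \<in> ch_dom c \<inter> S. f p \<in> ch_dom d}) (ch_map d \<circ> f \<circ> ch_inv c)"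
    using f by (simp add: smooth_map_on_def)
qed

lemma chart_atlasD:
  assumes "chart_atlas N k"
  shows "d \<in> mfd_atlas N \<Longrightarrow> is_chart (mfd_top N) (euclid k) (vecs k) d"
    and "q \<in> points N \<Longrightarrow> \<exists>d\<in>mfd_atlas N. q \<in> ch_dom d"
  using assms by (auto simp: chart_atlas_def)

lemma smooth_map_local_form:
  assumes Q: "chart_atlas Q k" and N: "chart_atlas N l" and f: "smooth_map_on Q N S f"
    and d: "d \<in> mfd_atlas Q" and e: "e \<in> mfd_atlas N"
  defines "T \<equiv> ch_map d ` {p \<in> ch_dom d \<inter> S. f p \<in> ch_dom e}"
  shows "openin (top_of_set (vecs k)) T"
    and "bsmooth (euclid k) (euclid l) T (ch_map e \<circ> f \<circ> ch_inv d)"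
proof -
  note D = chart_atlasD(1)[OF Q d] and E = chart_atlasD(1)[OF N e]
  have "openin (mfd_top Q) (ch_dom d \<inter> {p \<in> S. f p \<in> ch_dom e})"
    by (intro openin_Int is_chartD(2)[OF D] smooth_map_preimage[OF f] is_chartD(2)[OF E])
  also have "ch_dom d \<inter> {p \<in> S. f p \<in> ch_dom e} = {p \<in> ch_dom d \<inter> S. f p \<in> ch_dom e}" by auto
  finally have "openin (subtopology (ltop (euclid k)) (vecs k)) T"
    unfolding T_def by (rule chart_open_image[OF D]) auto
  then show "openin (top_of_set (vecs k)) T" by (simp add: subtopology_subtopology)
  show "bsmooth (euclid k) (euclid l) T (ch_map e \<circ> f \<circ> ch_inv d)"
    unfolding T_def using smooth_map_onD(3)[OF f d e] is_chartD(1)[OF D] is_chartD(1)[OF E] by simp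
qed

lemma mball_cfunspace_bound:
  assumes "g \<in> mball_of (cfunspace X euclidean_metric) h r" "x \<in> topspace X"
  shows "\<bar>g x - h x\<bar> < (r::real)"
proof -
  have gh: "h \<in> mspace (cfunspace X euclidean_metric)" "g \<in> mspace (cfunspace X euclidean_metric)"
    "mdist (cfunspace X euclidean_metric) h g < r"
    using assms(1) by (simp_all only: in_mball_of)
  have "mdist euclidean_metric (h x) (g x) \<le> mdist (cfunspace X euclidean_metric) h g"
    by (rule mdist_cfunspace_imp_mdist_le[OF gh(1,2) order_refl assms(2)])
  then have "dist (h x) (g x) < r" using gh(3) by (simp add: euclidean_metric_def)
  then show ?thesis by (simp add: dist_real_def abs_minus_commute)
qed

context suitable_family
begin

text \<open>Sup-norm neighbourhoods are open in \<open>\<F>(W,\<real>\<^sup>k)\<close> because \<open>\<F>(W,\<real>) \<rightarrow> BC(W,\<real>)\<close> is continuous.\<close>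

lemma vec_fun_uniform_neighbourhood:
  assumes W: "W \<in> \<U>" and h: "in_F k W h" and r: "r > 0"
  shows "\<exists>B. openin (vec_fun \<F> k W) B \<and> restrict h W \<in> B \<and> (\<forall>\<eta>\<in>B. \<forall>x\<in>W. \<forall>i<k. \<bar>\<eta> x i - h x i\<bar> < r)"
proof -
  have Wv: "W \<subseteq> vecs m" using U_subset[OF W] orthant_subset by blast
  let ?m = "cfunspace (subtopology (ltop (euclid m)) W) euclidean_metric"
  have BC: "BC m W = mtopology_of ?m" by (simp add: BC_def)
  define b where "b i = mball_of ?m (\<lambda>x\<in>W. h x i) r" for i
  have "openin (BC m W) (b i)" for i
    unfolding BC b_def mball_of_def mtopology_of_def
    by (rule Metric_space.openin_mball[OF Metric_space_mspace_mdist])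
  from openin_continuous_map_preimage[OF F_to_BC[OF W] this]
  have bF: "openin (\<F> W) {g \<in> topspace (\<F> W). g \<in> b i}" for i .
  define P where "P = (\<Pi>\<^sub>E i\<in>{..<k}. {g \<in> topspace (\<F> W). g \<in> b i})"
  have P: "openin (product_topology (\<lambda>_. \<F> W) {..<k}) P"
    unfolding P_def by (subst openin_PiE) (use bF in auto)
  \<comment> \<open>The topology of \<open>vec_fun\<close> is pulled back from a power of
    \<open>\<F> W\<close>, so its open sets are the preimages of open sets of that power.\<close>
  define B where "B = (\<lambda>\<gamma>. \<lambda>i\<in>{..<k}. \<lambda>x\<in>W. \<gamma> x i) -` P \<inter> (W \<rightarrow>\<^sub>E lcarrier (euclid k))"
  have "openin (vec_fun \<F> k W) B"
    unfolding vec_fun_def openin_pullback_topology B_def using P by blast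
  moreover have "restrict h W \<in> B"
  proof -
    have hi: "(\<lambda>x\<in>W. h x i) \<in> topspace (\<F> W)" if "i < k" for i
      using h that by (simp add: restrict_in_vec_fun)
    moreover have "(\<lambda>x\<in>W. h x i) \<in> b i" if "i < k" for i
    proof -
      have "(\<lambda>x\<in>W. h x i) \<in> mspace ?m"
        using hi[OF that] F_subset_BC[OF W] BC by (metis subsetD topspace_mtopology_of)
      then show ?thesis
        unfolding b_def mball_of_def by (simp only: Metric_space.centre_in_mball_iff[OF Metric_space_mspace_mdist] r)
    qed
    moreover have "(\<lambda>x\<in>W. restrict h W x i) = (\<lambda>x\<in>W. h x i)" for i by auto
    ultimately show ?thesis
      using in_F_vecs[OF h] by (auto simp: B_def P_def PiE_iff)
  qed
  moreover have "\<bar>\<eta> x i - h x i\<bar> < r" if \<eta>: "\<eta> \<in> B" and x: "x \<in> W" and i: "i < k" for \<eta> x i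
  proof -
    have "(\<lambda>x\<in>W. \<eta> x i) \<in> b i" using \<eta> i by (auto simp: B_def P_def PiE_iff)
    from mball_cfunspace_bound[OF this[unfolded b_def], of x] show ?thesis
      using x Wv by auto
  qed
  ultimately show ?thesis by blast
qed

end

context mapping_source
begin

text \<open>Applied to \<Sigma>, it shows that \<Psi> sends sections with values in \<Omega> to
  \<F>(M,N). Locally it is \<open>germ_F_compose\<close> for \<open>f\<close> in charts.\<close>

lemma maps_compose_smooth:
  assumes \<sigma>: "\<sigma> \<in> maps \<U> \<F> M k Q" and Q: "chart_atlas Q k" and N: "chart_atlas N l"
    and f: "smooth_map_on Q N S f" and S: "\<sigma> ` points M \<subseteq> S"
  shows "(\<lambda>p\<in>points M. f (\<sigma> p)) \<in> maps \<U> \<F> M l N"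
proof (rule mapsI)
  show "(\<lambda>p\<in>points M. f (\<sigma> p)) \<in> points M \<rightarrow>\<^sub>E points N"
    using smooth_map_onD(2)[OF f] S by auto
  fix p assume p: "p \<in> points M"
  obtain d B where d: "d \<in> mfd_atlas Q" and B: "openin (mfd_top M) B" "p \<in> B" "\<sigma> ` B \<subseteq> ch_dom d"
    and g: "germ_F k p (\<lambda>q. ch_map d (\<sigma> q))" using maps_local[OF \<sigma> p] by blast
  note D = chart_atlasD(1)[OF Q d]
  have "f (\<sigma> p) \<in> points N" using smooth_map_onD(2)[OF f] S p by blast
  then obtain e where e: "e \<in> mfd_atlas N" "f (\<sigma> p) \<in> ch_dom e" using chart_atlasD(2)[OF N] by blast
  let ?T = "ch_map d ` {p \<in> ch_dom d \<inter> S. f p \<in> ch_dom e}"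
  note T = smooth_map_local_form[OF Q N f d e(1)]
  have pT: "ch_map d (\<sigma> p) \<in> ?T" using p B S e(2) by blast
  from germ_F_compose[OF g T(1) pT T(2)]
  have germ0: "germ_F l p (\<lambda>q. (ch_map e \<circ> f \<circ> ch_inv d) (ch_map d (\<sigma> q)))" .
  have BM: "B \<subseteq> points M" by (rule openin_subset[OF B(1)])
  have eq: "ch_map e ((\<lambda>p\<in>points M. f (\<sigma> p)) q) = (ch_map e \<circ> f \<circ> ch_inv d) (ch_map d (\<sigma> q))" if "q \<in> B" for q
    using that B(3) BM chart_inv_map[OF D, of "\<sigma> q"] by auto
  have germ: "germ_F l p (\<lambda>q. ch_map e ((\<lambda>p\<in>points M. f (\<sigma> p)) q))"
    by (rule germ_F_cong[OF germ0 B(1,2) eq])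
  \<comment> \<open>A neighbourhood on which \<open>\<sigma>\<close> stays so close to
    \<open>\<sigma> p\<close> that \<open>f \<circ> \<sigma>\<close> remains in the chart domain of
    \<open>e\<close>.\<close>
  obtain B' where B': "openin (mfd_top M) B'" "p \<in> B'" "(\<lambda>q. ch_map d (\<sigma> q)) ` B' \<subseteq> ?T"
    using germ_F_open[OF g T(1) pT] by blast
  have "f (\<sigma> q) \<in> ch_dom e" if "q \<in> B \<inter> B'" for q
  proof -
    have "ch_map d (\<sigma> q) \<in> ?T" "\<sigma> q \<in> ch_dom d" using that B' B by auto
    then show ?thesis using chart_inj[OF D] by (auto dest: inj_onD)
  qed
  then have "(\<lambda>p\<in>points M. f (\<sigma> p)) ` (B \<inter> B') \<subseteq> ch_dom e" using BM by auto
  with germ show "\<exists>d\<in>mfd_atlas N. \<exists>B. openin (mfd_top M) B \<and> p \<in> B \<and>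
       (\<lambda>p\<in>points M. f (\<sigma> p)) ` B \<subseteq> ch_dom d \<and> germ_F l p (\<lambda>q. ch_map d ((\<lambda>p\<in>points M. f (\<sigma> p)) q))"
    using e B B' by (intro bexI[of _ e] exI[of _ "B \<inter> B'"]) auto
qed

text \<open>It is meant for the inverse of (\<pi>, \<Sigma>), which recovers a section from
  \<open>\<gamma>\<close> and \<open>\<xi>\<close>. The two maps are joined to one
  \<real>^(2n)-valued germ before composing.\<close>

lemma maps_compose_smooth_pair:
  assumes \<gamma>: "\<gamma> \<in> maps \<U> \<F> M n N" and \<xi>: "\<xi> \<in> maps \<U> \<F> M n N"
    and N: "chart_atlas N n" and Q: "chart_atlas Q k"
    and f: "smooth_map_on (prod_mfd N N) Q S f" and S: "(\<lambda>p. (\<gamma> p, \<xi> p)) ` points M \<subseteq> S"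
  shows "(\<lambda>p\<in>points M. f (\<gamma> p, \<xi> p)) \<in> maps \<U> \<F> M k Q"
proof (rule mapsI)
  show "(\<lambda>p\<in>points M. f (\<gamma> p, \<xi> p)) \<in> points M \<rightarrow>\<^sub>E points Q"
    using smooth_map_onD(2)[OF f] S by auto
  fix p assume p: "p \<in> points M"
  obtain c B1 where c: "c \<in> mfd_atlas N" and B1: "openin (mfd_top M) B1" "p \<in> B1" "\<gamma> ` B1 \<subseteq> ch_dom c"
    and g1: "germ_F n p (\<lambda>q. ch_map c (\<gamma> q))" using maps_local[OF \<gamma> p] by blast
  obtain d B2 where d: "d \<in> mfd_atlas N" and B2: "openin (mfd_top M) B2" "p \<in> B2" "\<xi> ` B2 \<subseteq> ch_dom d"
    and g2: "germ_F n p (\<lambda>q. ch_map d (\<xi> q))" using maps_local[OF \<xi> p] by blast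
  note C = chart_atlasD(1)[OF N c] and D = chart_atlasD(1)[OF N d]
  let ?pc = "prod_chart c d"
  have "f (\<gamma> p, \<xi> p) \<in> points Q" using smooth_map_onD(2)[OF f] S p by blast
  then obtain e where e: "e \<in> mfd_atlas Q" "f (\<gamma> p, \<xi> p) \<in> ch_dom e" using chart_atlasD(2)[OF Q] by blast
  note E = chart_atlasD(1)[OF Q e(1)]
  define V where "V = {z \<in> ch_dom ?pc \<inter> S. f z \<in> ch_dom e}"
  define T where "T = ch_map ?pc ` V"
  have "openin (mfd_top (prod_mfd N N)) (ch_dom ?pc)"
    using is_chartD(2)[OF C] is_chartD(2)[OF D] by (simp add: prod_mfd_def prod_chart_simps openin_prod_Times_iff)
  then have "openin (mfd_top (prod_mfd N N)) (ch_dom ?pc \<inter> {z \<in> S. f z \<in> ch_dom e})"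
    by (intro openin_Int smooth_map_preimage[OF f] is_chartD(2)[OF E])
  also have "ch_dom ?pc \<inter> {z \<in> S. f z \<in> ch_dom e} = V" by (auto simp: V_def)
  finally have V: "openin (prod_topology (mfd_top N) (mfd_top N)) V" by (simp add: prod_mfd_def)
  have To: "openin (prod_topology (ltop (euclid n)) (ltop (euclid n))) T"
    unfolding T_def using C D V by (intro prod_chart_open_image) (auto simp: V_def prod_chart_simps)
  have "?pc \<in> mfd_atlas (prod_mfd N N)" using c d by (auto simp: prod_mfd_def)
  from smooth_map_onD(3)[OF f this e(1)]
  have sm: "bsmooth (prod_lcs (euclid n) (euclid n)) (euclid k) T (ch_map e \<circ> f \<circ> ch_inv ?pc)"
    by (simp add: T_def V_def is_chartD(1)[OF C] is_chartD(1)[OF D] is_chartD(1)[OF E] prod_chart_simps)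
  define T' where "T' = {z \<in> vecs (2 * n). split_coords n z \<in> T}"
  note T' = bsmooth_split_coords[OF To sm, folded T'_def]
  let ?j = "\<lambda>q. join_coords n (ch_map c (\<gamma> q)) (ch_map d (\<xi> q))"
  have g: "germ_F (2 * n) p ?j" by (rule germ_F_join[OF g1 g2])
  have vec: "x \<in> ch_dom c \<Longrightarrow> ch_map c x \<in> vecs n" "y \<in> ch_dom d \<Longrightarrow> ch_map d y \<in> vecs n" for x y
    using chart_img_subset[OF C] chart_img_subset[OF D] by fastforce+
  have spl: "split_coords n (?j q) = ch_map ?pc (\<gamma> q, \<xi> q)" if "q \<in> B1 \<inter> B2" for q
  proof -
    have "\<gamma> q \<in> ch_dom c" "\<xi> q \<in> ch_dom d" using that B1 B2 by auto
    then show ?thesis using split_join vec by (simp add: prod_chart_simps)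
  qed
  have pT: "?j p \<in> T'"
  proof -
    have "\<gamma> p \<in> ch_dom c" "\<xi> p \<in> ch_dom d" using B1 B2 by auto
    moreover have "(\<gamma> p, \<xi> p) \<in> V" using calculation S p e(2) by (auto simp: V_def prod_chart_simps)
    ultimately show ?thesis using spl[of p] B1 B2 join_in_vecs vec by (auto simp: T'_def T_def)
  qed
  let ?h = "\<lambda>p\<in>points M. f (\<gamma> p, \<xi> p)"
  have BM: "B1 \<subseteq> points M" by (rule openin_subset[OF B1(1)])
  have B12: "openin (mfd_top M) (B1 \<inter> B2)" "p \<in> B1 \<inter> B2" using B1 B2 by auto
  have eq: "ch_map e (?h q) = (ch_map e \<circ> f \<circ> ch_inv ?pc) (split_coords n (?j q))" if q: "q \<in> B1 \<inter> B2" for q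
  proof -
    have "\<gamma> q \<in> ch_dom c" "\<xi> q \<in> ch_dom d" using q B1 B2 by auto
    then have "ch_inv ?pc (ch_map ?pc (\<gamma> q, \<xi> q)) = (\<gamma> q, \<xi> q)"
      using prod_chart_inv[OF C D] by (simp add: prod_chart_simps)
    then show ?thesis using spl[OF q] q BM by auto
  qed
  have germ: "germ_F k p (\<lambda>q. ch_map e (?h q))"
    by (rule germ_F_cong[OF germ_F_compose[OF g T'(1) pT T'(2)] B12 eq])
  obtain B' where B': "openin (mfd_top M) B'" "p \<in> B'" "?j ` B' \<subseteq> T'"
    using germ_F_open[OF g T'(1) pT] by blast
  have "f (\<gamma> q, \<xi> q) \<in> ch_dom e" if q: "q \<in> B1 \<inter> B2 \<inter> B'" for q
  proof -
    have "ch_map ?pc (\<gamma> q, \<xi> q) \<in> T" using spl[of q] q B'(3) by (auto simp: T'_def)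
    then obtain z where z: "z \<in> V" "ch_map ?pc z = ch_map ?pc (\<gamma> q, \<xi> q)" by (auto simp: T_def)
    have "\<gamma> q \<in> ch_dom c" "\<xi> q \<in> ch_dom d" using q B1 B2 by auto
    then have "z = (\<gamma> q, \<xi> q)"
      using z chart_inj[OF C] chart_inj[OF D] by (auto simp: V_def prod_chart_simps dest: inj_onD)
    then show ?thesis using z(1) by (simp add: V_def)
  qed
  then have "?h ` (B1 \<inter> B2 \<inter> B') \<subseteq> ch_dom e" using BM by auto
  with germ show "\<exists>d\<in>mfd_atlas Q. \<exists>B. openin (mfd_top M) B \<and> p \<in> B \<and> ?h ` B \<subseteq> ch_dom d \<and>
      germ_F k p (\<lambda>q. ch_map d (?h q))"
    using e B12 B' by (intro bexI[of _ e] exI[of _ "B1 \<inter> B2 \<inter> B'"]) auto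
qed

end

locale mapping_space = mapping_source + target_manifold n N for n N
begin

lemma sections_sub: "\<sigma> \<in> sections \<U> \<F> M n N \<gamma> \<Longrightarrow> p \<in> points M \<Longrightarrow> \<sigma> p \<in> tangent_points N \<and> fst (\<sigma> p) = \<gamma> p"
  using points_TN by (auto simp: sections_def maps_def)

lemma topspace_sections: "topspace (sections_topology m \<U> \<F> M n N \<gamma>) = sections \<U> \<F> M n N \<gamma>"
  unfolding sections_topology_def topology_generated_by_topspace by blast

lemma tch_section:
  assumes "\<sigma> \<in> sections \<U> \<F> M n N \<gamma>" "p \<in> points M" "e \<in> mfd_atlas N" "\<gamma> p \<in> ch_dom e"
  shows "\<sigma> p \<in> ch_dom (tch e)"
    and "ch_map (tch e) (\<sigma> p) = join_coords n (ch_map e (\<gamma> p)) (snd (\<sigma> p) e)"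
  using sections_sub[OF assms(1,2)] assms(3,4) by (auto simp: tch_simps)

text \<open>Every section has a local representative in \<open>\<F>\<close> near each point, so the seminorms of the
  section space control the sections pointwise.\<close>

lemma sections_evaluation_continuous:
  assumes \<gamma>: "\<gamma> \<in> maps \<U> \<F> M n N" and \<sigma>0: "\<sigma>0 \<in> sections \<U> \<F> M n N \<gamma>" and p0: "p0 \<in> points M"
    and Op: "openin (mfd_top TN) Op" "\<sigma>0 p0 \<in> Op"
  shows "\<exists>A B. openin (sections_topology m \<U> \<F> M n N \<gamma>) A \<and> \<sigma>0 \<in> A \<and> openin (mfd_top M) B \<and> p0 \<in> B \<and>
     (\<forall>\<sigma>\<in>A. \<forall>p\<in>B. \<sigma> p \<in> Op)"
proof -
  have "\<gamma> p0 \<in> points N" using \<gamma> p0 by (auto simp: maps_def)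
  then obtain e where e: "e \<in> mfd_atlas N" "\<gamma> p0 \<in> ch_dom e" using maximal_atlasD(1)[OF N_atlas] by blast
  note E = tch_is_chart[OF e(1)]
  have \<sigma>m: "\<sigma>0 \<in> maps \<U> \<F> M (2 * n) TN" using \<sigma>0 by (simp add: sections_def)
  obtain d B1 where d: "d \<in> mfd_atlas TN" and B1: "openin (mfd_top M) B1" "p0 \<in> B1" "\<sigma>0 ` B1 \<subseteq> ch_dom d"
    and g: "germ_F (2 * n) p0 (\<lambda>q. ch_map d (\<sigma>0 q))" using maps_local[OF \<sigma>m p0] by blast
  note D = TN_chart[OF d]
  have B1M: "B1 \<subseteq> points M" by (rule openin_subset[OF B1(1)])
  define B2 where "B2 = {q \<in> points M. \<gamma> q \<in> ch_dom e}"
  have B2: "openin (mfd_top M) B2"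
    unfolding B2_def
    using openin_continuous_map_preimage[OF maps_continuous[OF \<gamma> N_chart_atlas] is_chartD(2)[OF N_chart[OF e(1)]]] .
  have p0B2: "p0 \<in> B2" using p0 e by (simp add: B2_def)
  let ?s = "\<lambda>q. ch_map (tch e) (\<sigma>0 q)"
  have \<sigma>e: "\<sigma>0 q \<in> ch_dom (tch e)" if "q \<in> B2" for q
    using that tch_section(1)[OF \<sigma>0 _ e(1)] by (auto simp: B2_def)
  let ?T = "ch_map d ` (ch_dom d \<inter> ch_dom (tch e))"
  have "openin (subtopology (ltop (euclid (2 * n))) (vecs (2 * n))) ?T"
    using is_chartD(2)[OF D] is_chartD(2)[OF E] by (intro chart_open_image[OF D]) auto
  then have T: "openin (top_of_set (vecs (2 * n))) ?T" by (simp add: subtopology_subtopology)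
  have sm: "bsmooth (euclid (2 * n)) (euclid (2 * n)) ?T (ch_map (tch e) \<circ> ch_inv d)"
    using TN_compatible[OF d e(1)] is_chartD(1)[OF D] is_chartD(1)[OF E] by (simp add: smoothly_compatible_def)
  have p0T: "ch_map d (\<sigma>0 p0) \<in> ?T" using B1 \<sigma>e[OF p0B2] by auto
  have eq: "?s q = (ch_map (tch e) \<circ> ch_inv d) (ch_map d (\<sigma>0 q))" if "q \<in> B1" for q
    using chart_inv_map[OF D, of "\<sigma>0 q"] that B1(3) by auto
  have gs: "germ_F (2 * n) p0 ?s"
    by (rule germ_F_cong[OF germ_F_compose[OF g T p0T sm] B1(1,2) eq])
  define O' where "O' = ch_map (tch e) ` (Op \<inter> ch_dom (tch e))"
  have "openin (subtopology (ltop (euclid (2 * n))) (vecs (2 * n))) O'"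
    unfolding O'_def using Op(1) is_chartD(2)[OF E] by (intro chart_open_image[OF E]) auto
  then have O': "openin (top_of_set (vecs (2 * n))) O'" by (simp add: subtopology_subtopology)
  have s0: "?s p0 \<in> O'" using Op(2) \<sigma>e[OF p0B2] by (auto simp: O'_def)
  obtain \<delta> where \<delta>: "\<delta> > 0" "\<forall>z\<in>vecs (2 * n). (\<forall>i<2 * n. \<bar>z i - ?s p0 i\<bar> < \<delta>) \<longrightarrow> z \<in> O'"
    using open_box[OF O' s0] by blast
  have s0v: "?s p0 \<in> vecs (2 * n)" using s0 openin_subset[OF O'] by auto
  \<comment> \<open>One half of \<open>\<delta>\<close> is for the variation of
    \<open>\<sigma>0\<close> over a neighbourhood of \<open>p0\<close>, the other for the distance
    between \<open>\<sigma>\<close> and \<open>\<sigma>0\<close>.\<close>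
  let ?box = "{z \<in> vecs (2 * n). \<forall>i<2 * n. \<bar>z i - ?s p0 i\<bar> < \<delta> / 2}"
  have "?s p0 \<in> ?box" using s0v \<delta>(1) by auto
  from germ_F_open[OF gs openin_boxI this] obtain B3 where
    B3: "openin (mfd_top M) B3" "p0 \<in> B3" "?s ` B3 \<subseteq> ?box" by blast
  obtain c where c: "c \<in> mfd_atlas M" "p0 \<in> ch_dom c" using maximal_atlasD(1)[OF M_atlas p0] by blast
  note C = M_chart[OF c(1)]
  have "openin (mfd_top M) (ch_dom c \<inter> B2 \<inter> B3)" using B2 B3(1) is_chartD(2)[OF C] by blast
  from M_chart_open_image[OF c(1) this]
  have "openin (top_of_set (orthant m)) (ch_map c ` (ch_dom c \<inter> B2 \<inter> B3))" by auto
  from germ_F_chart[OF gs c this] obtain W0 where W0: "W0 \<in> \<U>" "ch_map c p0 \<in> W0"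
    "W0 \<subseteq> ch_map c ` (ch_dom c \<inter> B2 \<inter> B3)" "W0 \<subseteq> ch_img c" "in_F (2 * n) W0 (\<lambda>x. ?s (ch_inv c x))"
    using c p0B2 B3 by blast
  from small_U[OF U_open[OF W0(1)] W0(2)] obtain W where W: "W \<in> \<U>" "ch_map c p0 \<in> W" "W \<subseteq> W0"
    "relatively_compact_in (orthant_top m) W W0" by blast
  \<comment> \<open>A subbasic open set of the section topology requires a chart of \<open>M\<close>
    whose whole domain is mapped into one chart of \<open>N\<close> by \<open>\<gamma>\<close>, and
    a set \<open>W\<close> relatively compact in its image; hence the chart \<open>c\<close> is cut
    down to \<open>W0\<close>.\<close>
  let ?r = "restrict_chart c W0"
  have r: "?r \<in> mfd_atlas M"
    using restrict_chart_in_atlas[OF M_atlas c(1) _ W0(4)] U_open[OF W0(1)] by simp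
  have inv_r: "ch_inv ?r x = ch_inv c x" if "x \<in> W" for x
    using that W(3) by (intro ch_inv_restrict_chart[OF C W0(4)]) auto
  have in23: "q \<in> B2 \<inter> B3" if "q \<in> ch_dom c" "ch_map c q \<in> W0" for q
  proof -
    obtain q' where "q' \<in> ch_dom c \<inter> B2 \<inter> B3" "ch_map c q' = ch_map c q" using W0(3) \<open>ch_map c q \<in> W0\<close> by force
    moreover from this have "q' = q" using chart_inj[OF C] \<open>q \<in> ch_dom c\<close> by (auto dest: inj_onD)
    ultimately show ?thesis by simp
  qed
  have \<gamma>r: "\<gamma> ` ch_dom ?r \<subseteq> ch_dom e"
    using in23 by (auto simp: ch_dom_restrict_chart B2_def)
  have inW: "ch_inv c x \<in> ch_dom c" "ch_map c (ch_inv c x) = x" "ch_inv c x \<in> B2" if "x \<in> W" for x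
  proof -
    have x: "x \<in> ch_img c" "x \<in> W0" using that W(3) W0(4) by auto
    show "ch_inv c x \<in> ch_dom c" "ch_map c (ch_inv c x) = x"
      using chart_inv_mem[OF x(1)] chart_map_inv[OF x(1)] .
    then show "ch_inv c x \<in> B2" using in23[of "ch_inv c x"] x by auto
  qed
  have "in_F (2 * n) W (\<lambda>x. ?s (ch_inv c x))" by (rule in_F_restrict[OF W0(1) W(1,4) W0(5)])
  then have "in_F (2 * n) W (\<lambda>x. join_coords n (ch_map e (\<gamma> (ch_inv c x))) (snd (\<sigma>0 (ch_inv c x)) e))"
    by (rule in_F_cong) (use tch_section(2)[OF \<sigma>0 _ e(1)] inW(3) in \<open>auto simp: B2_def\<close>)
  moreover have "(\<lambda>x. snd (\<sigma>0 (ch_inv c x)) e) ` W \<subseteq> vecs n"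
  proof (rule image_subsetI)
    fix x assume "x \<in> W"
    then have x: "ch_inv c x \<in> points M" "\<gamma> (ch_inv c x) \<in> ch_dom e" using inW(3) by (auto simp: B2_def)
    then show "snd (\<sigma>0 (ch_inv c x)) e \<in> vecs n"
      using tangent_pointD(1)[OF _ e(1)] sections_sub[OF \<sigma>0 x(1)] by auto
  qed
  ultimately have "in_F n W (\<lambda>x. snd (\<sigma>0 (ch_inv c x)) e)" by (rule snd_in_vec_fun)
  then have \<eta>0: "in_F n W (\<lambda>x. snd (\<sigma>0 (ch_inv ?r x)) e)" by (rule in_F_cong) (simp add: inv_r)
  from vec_fun_uniform_neighbourhood[OF W(1) this, of "\<delta> / 2"] \<delta>(1) obtain Bset where
    Bset: "openin (vec_fun \<F> n W) Bset" "(\<lambda>x\<in>W. snd (\<sigma>0 (ch_inv ?r x)) e) \<in> Bset"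
      "\<forall>\<eta>\<in>Bset. \<forall>x\<in>W. \<forall>i<n. \<bar>\<eta> x i - snd (\<sigma>0 (ch_inv ?r x)) e i\<bar> < \<delta> / 2" by auto
  define A where "A = {\<sigma> \<in> sections \<U> \<F> M n N \<gamma>. (\<lambda>x\<in>W. snd (\<sigma> (ch_inv ?r x)) e) \<in> Bset}"
  have relc: "relatively_compact_in (orthant_top m) W (ch_img ?r)"
    unfolding ch_img_restrict_chart[OF W0(4)] by (rule W(4))
  have "openin (sections_topology m \<U> \<F> M n N \<gamma>) A"
    unfolding sections_topology_def
    by (rule topology_generated_by_Basis, rule insertI2, rule CollectI)
      (intro exI[of _ ?r] exI[of _ e] exI[of _ W] exI[of _ Bset] conjI A_def r W(1) relc e(1) \<gamma>r Bset(1))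
  moreover have "\<sigma>0 \<in> A" using \<sigma>0 Bset(2) by (simp add: A_def)
  moreover define B where "B = {q \<in> ch_dom c. ch_map c q \<in> W}"
  have "openin (mfd_top M) B" unfolding B_def by (rule M_chart_open_preimage[OF c(1) U_open[OF W(1)]])
  moreover have "p0 \<in> B" using c W by (simp add: B_def)
  moreover have "\<sigma> q \<in> Op" if \<sigma>: "\<sigma> \<in> A" and q: "q \<in> B" for \<sigma> q
  proof -
    have \<sigma>s: "\<sigma> \<in> sections \<U> \<F> M n N \<gamma>" using \<sigma> by (simp add: A_def)
    have q': "q \<in> B2" "q \<in> B3" "ch_map c q \<in> W" using q in23[of q] W(3) by (auto simp: B_def)
    have qM: "q \<in> points M" "\<gamma> q \<in> ch_dom e" using q'(1) by (auto simp: B2_def)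
    have invq: "ch_inv ?r (ch_map c q) = q"
      using inv_r[OF q'(3)] chart_inv_map[OF C, of q] q by (auto simp: B_def)
    have "(\<lambda>x\<in>W. snd (\<sigma> (ch_inv ?r x)) e) \<in> Bset" using \<sigma> by (simp add: A_def)
    from Bset(3)[rule_format, OF this q'(3)]
    have close: "\<bar>snd (\<sigma> q) e i - snd (\<sigma>0 q) e i\<bar> < \<delta> / 2" if "i < n" for i
      using that q'(3) invq by simp
    have s0q: "?s q \<in> ?box" using B3(3) q'(2) by blast
    have "\<bar>ch_map (tch e) (\<sigma> q) i - ?s p0 i\<bar> < \<delta>" if i: "i < 2 * n" for i
    proof -
      \<comment> \<open>Both sections lie over \<open>\<gamma>\<close>, so their base coordinates
        coincide and only the fibre coordinates are compared.\<close>
      have "\<bar>ch_map (tch e) (\<sigma> q) i - ?s q i\<bar> < \<delta> / 2"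
        using close[of "i - n"] i \<delta>(1)
        by (simp add: tch_section(2)[OF \<sigma>s qM(1) e(1) qM(2)] tch_section(2)[OF \<sigma>0 qM(1) e(1) qM(2)] join_coords_def)
      moreover have "\<bar>?s q i - ?s p0 i\<bar> < \<delta> / 2" using s0q i by simp
      ultimately show ?thesis by linarith
    qed
    moreover have \<sigma>d: "\<sigma> q \<in> ch_dom (tch e)" by (rule tch_section(1)[OF \<sigma>s qM(1) e(1) qM(2)])
    moreover have "ch_map (tch e) (\<sigma> q) \<in> vecs (2 * n)" using chart_img_subset[OF E] \<sigma>d by auto
    ultimately have "ch_map (tch e) (\<sigma> q) \<in> O'" using \<delta>(2) by blast
    then show ?thesis using \<sigma>d chart_inj[OF E] by (auto simp: O'_def dest: inj_onD)
  qed
  ultimately show ?thesis by blast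
qed

text \<open>As in the tube lemma: finitely many of the sets \<open>B\<close> from
  \<open>sections_evaluation_continuous\<close> cover \<open>K\<close>, and the corresponding sets
  \<open>A\<close> are intersected.\<close>

lemma openin_sections_compact:
  assumes \<gamma>: "\<gamma> \<in> maps \<U> \<F> M n N" and K: "compactin (mfd_top M) K" and Op: "openin (mfd_top TN) Op"
  shows "openin (sections_topology m \<U> \<F> M n N \<gamma>) {\<sigma> \<in> sections \<U> \<F> M n N \<gamma>. \<sigma> ` K \<subseteq> Op}"
proof (subst openin_subopen, intro ballI)
  let ?T = "sections_topology m \<U> \<F> M n N \<gamma>"
  fix \<sigma>0 assume \<sigma>0: "\<sigma>0 \<in> {\<sigma> \<in> sections \<U> \<F> M n N \<gamma>. \<sigma> ` K \<subseteq> Op}"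
  have KM: "K \<subseteq> points M" by (rule compactin_subset_topspace[OF K])
  have "\<forall>p\<in>K. \<exists>A B. openin ?T A \<and> \<sigma>0 \<in> A \<and> openin (mfd_top M) B \<and> p \<in> B \<and> (\<forall>\<sigma>\<in>A. \<forall>p\<in>B. \<sigma> p \<in> Op)"
    using sections_evaluation_continuous[OF \<gamma> _ _ Op] \<sigma>0 KM by blast
  then obtain A B where AB: "\<And>p. p \<in> K \<Longrightarrow> openin ?T (A p) \<and> \<sigma>0 \<in> A p \<and> openin (mfd_top M) (B p) \<and> p \<in> B p \<and>
      (\<forall>\<sigma>\<in>A p. \<forall>p\<in>B p. \<sigma> p \<in> Op)" by metis
  have "K \<subseteq> \<Union>(B ` K)" using AB by blast
  moreover have "\<forall>U\<in>B ` K. openin (mfd_top M) U" using AB by blast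
  ultimately obtain \<K> where \<K>: "finite \<K>" "\<K> \<subseteq> B ` K" "K \<subseteq> \<Union>\<K>"
    using K unfolding compactin_def by meson
  obtain I where I: "I \<subseteq> K" "finite I" "\<K> = B ` I" using finite_subset_image[OF \<K>(1,2)] by blast
  \<comment> \<open>The factor \<open>topspace ?T\<close> takes care of an empty index set, which
    occurs for empty \<open>K\<close>.\<close>
  let ?A = "(\<Inter>p\<in>I. A p) \<inter> topspace ?T"
  have "openin ?T ?A" using I AB by (intro openin_INT) auto
  moreover have "\<sigma>0 \<in> ?A" using I AB \<sigma>0 by (auto simp: topspace_sections)
  moreover have "?A \<subseteq> {\<sigma> \<in> sections \<U> \<F> M n N \<gamma>. \<sigma> ` K \<subseteq> Op}"
  proof
    fix \<sigma> assume \<sigma>: "\<sigma> \<in> ?A"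
    have "\<sigma> p \<in> Op" if "p \<in> K" for p
    proof -
      have "p \<in> \<Union>(B ` I)" using \<open>p \<in> K\<close> \<K>(3) I(3) by blast
      then obtain i where "i \<in> I" "p \<in> B i" by blast
      then show ?thesis using AB[of i] I(1) \<sigma> by blast
    qed
    then show "\<sigma> \<in> {\<sigma> \<in> sections \<U> \<F> M n N \<gamma>. \<sigma> ` K \<subseteq> Op}"
      using \<sigma> by (auto simp: topspace_sections)
  qed
  ultimately show "\<exists>T. openin ?T T \<and> \<sigma>0 \<in> T \<and> T \<subseteq> {\<sigma> \<in> sections \<U> \<F> M n N \<gamma>. \<sigma> ` K \<subseteq> Op}" by blast
qed

end

section \<open>The manifold of mappings\<close>

lemma maps_extensional: "\<gamma> \<in> maps \<U> \<F> M k N \<Longrightarrow> \<gamma> \<in> extensional (points M)"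
  by (simp add: maps_def PiE_iff)

text \<open>Images under the charts of \<F>(M,N), which are inverses of \<Psi>, become preimages
  under \<Psi>.\<close>

lemma restrict_inv_into_image:
  assumes P: "bij_betw P V U"
  shows "restrict (inv_into V P) U ` (W \<inter> U) = {\<sigma> \<in> V. P \<sigma> \<in> W}"
proof -
  have "W \<inter> U = P ` {\<sigma> \<in> V. P \<sigma> \<in> W}" using P by (auto simp: bij_betw_def)
  moreover have "restrict (inv_into V P) U (P \<sigma>) = \<sigma>" if "\<sigma> \<in> V" for \<sigma>
    using P that by (auto simp: bij_betw_def inv_into_f_f)
  ultimately show ?thesis by (simp only: image_image) (force simp del: restrict_apply)
qed

locale manifold_of_maps = mapping_space m \<U> \<F> M n N
  for m \<U> \<F> and M :: "('p, nat \<Rightarrow> real) mfd" and n and N :: "('q, nat \<Rightarrow> real) mfd" +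
  fixes \<Omega> :: "'q tangent set" and \<Sigma> :: "'q tangent \<Rightarrow> 'q"
  assumes compact: "compact_space (mfd_top M)" and locadd: "local_addition n N \<Omega> \<Sigma>"
begin

abbreviation "theta \<equiv> (\<lambda>x. (fst x, \<Sigma> x))"
abbreviation "Psi \<equiv> (\<lambda>\<sigma>. \<lambda>p\<in>points M. \<Sigma> (\<sigma> p))"
abbreviation "maps_MN \<equiv> maps \<U> \<F> M n N"
abbreviation "Gam \<equiv> sections \<U> \<F> M n N"
abbreviation "V_dom \<gamma> \<equiv> {\<sigma> \<in> Gam \<gamma>. \<sigma> ` points M \<subseteq> \<Omega>}"
abbreviation "U_dom \<gamma> \<equiv> {\<xi> \<in> maps_MN. (\<lambda>p. (\<gamma> p, \<xi> p)) ` points M \<subseteq> theta ` \<Omega>}"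
abbreviation "mch \<equiv> maps_chart m \<U> \<F> M n N \<Omega> \<Sigma>"
abbreviation "mapsM \<equiv> maps_mfd m \<U> \<F> M n N \<Omega> \<Sigma>"

lemma Omega: "openin (mfd_top TN) \<Omega>" and Sigma: "smooth_map_on TN N \<Omega> \<Sigma>"
  and theta_inj: "inj_on theta \<Omega>"
  and theta_inv: "smooth_map_on (prod_mfd N N) TN (theta ` \<Omega>) (inv_into \<Omega> theta)"
  using locadd by (simp_all only: local_addition_def Let_def)

lemma mch_simps:
  "ch_model (mch \<gamma>) = sections_lcs m \<U> \<F> M n N \<gamma>"
  "ch_dom (mch \<gamma>) = U_dom \<gamma>"
  "ch_map (mch \<gamma>) = restrict (inv_into (V_dom \<gamma>) Psi) (U_dom \<gamma>)"
  by (simp_all add: maps_chart_def Let_def)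

text \<open>A vector in \<Omega> is determined by its base point and its image under \<Sigma>, as
  \<open>theta\<close> is injective. Conversely \<open>inv_into \<Omega> theta\<close>, applied to
  (\<open>\<gamma>\<close>, \<open>\<xi>\<close>) pointwise, is a section of class \<F> because that
  inverse is smooth.\<close>

lemma Psi_bij:
  assumes \<gamma>: "\<gamma> \<in> maps_MN"
  shows "bij_betw Psi (V_dom \<gamma>) (U_dom \<gamma>)"
proof -
  have inj: "inj_on Psi (V_dom \<gamma>)"
  proof (rule inj_onI)
    fix \<sigma> \<tau> assume \<sigma>: "\<sigma> \<in> V_dom \<gamma>" and \<tau>: "\<tau> \<in> V_dom \<gamma>" and eq: "Psi \<sigma> = Psi \<tau>"
    have "\<sigma> p = \<tau> p" if p: "p \<in> points M" for p
    proof -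
      have "\<Sigma> (\<sigma> p) = \<Sigma> (\<tau> p)" using fun_cong[OF eq, of p] p by simp
      moreover have "fst (\<sigma> p) = fst (\<tau> p)" using \<sigma> \<tau> p by (simp add: sections_def)
      ultimately have "theta (\<sigma> p) = theta (\<tau> p)" by simp
      then show ?thesis using inj_onD[OF theta_inj] \<sigma> \<tau> p by blast
    qed
    moreover have "\<sigma> \<in> extensional (points M)" "\<tau> \<in> extensional (points M)"
      using \<sigma> \<tau> maps_extensional by (auto simp: sections_def)
    ultimately show "\<sigma> = \<tau>" by (intro extensionalityI) auto
  qed
  have into: "Psi \<sigma> \<in> U_dom \<gamma>" if \<sigma>: "\<sigma> \<in> V_dom \<gamma>" for \<sigma>
  proof (intro CollectI conjI)
    have "\<sigma> \<in> maps \<U> \<F> M (2 * n) TN" using \<sigma> by (simp add: sections_def)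
    then show "Psi \<sigma> \<in> maps_MN"
      using \<sigma> by (intro maps_compose_smooth[OF _ TN_chart_atlas N_chart_atlas Sigma]) auto
    show "(\<lambda>p. (\<gamma> p, Psi \<sigma> p)) ` points M \<subseteq> theta ` \<Omega>"
    proof (rule image_subsetI)
      fix p assume p: "p \<in> points M"
      then have "(\<gamma> p, Psi \<sigma> p) = theta (\<sigma> p)" using \<sigma> by (simp add: sections_def)
      moreover have "\<sigma> p \<in> \<Omega>" using \<sigma> p by blast
      ultimately show "(\<gamma> p, Psi \<sigma> p) \<in> theta ` \<Omega>" by simp
    qed
  qed
  have onto: "\<xi> \<in> Psi ` V_dom \<gamma>" if \<xi>: "\<xi> \<in> U_dom \<gamma>" for \<xi>
  proof
    define \<sigma> where "\<sigma> = (\<lambda>p\<in>points M. inv_into \<Omega> theta (\<gamma> p, \<xi> p))"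
    have th: "(\<gamma> p, \<xi> p) \<in> theta ` \<Omega>" if "p \<in> points M" for p using \<xi> that by blast
    have in\<Omega>: "\<sigma> p \<in> \<Omega>" and eq: "theta (\<sigma> p) = (\<gamma> p, \<xi> p)" if "p \<in> points M" for p
      using inv_into_into[OF th[OF that]] f_inv_into_f[OF th[OF that]] that by (simp_all add: \<sigma>_def)
    have "\<sigma> \<in> maps \<U> \<F> M (2 * n) TN"
      unfolding \<sigma>_def using \<xi> \<gamma>
      by (intro maps_compose_smooth_pair[OF _ _ N_chart_atlas TN_chart_atlas theta_inv]) auto
    then show "\<sigma> \<in> V_dom \<gamma>" using in\<Omega> eq by (auto simp: sections_def)
    have "\<xi> \<in> extensional (points M)" using \<xi> maps_extensional by blast
    then show "\<xi> = Psi \<sigma>" by (rule extensionalityI) (use eq in auto)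
  qed
  have "Psi ` V_dom \<gamma> = U_dom \<gamma>"
    by (intro subset_antisym image_subsetI subsetI) (fact into onto)+
  with inj show ?thesis by (simp only: bij_betw_def)
qed

lemma mch_bij: "\<gamma> \<in> maps_MN \<Longrightarrow> bij_betw (ch_map (mch \<gamma>)) (U_dom \<gamma>) (V_dom \<gamma>)"
proof -
  assume "\<gamma> \<in> maps_MN"
  from bij_betw_inv_into[OF Psi_bij[OF this]] show ?thesis
    unfolding mch_simps(3) by (rule bij_betw_cong[THEN iffD1, rotated]) (rule restrict_apply'[symmetric])
qed

lemma mch_inj: "\<gamma> \<in> maps_MN \<Longrightarrow> inj_on (ch_map (mch \<gamma>)) (ch_dom (mch \<gamma>))"
  using mch_bij by (simp add: bij_betw_def mch_simps(2))

lemma mch_Psi: "\<gamma> \<in> maps_MN \<Longrightarrow> \<sigma> \<in> V_dom \<gamma> \<Longrightarrow> Psi \<sigma> \<in> U_dom \<gamma> \<and> ch_map (mch \<gamma>) (Psi \<sigma>) = \<sigma>"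
proof -
  assume \<gamma>: "\<gamma> \<in> maps_MN" and \<sigma>: "\<sigma> \<in> V_dom \<gamma>"
  have "Psi \<sigma> \<in> U_dom \<gamma>" using bij_betwE[OF Psi_bij[OF \<gamma>]] \<sigma> by blast
  moreover have "inv_into (V_dom \<gamma>) Psi (Psi \<sigma>) = \<sigma>"
    using bij_betw_imp_inj_on[OF Psi_bij[OF \<gamma>]] \<sigma> by (rule inv_into_f_f)
  ultimately show ?thesis unfolding mch_simps(3) by simp
qed

lemma mch_inv: "\<gamma> \<in> maps_MN \<Longrightarrow> \<sigma> \<in> V_dom \<gamma> \<Longrightarrow> ch_inv (mch \<gamma>) \<sigma> = Psi \<sigma>"
  using mch_Psi by (intro inv_into_f_eq[OF mch_inj]) (auto simp: mch_simps(2))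

lemma mch_image: "\<gamma> \<in> maps_MN \<Longrightarrow> ch_map (mch \<gamma>) ` (W \<inter> U_dom \<gamma>) = {\<sigma> \<in> V_dom \<gamma>. Psi \<sigma> \<in> W}"
  using restrict_inv_into_image[OF Psi_bij, of \<gamma> W] by (simp only: mch_simps(3) mem_Collect_eq)

section \<open>Topology of the manifold of mappings\<close>

lemma mapsM_simps:
  "mfd_top mapsM = atlas_topology maps_MN (mch ` maps_MN)"
  "mfd_atlas mapsM = mch ` maps_MN"
  by (simp_all add: maps_mfd_def Let_def)

lemma openin_mapsM:
  "openin (mfd_top mapsM) W \<longleftrightarrow> W \<subseteq> maps_MN \<and>
     (\<forall>\<gamma>\<in>maps_MN. openin (sections_topology m \<U> \<F> M n N \<gamma>) {\<sigma> \<in> V_dom \<gamma>. Psi \<sigma> \<in> W})"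
proof -
  have inj: "inj_on (ch_map c) (ch_dom c)" if "c \<in> mch ` maps_MN" for c using that mch_inj by blast
  have "openin (mfd_top mapsM) W \<longleftrightarrow> W \<subseteq> maps_MN \<and>
     (\<forall>c\<in>mch ` maps_MN. openin (ltop (ch_model c)) (ch_map c ` (W \<inter> ch_dom c)))"
    unfolding mapsM_simps(1) by (rule openin_atlas_topology[OF inj])
  then show ?thesis
    by (simp only: ball_simps mch_simps(1,2) mch_image sections_lcs_def lcs.simps cong: ball_cong)
qed

text \<open>In the chart at \<open>\<gamma>\<close> there are two conditions on a section, one on
  \<open>K\<close> and one on all of \<open>M\<close>, namely to have values in \<Omega>.
  Compactness of \<open>M\<close> makes the second one open as well.\<close>

lemma openin_maps_compact:
  assumes K: "compactin (mfd_top M) K" and V: "openin (mfd_top N) V"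
  shows "openin (mfd_top mapsM) {\<xi> \<in> maps_MN. \<xi> ` K \<subseteq> V}"
  unfolding openin_mapsM
proof (intro conjI ballI)
  fix \<gamma> assume \<gamma>: "\<gamma> \<in> maps_MN"
  have KM: "K \<subseteq> points M" by (rule compactin_subset_topspace[OF K])
  have "openin (sections_topology m \<U> \<F> M n N \<gamma>)
     ({\<sigma> \<in> Gam \<gamma>. \<sigma> ` points M \<subseteq> \<Omega>} \<inter> {\<sigma> \<in> Gam \<gamma>. \<sigma> ` K \<subseteq> {x \<in> \<Omega>. \<Sigma> x \<in> V}})"
    using compact by (intro openin_Int openin_sections_compact[OF \<gamma>] K Omega smooth_map_preimage[OF Sigma V])
      (simp add: compact_space_def)
  also have "{\<sigma> \<in> Gam \<gamma>. \<sigma> ` points M \<subseteq> \<Omega>} \<inter> {\<sigma> \<in> Gam \<gamma>. \<sigma> ` K \<subseteq> {x \<in> \<Omega>. \<Sigma> x \<in> V}} =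
     {\<sigma> \<in> V_dom \<gamma>. Psi \<sigma> \<in> {\<xi> \<in> maps_MN. \<xi> ` K \<subseteq> V}}"
  proof (intro set_eqI)
    fix \<sigma>
    show "\<sigma> \<in> {\<sigma> \<in> Gam \<gamma>. \<sigma> ` points M \<subseteq> \<Omega>} \<inter> {\<sigma> \<in> Gam \<gamma>. \<sigma> ` K \<subseteq> {x \<in> \<Omega>. \<Sigma> x \<in> V}} \<longleftrightarrow>
        \<sigma> \<in> {\<sigma> \<in> V_dom \<gamma>. Psi \<sigma> \<in> {\<xi> \<in> maps_MN. \<xi> ` K \<subseteq> V}}"
    proof (cases "\<sigma> \<in> V_dom \<gamma>")
      case True
      have "Psi \<sigma> ` K = (\<lambda>p. \<Sigma> (\<sigma> p)) ` K" using KM by (intro image_cong) auto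
      moreover have "\<sigma> ` K \<subseteq> \<Omega>" using True KM by blast
      then have "\<sigma> ` K \<subseteq> {x \<in> \<Omega>. \<Sigma> x \<in> V} \<longleftrightarrow> (\<lambda>p. \<Sigma> (\<sigma> p)) ` K \<subseteq> V" by blast
      moreover have "Psi \<sigma> \<in> maps_MN" using mch_Psi[OF \<gamma> True] by blast
      ultimately show ?thesis using True by (simp only: Int_iff mem_Collect_eq simp_thms)
    qed blast
  qed
  finally show "openin (sections_topology m \<U> \<F> M n N \<gamma>)
      {\<sigma> \<in> V_dom \<gamma>. Psi \<sigma> \<in> {\<xi> \<in> maps_MN. \<xi> ` K \<subseteq> V}}" .
qed auto

lemma points_mapsM: "points mapsM = maps_MN"
proof
  \<comment> \<open>The empty compact set imposes no condition, so this is all of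
    \<open>maps_MN\<close>.\<close>
  have "openin (mfd_top mapsM) {\<xi> \<in> maps_MN. \<xi> ` {} \<subseteq> {}}" by (intro openin_maps_compact) auto
  then show "maps_MN \<subseteq> points mapsM" using openin_subset by fastforce
  show "points mapsM \<subseteq> maps_MN" using openin_topspace openin_mapsM by blast
qed

section \<open>Continuity and smoothness of the evaluations\<close>

lemma evaluation_continuous:
  "continuous_map (prod_topology (mfd_top mapsM) (mfd_top M)) (mfd_top N) (\<lambda>(\<gamma>, p). \<gamma> p)"
  unfolding continuous_map_def
proof (intro conjI allI impI)
  show "(\<lambda>(\<gamma>, p). \<gamma> p) \<in> topspace (prod_topology (mfd_top mapsM) (mfd_top M)) \<rightarrow> points N"
    by (auto simp: points_mapsM maps_def)
  fix V assume V: "openin (mfd_top N) V"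
  have "Hausdorff_space (mfd_top M)" using M by (simp add: manifold_with_corners_def)
  \<comment> \<open>A compact Hausdorff space is regular, so \<open>p\<close> has a closed and
    therefore compact neighbourhood \<open>K\<close> inside the preimage of \<open>V\<close> under
    \<open>\<gamma>\<close>. All maps sending \<open>K\<close> into \<open>V\<close>, paired with
    points of \<open>K\<close> near \<open>p\<close>, evaluate into \<open>V\<close>.\<close>
  then have nb: "neighbourhood_base_of (closedin (mfd_top M)) (mfd_top M)"
    using compact compact_Hausdorff_imp_regular_space neighbourhood_base_of_closedin by blast
  show "openin (prod_topology (mfd_top mapsM) (mfd_top M))
      {z \<in> topspace (prod_topology (mfd_top mapsM) (mfd_top M)). (\<lambda>(\<gamma>, p). \<gamma> p) z \<in> V}"
    unfolding openin_prod_topology_alt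
  proof (intro allI impI)
    fix \<gamma> p assume "(\<gamma>, p) \<in> {z \<in> topspace (prod_topology (mfd_top mapsM) (mfd_top M)). (\<lambda>(\<gamma>, p). \<gamma> p) z \<in> V}"
    then have \<gamma>: "\<gamma> \<in> maps_MN" and p: "p \<in> points M" "\<gamma> p \<in> V" by (auto simp: points_mapsM)
    have "openin (mfd_top M) {q \<in> points M. \<gamma> q \<in> V}"
      by (rule openin_continuous_map_preimage[OF maps_continuous[OF \<gamma> N_chart_atlas] V])
    then obtain B K where B: "openin (mfd_top M) B" "closedin (mfd_top M) K" "p \<in> B" "B \<subseteq> K"
      "K \<subseteq> {q \<in> points M. \<gamma> q \<in> V}"
      using nb[unfolded neighbourhood_base_of, rule_format, of "{q \<in> points M. \<gamma> q \<in> V}" p] p by blast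
    have K: "compactin (mfd_top M) K" by (rule closedin_compact_space[OF compact B(2)])
    show "\<exists>A B. openin (mfd_top mapsM) A \<and> openin (mfd_top M) B \<and> \<gamma> \<in> A \<and> p \<in> B \<and>
        A \<times> B \<subseteq> {z \<in> topspace (prod_topology (mfd_top mapsM) (mfd_top M)). (\<lambda>(\<gamma>, p). \<gamma> p) z \<in> V}"
    proof (intro exI conjI)
      show "openin (mfd_top mapsM) {\<xi> \<in> maps_MN. \<xi> ` K \<subseteq> V}" by (rule openin_maps_compact[OF K V])
      show "\<gamma> \<in> {\<xi> \<in> maps_MN. \<xi> ` K \<subseteq> V}" using \<gamma> B(5) by blast
      show "{\<xi> \<in> maps_MN. \<xi> ` K \<subseteq> V} \<times> B \<subseteq>
          {z \<in> topspace (prod_topology (mfd_top mapsM) (mfd_top M)). (\<lambda>(\<gamma>, p). \<gamma> p) z \<in> V}"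
        using B(4) openin_subset[OF B(1)] by (auto simp: points_mapsM)
    qed (fact B)+
  qed
qed

lemma point_evaluation_continuous:
  assumes p: "p \<in> points M"
  shows "continuous_map (mfd_top mapsM) (mfd_top N) (\<lambda>\<gamma>. \<gamma> p)"
proof -
  have "continuous_map (mfd_top mapsM) (prod_topology (mfd_top mapsM) (mfd_top M)) (\<lambda>\<gamma>. (\<gamma>, p))"
    using p by (intro continuous_map_pairedI) auto
  from continuous_map_compose[OF this evaluation_continuous] show ?thesis by (simp add: comp_def)
qed

lemma section_coordinates_continuous:
  assumes \<gamma>: "\<gamma> \<in> maps_MN" and p: "p \<in> points M" and e: "e \<in> mfd_atlas N" "\<gamma> p \<in> ch_dom e"
  shows "continuous_map (sections_topology m \<U> \<F> M n N \<gamma>) (top_of_set (vecs (2 * n)))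
     (\<lambda>\<sigma>. join_coords n (ch_map e (\<gamma> p)) (snd (\<sigma> p) e))"
proof -
  let ?T = "sections_topology m \<U> \<F> M n N \<gamma>"
  have "continuous_map ?T (subtopology (mfd_top TN) (ch_dom (tch e))) (\<lambda>\<sigma>. \<sigma> p)"
    unfolding continuous_map_in_subtopology
  proof
    show "continuous_map ?T (mfd_top TN) (\<lambda>\<sigma>. \<sigma> p)"
      unfolding continuous_map_def
    proof (intro conjI allI impI)
      show "(\<lambda>\<sigma>. \<sigma> p) \<in> topspace ?T \<rightarrow> points TN"
        using sections_sub p by (auto simp: topspace_sections points_TN)
      fix V assume "openin (mfd_top TN) V"
      \<comment> \<open>Evaluation at \<open>p\<close> is the case of a one-point compact
        set.\<close>
      from openin_sections_compact[OF \<gamma> _ this, of "{p}"] p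
      show "openin ?T {\<sigma> \<in> topspace ?T. \<sigma> p \<in> V}" by (simp add: topspace_sections)
    qed
    show "(\<lambda>\<sigma>. \<sigma> p) \<in> topspace ?T \<rightarrow> ch_dom (tch e)"
      using tch_section(1)[where \<gamma> = \<gamma>, OF _ p e] by (auto simp: topspace_sections)
  qed
  from continuous_map_compose[OF this chart_continuous[OF tch_is_chart[OF e(1)]]]
  have "continuous_map ?T (top_of_set (vecs (2 * n))) (\<lambda>\<sigma>. ch_map (tch e) (\<sigma> p))"
    by (simp only: comp_def ltop_euclid)
  then show ?thesis
    by (rule continuous_map_eq) (use tch_section(2)[where \<gamma> = \<gamma>, OF _ p e] in \<open>auto simp: topspace_sections\<close>)
qed

text \<open>In a tangent chart the base half of \<open>\<sigma> p\<close> is constant in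
  \<open>\<sigma>\<close>, since all sections lie over \<open>\<gamma>\<close>, while the fibre half
  is linear. So \<open>bsmooth_affine\<close> applies, with \<open>A\<close> these coordinates and
  \<open>L\<close> the same with base half 0.\<close>

lemma point_evaluation_bsmooth:
  assumes \<gamma>: "\<gamma> \<in> maps_MN" and p: "p \<in> points M" and d: "d \<in> mfd_atlas N"
  shows "bsmooth (sections_lcs m \<U> \<F> M n N \<gamma>) (euclid n)
     {\<sigma> \<in> V_dom \<gamma>. \<Sigma> (\<sigma> p) \<in> ch_dom d} (\<lambda>\<sigma>. ch_map d (\<Sigma> (\<sigma> p)))"
proof -
  let ?E = "sections_lcs m \<U> \<F> M n N \<gamma>"
  let ?T = "sections_topology m \<U> \<F> M n N \<gamma>"
  have top: "ltop ?E = ?T" by (simp add: sections_lcs_def)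
  have "\<gamma> p \<in> points N" using \<gamma> p by (auto simp: maps_def)
  then obtain e where e: "e \<in> mfd_atlas N" "\<gamma> p \<in> ch_dom e" using maximal_atlasD(1)[OF N_atlas] by blast
  define A where "A \<sigma> = join_coords n (ch_map e (\<gamma> p)) (snd (\<sigma> p) e)" for \<sigma> :: "'p \<Rightarrow> 'q tangent"
  define L where "L \<sigma> = (if \<sigma> \<in> Gam \<gamma> then join_coords n (\<lambda>i. 0) (snd (\<sigma> p) e) else (\<lambda>i. 0))" for \<sigma> :: "'p \<Rightarrow> 'q tangent"
  let ?S = "{\<sigma> \<in> V_dom \<gamma>. \<Sigma> (\<sigma> p) \<in> ch_dom d}"
  define T where "T = ch_map (tch e) ` {x \<in> ch_dom (tch e) \<inter> \<Omega>. \<Sigma> x \<in> ch_dom d}"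
  note loc = smooth_map_local_form[OF TN_chart_atlas N_chart_atlas Sigma tch_in_atlas[OF e(1)] d, folded T_def]
  have contA: "continuous_map ?T (top_of_set (vecs (2 * n))) A"
    using section_coordinates_continuous[OF \<gamma> p e] by (simp add: A_def[abs_def])
  have A_tch: "A \<sigma> = ch_map (tch e) (\<sigma> p)" if "\<sigma> \<in> Gam \<gamma>" for \<sigma>
    using tch_section(2)[where \<gamma> = \<gamma>, OF that p e] by (simp add: A_def)
  have "bsmooth ?E (euclid n) ?S (\<lambda>\<sigma>. (ch_map d \<circ> \<Sigma> \<circ> ch_inv (tch e)) (A \<sigma>))"
  proof (rule bsmooth_affine[where A = A and L = L and g = "ch_map d \<circ> \<Sigma> \<circ> ch_inv (tch e)"])
    show "bsmooth (euclid (2 * n)) (euclid n) T (ch_map d \<circ> \<Sigma> \<circ> ch_inv (tch e))" by (rule loc(2))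
    show "openin (ltop (euclid (2 * n))) T" using loc(1) by simp
    show "?S \<subseteq> lcarrier ?E" by (auto simp: top topspace_sections)
    show "continuous_map (subtopology (ltop ?E) ?S) (ltop (euclid (2 * n))) A"
      using contA by (simp add: top continuous_map_from_subtopology)
    show "A ` ?S \<subseteq> T"
      using A_tch tch_section(1)[where \<gamma> = \<gamma>, OF _ p e] p by (auto simp: T_def image_subset_iff)
    have "continuous_map ?T (top_of_set (vecs (2 * n))) L"
      unfolding continuous_map_vecs_iff
    proof (intro conjI allI impI)
      show "L \<in> topspace ?T \<rightarrow> vecs (2 * n)"
        using contA unfolding continuous_map_vecs_iff
        by (auto simp: topspace_sections L_def A_def join_coords_def Pi_iff split: if_splits)
      fix i assume i: "i < 2 * n"
      \<comment> \<open>On sections, \<open>L\<close> arises from \<open>A\<close> by replacing the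
        base coordinates with 0, so it inherits continuity.\<close>
      have "continuous_map ?T euclideanreal (\<lambda>\<sigma>. if i < n then 0 else A \<sigma> i)"
        using contA i by (cases "i < n") (simp_all add: continuous_map_vecs_iff)
      then show "continuous_map ?T euclideanreal (\<lambda>\<sigma>. L \<sigma> i)"
        by (rule continuous_map_eq) (auto simp: topspace_sections L_def A_def join_coords_def)
    qed
    then show "continuous_map (ltop ?E) (ltop (euclid (2 * n))) L" by (simp add: top)
    fix \<sigma> \<tau> t assume \<sigma>: "\<sigma> \<in> ?S" and "\<tau> \<in> lcarrier ?E"
    then have \<tau>: "\<tau> \<in> Gam \<gamma>" by (simp add: top topspace_sections)
    have fsts: "fst (\<sigma> p) = \<gamma> p" "fst (\<tau> p) = \<gamma> p" using \<sigma> \<tau> p by (auto simp: sections_def)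
    have "e \<in> charts_at N (\<gamma> p)" using e by (simp add: charts_at_def)
    then have "snd (ladd ?E \<sigma> (lscale ?E t \<tau>) p) e = (\<lambda>i. snd (\<sigma> p) e i + t * snd (\<tau> p) e i)"
      using p fsts e(1) by (simp add: sections_lcs_def tangent_add_def tangent_scale_def)
    then show "A (ladd ?E \<sigma> (lscale ?E t \<tau>)) =
        ladd (euclid (2 * n)) (A \<sigma>) (lscale (euclid (2 * n)) t (L \<tau>))"
      using \<tau> by (auto simp: A_def L_def join_coords_def fun_eq_iff)
  qed
  then show ?thesis
  proof (rule bsmooth_cong)
    fix \<sigma> assume "\<sigma> \<in> ?S"
    then have "\<sigma> \<in> Gam \<gamma>" by simp
    then show "ch_map d (\<Sigma> (\<sigma> p)) = (ch_map d \<circ> \<Sigma> \<circ> ch_inv (tch e)) (A \<sigma>)"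
      using A_tch chart_inv_map[OF tch_is_chart[OF e(1)] tch_section(1)[where \<gamma> = \<gamma>, OF _ p e]] by simp
  qed
qed

lemma point_evaluation_smooth:
  assumes p: "p \<in> points M"
  shows "smooth_map_on mapsM N maps_MN (\<lambda>\<gamma>. \<gamma> p)"
  unfolding smooth_map_on_def
proof (intro conjI ballI)
  show "openin (mfd_top mapsM) maps_MN" using openin_topspace[of "mfd_top mapsM"] by (simp only: points_mapsM)
  show "continuous_map (subtopology (mfd_top mapsM) maps_MN) (mfd_top N) (\<lambda>\<gamma>. \<gamma> p)"
    by (rule continuous_map_from_subtopology[OF point_evaluation_continuous[OF p]])
  fix c d assume "c \<in> mfd_atlas mapsM" and d: "d \<in> mfd_atlas N"
  then obtain \<gamma> where \<gamma>: "\<gamma> \<in> maps_MN" "c = mch \<gamma>" by (auto simp: mapsM_simps(2))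
  let ?W = "{\<xi> \<in> maps_MN. \<xi> p \<in> ch_dom d}"
  have "{\<xi> \<in> ch_dom c \<inter> maps_MN. \<xi> p \<in> ch_dom d} = ?W \<inter> U_dom \<gamma>"
    by (auto simp: \<gamma>(2) mch_simps(2))
  then have "ch_map c ` {\<xi> \<in> ch_dom c \<inter> maps_MN. \<xi> p \<in> ch_dom d} = {\<sigma> \<in> V_dom \<gamma>. Psi \<sigma> \<in> ?W}"
    using mch_image[OF \<gamma>(1)] \<gamma>(2) by simp
  also have "\<dots> = {\<sigma> \<in> V_dom \<gamma>. \<Sigma> (\<sigma> p) \<in> ch_dom d}"
    using mch_Psi[OF \<gamma>(1)] p by auto
  finally have img: "ch_map c ` {\<xi> \<in> ch_dom c \<inter> maps_MN. \<xi> p \<in> ch_dom d} =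
      {\<sigma> \<in> V_dom \<gamma>. \<Sigma> (\<sigma> p) \<in> ch_dom d}" .
  have "bsmooth (sections_lcs m \<U> \<F> M n N \<gamma>) (euclid n) {\<sigma> \<in> V_dom \<gamma>. \<Sigma> (\<sigma> p) \<in> ch_dom d}
      (ch_map d \<circ> (\<lambda>\<gamma>. \<gamma> p) \<circ> ch_inv c)"
  proof (rule bsmooth_cong[OF point_evaluation_bsmooth[OF \<gamma>(1) p d]])
    fix \<sigma> assume "\<sigma> \<in> {\<sigma> \<in> V_dom \<gamma>. \<Sigma> (\<sigma> p) \<in> ch_dom d}"
    then have "ch_inv c \<sigma> = Psi \<sigma>" unfolding \<gamma>(2) by (intro mch_inv[OF \<gamma>(1)]) simp
    then show "(ch_map d \<circ> (\<lambda>\<gamma>. \<gamma> p) \<circ> ch_inv c) \<sigma> = ch_map d (\<Sigma> (\<sigma> p))" using p by simp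
  qed
  then show "bsmooth (ch_model c) (ch_model d) (ch_map c ` {\<xi> \<in> ch_dom c \<inter> maps_MN. \<xi> p \<in> ch_dom d})
      (ch_map d \<circ> (\<lambda>\<gamma>. \<gamma> p) \<circ> ch_inv c)"
    unfolding img by (simp add: \<gamma>(2) mch_simps(1) N_model[OF d])
qed

end

theorem proposition4p14:
  fixes m n :: nat
    and \<U> :: "(nat \<Rightarrow> real) set set"
    and \<F> :: "(nat \<Rightarrow> real) set \<Rightarrow> ((nat \<Rightarrow> real) \<Rightarrow> real) topology"
    and M :: "('p, nat \<Rightarrow> real) mfd"
    and N :: "('q, nat \<Rightarrow> real) mfd"
    and \<Omega> :: "'q tangent set"
    and \<Sigma> :: "'q tangent \<Rightarrow> 'q"
  assumes "good_collection m \<U>"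
    and "suitable_for_global_analysis m \<U> \<F>"
    and "manifold_with_corners m M"
    and "compact_space (mfd_top M)"
    and "smooth_manifold n N"
    and "local_addition n N \<Omega> \<Sigma>"
  shows "continuous_map
           (prod_topology (mfd_top (maps_mfd m \<U> \<F> M n N \<Omega> \<Sigma>)) (mfd_top M)) (mfd_top N)
           (\<lambda>(\<gamma>, p). \<gamma> p)
       \<and> (\<forall>p\<in>points M.
            smooth_map_on (maps_mfd m \<U> \<F> M n N \<Omega> \<Sigma>) N (maps \<U> \<F> M n N) (\<lambda>\<gamma>. \<gamma> p))"
proof -
  interpret manifold_of_maps m \<U> \<F> M n N \<Omega> \<Sigma>
    by unfold_locales (rule assms)+
  show ?thesis using evaluation_continuous point_evaluation_smooth by blast
qed

end
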